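(* Fix $P\in\mathbb{R}^n$ and $T>0$. For $\epsilon=\frac1k$, $k\in\mathbb{N}$, let $(u^\epsilon,m^\epsilon)$ be the smooth solution of $$\begin{cases} -u_t^\epsilon-\epsilon\Delta u^\epsilon +\frac{1}{2}|\nabla u^\epsilon|^2=V\left(\frac{x}{\epsilon}, m^\epsilon \right), & x\in \mathbb{R}^n,\ t\in (0,T)\\ m^\epsilon_t-\epsilon \Delta m^\epsilon-\mathrm{div}(m^\epsilon\nabla u^\epsilon)=0,& x\in \mathbb{R}^n,\ t\in (0,T)\\ u^\epsilon(x,T)=P\cdot x,\qquad m^\epsilon(x, 0)\equiv 1,& x\in \mathbb{R}^n, \end{cases}$$ which is unique among solutions such that $x\mapsto u^\epsilon(x,t)-P\cdot x$ and $x\mapsto m^\epsilon(x,t)$ are $\epsilon\mathbb{Z}^n$-periodic for every $t\in[0,T]$. Let $$u^0(x,t)=P\cdot x+(t-T)\bar H(P,1),\qquad m^0(x,t)\equiv 1,$$ which is a solution of the effective problem $$\begin{cases} -u_t+\bar H(\nabla u, m)=0,& x\in\mathbb{R}^n,\ t\in(0,T)\\ m_t-\mathrm{div}(\bar b(\nabla u, m)\, m)=0,& x\in\mathbb{R}^n,\ t\in(0,T)\\ u(x,T)=P\cdot x,\quad m(x,0)=1,& x\in\mathbb{R}^n. \end{cases}$$ Then, as $\epsilon\to0$, for every compact $Q\subset\mathbb{R}^n$: (i) $u^\epsilon\to u^0$ in $L^2(Q\times[0,T])$; (ii) $m^\epsilon\to m^0$ weakly in $L^1(Q\times[0,T])$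.
   Context: $\mathbb{T}^n=\mathbb{R}^n/\mathbb{Z}^n$ is the unit torus; functions on $\mathbb{T}^n$ are identified with $\mathbb{Z}^n$-periodic functions on $\mathbb{R}^n$. Standing assumptions on $V:\mathbb{T}^n\times\mathbb{R}\to\mathbb{R}$: $V$ is a bounded $C^1$ function, $V\ge 0$, and for every compact interval $K\subset\mathbb{R}$ there is $\gamma_K>0$ with $V(y,m)-V(y,m')\ge\gamma_K(m-m')$ for all $m\ge m'$ in $K$ and all $y\in\mathbb{T}^n$. Effective operators: for $P\in\mathbb{R}^n$ and $\alpha\ge0$, $\bar H(P,\alpha)$ is the unique constant for which the cell problem $$-\Delta u+\tfrac12|\nabla u+P|^2-V(y,\alpha m)=\bar H(P,\alpha),\quad -\Delta m-\mathrm{div}(m(\nabla u+P))=0\ \text{ on }\mathbb{T}^n,\quad \int_{\mathbb{T}^n}u=0,\ \int_{\mathbb{T}^n}m=1$$ admits a solution $(u,m)$; this solution is unique, with $u\in C^{2,\gamma}(\mathbb{T}^n)$ for all $\gamma\in(0,1)$, $m\in W^{1,p}(\mathbb{T}^n)$ for all $p>1$, $m>0$. One sets $\bar b(P,\alpha)=\int_{\mathbb{T}^n}(\nabla u+P)\,m\,dy$. *)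

theory Defs
  imports "HOL-Analysis.Analysis"
begin

text \<open>Functions on the torus are represented by periodic functions on \<open>real^'n\<close>;
  integrals over the torus are integrals over the unit cell.\<close>

definition periodic :: "real \<Rightarrow> (real^'n \<Rightarrow> 'a) \<Rightarrow> bool" where
  "periodic r f \<longleftrightarrow> (\<forall>x k. (\<forall>i. k $ i \<in> \<int>) \<longrightarrow> f (x + r *\<^sub>R k) = f x)"

abbreviation unit_cell :: "(real^'n) set" where
  "unit_cell \<equiv> cbox 0 1"


subsection \<open>Differential operators and regularity classes\<close>

definition partial :: "'n \<Rightarrow> (real^'n \<Rightarrow> 'b::real_normed_vector) \<Rightarrow> real^'n \<Rightarrow> 'b" where
  "partial i f x = frechet_derivative f (at x) (axis i 1)"

definition grad :: "(real^'n \<Rightarrow> real) \<Rightarrow> real^'n \<Rightarrow> real^'n" where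
  "grad f x = (\<chi> i. partial i f x)"

definition divergence :: "(real^'n \<Rightarrow> real^'n) \<Rightarrow> real^'n \<Rightarrow> real" where
  "divergence F x = (\<Sum>i\<in>UNIV. partial i F x $ i)"

definition laplacian :: "(real^'n \<Rightarrow> real) \<Rightarrow> real^'n \<Rightarrow> real" where
  "laplacian f = divergence (grad f)"

definition C1 :: "('a::real_normed_vector \<Rightarrow> 'b::real_normed_vector) \<Rightarrow> bool" where
  "C1 f \<longleftrightarrow> (\<exists>f'. (\<forall>x. (f has_derivative blinfun_apply (f' x)) (at x)) \<and> continuous_on UNIV f')"

definition C2 :: "(real^'n \<Rightarrow> real) \<Rightarrow> bool" where
  "C2 f \<longleftrightarrow> C1 f \<and> C1 (grad f)"

text \<open>For periodic \<open>f\<close> the global Hoelder condition on \<open>real^'n\<close> is the one on the torus.\<close>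

definition C2_holder :: "real \<Rightarrow> (real^'n \<Rightarrow> real) \<Rightarrow> bool" where
  "C2_holder \<gamma> f \<longleftrightarrow> C2 f \<and>
     (\<forall>i. \<exists>C. \<forall>x y. norm (partial i (grad f) x - partial i (grad f) y) \<le> C * dist x y powr \<gamma>)"

definition Lp_cell :: "real \<Rightarrow> (real^'n \<Rightarrow> 'b::euclidean_space) \<Rightarrow> bool" where
  "Lp_cell p f \<longleftrightarrow> set_borel_measurable lborel unit_cell f \<and>
     set_integrable lborel unit_cell (\<lambda>y. norm (f y) powr p)"

text \<open>Weak gradient on the torus: periodic test functions leave no boundary terms.\<close>

definition weak_grad :: "(real^'n \<Rightarrow> real) \<Rightarrow> (real^'n \<Rightarrow> real^'n) \<Rightarrow> bool" where
  "weak_grad m g \<longleftrightarrow>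
     set_integrable lborel unit_cell m \<and> set_integrable lborel unit_cell g \<and>
     (\<forall>\<phi>. C1 \<phi> \<and> periodic 1 \<phi> \<longrightarrow>
        (LINT y:unit_cell|lborel. m y *\<^sub>R grad \<phi> y) = - (LINT y:unit_cell|lborel. \<phi> y *\<^sub>R g y))"


subsection \<open>The cell problem and the effective operators\<close>

text \<open>Since \<open>m\<close> lies in every \<open>W\<^sup>1\<^sup>,\<^sup>p\<close> it has a continuous representative, and \<open>m\<close> denotes that
  representative; so the first equation holds pointwise. The second equation is understood in
  the weak sense, \<open>g\<close> being the weak gradient of \<open>m\<close>.\<close>

definition cell_solution ::
  "(real^'n \<Rightarrow> real \<Rightarrow> real) \<Rightarrow> real^'n \<Rightarrow> real \<Rightarrow> real \<Rightarrow> (real^'n \<Rightarrow> real) \<Rightarrow> (real^'n \<Rightarrow> real) \<Rightarrow> bool"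
where
  "cell_solution V P \<alpha> H u m \<longleftrightarrow>
     periodic 1 u \<and> (\<forall>\<gamma>\<in>{0<..<1}. C2_holder \<gamma> u) \<and>
     periodic 1 m \<and> continuous_on UNIV m \<and> (\<forall>y. 0 < m y) \<and>
     (\<forall>y. - laplacian u y + 1/2 * (norm (grad u y + P))\<^sup>2 - V y (\<alpha> * m y) = H) \<and>
     (\<exists>g. weak_grad m g \<and> (\<forall>p>1. Lp_cell p m \<and> Lp_cell p g) \<and>
        (\<forall>\<phi>. C1 \<phi> \<and> periodic 1 \<phi> \<longrightarrow>
           (LINT y:unit_cell|lborel. (g y + m y *\<^sub>R (grad u y + P)) \<bullet> grad \<phi> y) = 0)) \<and>
     (LINT y:unit_cell|lborel. u y) = 0 \<and>
     (LINT y:unit_cell|lborel. m y) = 1"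

text \<open>\<open>Hbar P \<alpha>\<close> is the unique constant for which the cell problem has a solution, that solution
  is unique, and \<open>bbar P \<alpha>\<close> is its averaged drift.\<close>

definition effective_operators ::
  "(real^'n \<Rightarrow> real \<Rightarrow> real) \<Rightarrow> (real^'n \<Rightarrow> real \<Rightarrow> real) \<Rightarrow> (real^'n \<Rightarrow> real \<Rightarrow> real^'n) \<Rightarrow> bool"
where
  "effective_operators V Hbar bbar \<longleftrightarrow>
     (\<forall>P. \<forall>\<alpha>\<ge>0. \<exists>u m.
        (\<forall>H' u' m'. cell_solution V P \<alpha> H' u' m' \<longleftrightarrow> H' = Hbar P \<alpha> \<and> u' = u \<and> m' = m) \<and>
        bbar P \<alpha> = (LINT y:unit_cell|lborel. m y *\<^sub>R (grad u y + P)))"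


subsection \<open>The oscillating and the effective evolution problems\<close>

text \<open>Classical regularity for second order parabolic equations: twice continuously
  differentiable in space and once in time for \<open>0 < t < T\<close>, continuous up to \<open>t = 0\<close> and
  \<open>t = T\<close>. As the coupling is merely \<open>C\<^sup>1\<close>, solutions need not be infinitely differentiable.\<close>

definition C21 :: "real \<Rightarrow> (real^'n \<Rightarrow> real \<Rightarrow> real) \<Rightarrow> bool" where
  "C21 T w \<longleftrightarrow>
     continuous_on (UNIV \<times> {0..T}) (\<lambda>(x, t). w x t) \<and>
     (\<forall>t\<in>{0<..<T}. C2 (\<lambda>x. w x t)) \<and>
     (\<forall>x. \<forall>t\<in>{0<..<T}. w x differentiable (at t)) \<and>
     continuous_on (UNIV \<times> {0<..<T}) (\<lambda>(x, t). deriv (w x) t) \<and>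
     continuous_on (UNIV \<times> {0<..<T}) (\<lambda>(x, t). grad (\<lambda>y. w y t) x) \<and>
     (\<forall>i. continuous_on (UNIV \<times> {0<..<T}) (\<lambda>(x, t). partial i (grad (\<lambda>y. w y t)) x))"

definition mfg_solution ::
  "(real^'n \<Rightarrow> real \<Rightarrow> real) \<Rightarrow> real^'n \<Rightarrow> real \<Rightarrow> real \<Rightarrow>
   (real^'n \<Rightarrow> real \<Rightarrow> real) \<Rightarrow> (real^'n \<Rightarrow> real \<Rightarrow> real) \<Rightarrow> bool"
where
  "mfg_solution V P T \<epsilon> u m \<longleftrightarrow>
     C21 T u \<and> C21 T m \<and>
     (\<forall>x. \<forall>t\<in>{0<..<T}.
        - deriv (u x) t - \<epsilon> * laplacian (\<lambda>y. u y t) x + 1/2 * (norm (grad (\<lambda>y. u y t) x))\<^sup>2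
          = V (x /\<^sub>R \<epsilon>) (m x t) \<and>
        deriv (m x) t - \<epsilon> * laplacian (\<lambda>y. m y t) x
          - divergence (\<lambda>y. m y t *\<^sub>R grad (\<lambda>z. u z t) y) x = 0) \<and>
     (\<forall>x. u x T = P \<bullet> x \<and> m x 0 = 1)"

definition periodic_mfg_solution ::
  "(real^'n \<Rightarrow> real \<Rightarrow> real) \<Rightarrow> real^'n \<Rightarrow> real \<Rightarrow> real \<Rightarrow>
   (real^'n \<Rightarrow> real \<Rightarrow> real) \<Rightarrow> (real^'n \<Rightarrow> real \<Rightarrow> real) \<Rightarrow> bool"
where
  "periodic_mfg_solution V P T \<epsilon> u m \<longleftrightarrow>
     mfg_solution V P T \<epsilon> u m \<and>
     (\<forall>t\<in>{0..T}. periodic \<epsilon> (\<lambda>x. u x t - P \<bullet> x) \<and> periodic \<epsilon> (\<lambda>x. m x t))"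

definition effective_solution ::
  "(real^'n \<Rightarrow> real \<Rightarrow> real) \<Rightarrow> (real^'n \<Rightarrow> real \<Rightarrow> real^'n) \<Rightarrow> real^'n \<Rightarrow> real \<Rightarrow>
   (real^'n \<Rightarrow> real \<Rightarrow> real) \<Rightarrow> (real^'n \<Rightarrow> real \<Rightarrow> real) \<Rightarrow> bool"
where
  "effective_solution Hbar bbar P T u m \<longleftrightarrow>
     continuous_on (UNIV \<times> {0..T}) (\<lambda>(x, t). u x t) \<and>
     continuous_on (UNIV \<times> {0..T}) (\<lambda>(x, t). m x t) \<and>
     (\<forall>x. \<forall>t\<in>{0<..<T}.
        u x differentiable (at t) \<and> (\<lambda>y. u y t) differentiable (at x) \<and>
        m x differentiable (at t) \<and>
        (\<lambda>y. m y t *\<^sub>R bbar (grad (\<lambda>z. u z t) y) (m y t)) differentiable (at x) \<and>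
        - deriv (u x) t + Hbar (grad (\<lambda>y. u y t) x) (m x t) = 0 \<and>
        deriv (m x) t - divergence (\<lambda>y. m y t *\<^sub>R bbar (grad (\<lambda>z. u z t) y) (m y t)) x = 0) \<and>
     (\<forall>x. u x T = P \<bullet> x \<and> m x 0 = 1)"


subsection \<open>Modes of convergence\<close>

definition L2_on :: "'a::euclidean_space set \<Rightarrow> ('a \<Rightarrow> real) \<Rightarrow> bool" where
  "L2_on S f \<longleftrightarrow> set_borel_measurable lborel S f \<and> set_integrable lborel S (\<lambda>z. (f z)\<^sup>2)"

definition tendsto_L2 :: "'a::euclidean_space set \<Rightarrow> (nat \<Rightarrow> 'a \<Rightarrow> real) \<Rightarrow> ('a \<Rightarrow> real) \<Rightarrow> bool" where
  "tendsto_L2 S f f0 \<longleftrightarrow>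
     (\<forall>\<^sub>F k in sequentially. L2_on S (f k)) \<and> L2_on S f0 \<and>
     (\<lambda>k. sqrt (LINT z:S|lborel. (f k z - f0 z)\<^sup>2)) \<longlonglongrightarrow> 0"

text \<open>Weak convergence in \<open>L\<^sup>1\<close> is tested against all essentially bounded functions.\<close>

definition tendsto_weak_L1 :: "'a::euclidean_space set \<Rightarrow> (nat \<Rightarrow> 'a \<Rightarrow> real) \<Rightarrow> ('a \<Rightarrow> real) \<Rightarrow> bool" where
  "tendsto_weak_L1 S f f0 \<longleftrightarrow>
     (\<forall>\<^sub>F k in sequentially. set_integrable lborel S (f k)) \<and> set_integrable lborel S f0 \<and>
     (\<forall>\<psi>. set_borel_measurable lborel S \<psi> \<and> (\<exists>C. AE z in lborel. z \<in> S \<longrightarrow> \<bar>\<psi> z\<bar> \<le> C) \<longrightarrow>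
        (\<lambda>k. LINT z:S|lborel. f k z * \<psi> z) \<longlonglongrightarrow> (LINT z:S|lborel. f0 z * \<psi> z))"

end

theory Submission
  imports Defs
begin

text \<open>
  The proof compares the oscillating solution with an exact solution of the same equations. Let
  \<open>k = 1 / \<epsilon>\<close>. In the fast variable \<open>y = x / \<epsilon>\<close> the functions \<open>w (y, t) = k u (y / k, t) - P \<bullet> y\<close> and
  \<open>m (y / k, t)\<close> have period one and solve a mean field system in which \<open>k\<close> only multiplies the space
  operators. If \<open>v\<close>, \<open>\<mu>\<close> and \<open>H\<close> solve the cell problem for \<open>P\<close>, then \<open>v (y) + k H (t - T)\<close> and \<open>\<mu> (y)\<close>
  solve the same system, but with other data at times \<open>0\<close> and \<open>T\<close>. Undoing the scaling, this comparison
  function is \<open>P \<bullet> x + (t - T) H\<close> up to an error \<open>v (x / \<epsilon>) / k\<close>.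

  The two solutions are compared by the duality of Lasry and Lions: the integral over the cell of the
  product of the two differences decreases in time, and its dissipation is \<open>k\<close> times the sum of a
  weighted square of the difference of the gradients and the monotonicity defect of the coupling
  (\<open>lasry_lions\<close>, \<open>energy_identity\<close>). For equal data the pairing is zero at both ends, which gives uniqueness
  (\<open>mean_field_unique\<close>). For the comparison it is bounded independently of \<open>k\<close> (\<open>energy_bound\<close>), because a
  doubling of variables bounds the oscillation of \<open>w\<close> in space by a constant
  (\<open>hamilton_jacobi_oscillation\<close>) and both densities have mass one. Hence the total dissipation is of
  order \<open>1 / k\<close>.

  Two conclusions follow (\<open>homogenization\<close>). Strict monotonicity of the coupling makes the densities
  close in the mean. Moreover, the average of the gap of the value functions against \<open>\<mu>\<close> changes only
  by the dissipation and by the difference of the sources, so, divided by \<open>k\<close>, it tends to zero; as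
  the oscillation of the gap is bounded, the gap divided by \<open>k\<close> tends to zero uniformly. The first
  convergence is therefore even uniform. The second one follows since \<open>\<mu> (x / \<epsilon>)\<close> converges weakly to its
  mean value one (\<open>oscillating_mean_zero\<close>).

  Two points of regularity shape the argument. The density of the cell problem satisfies its equation
  only weakly; the predicate \<open>transported\<close> is the common formulation that suffices for the duality. The
  derivatives of the oscillating solutions are controlled only for \<open>0 < t < T\<close>; monotonicity in time of
  functions that are continuous up to the ends replaces integrals of derivatives.
\<close>

section \<open>Calculus of the regularity classes\<close>

lemma C1_has_derivative: "C1 f \<Longrightarrow> (f has_derivative frechet_derivative f (at x)) (at x)"
  unfolding C1_def by (meson differentiableI frechet_derivative_works)

lemma partial_eqI: "(f has_derivative f') (at x) \<Longrightarrow> partial i f x = f' (axis i 1)"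
  unfolding partial_def by (metis frechet_derivative_at)

text \<open>Since the space is finite dimensional, continuity of the derivative as an operator can be
  checked direction by direction.\<close>

lemma C1I:
  fixes f :: "real^'n \<Rightarrow> 'b::real_normed_vector"
  assumes "\<And>x. (f has_derivative f' x) (at x)" and "\<And>h. continuous_on UNIV (\<lambda>x. f' x h)"
  shows "C1 f"
  unfolding C1_def
proof (intro exI conjI allI)
  have bl: "bounded_linear (f' x)" for x
    using assms(1) has_derivative_bounded_linear by blast
  then show "(f has_derivative blinfun_apply (Blinfun (f' x))) (at x)" for x
    using assms(1) by (simp add: bounded_linear_Blinfun_apply)
  show "continuous_on UNIV (\<lambda>x. Blinfun (f' x))"
    by (rule continuous_on_blinfun_componentwise) (simp add: bl bounded_linear_Blinfun_apply assms(2))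
qed

lemma C1_derivative_continuous:
  assumes "C1 f" shows "continuous_on UNIV (\<lambda>x. frechet_derivative f (at x) h)"
proof -
  obtain f' where f': "\<And>x. (f has_derivative blinfun_apply (f' x)) (at x)" "continuous_on UNIV f'"
    using assms unfolding C1_def by blast
  have "frechet_derivative f (at x) h = blinfun_apply (f' x) h" for x
    by (metis f'(1) frechet_derivative_at)
  then show ?thesis using f'(2) by (auto intro!: continuous_intros)
qed

lemma C1_partial_continuous: "C1 f \<Longrightarrow> continuous_on UNIV (partial i f)"
  unfolding partial_def[abs_def] by (rule C1_derivative_continuous)

lemma C1_continuous: "C1 f \<Longrightarrow> continuous_on UNIV f"
  by (intro continuous_at_imp_continuous_on ballI has_derivative_continuous[OF C1_has_derivative])

lemma grad_nth [simp]: "grad f x $ i = partial i f x"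
  by (simp add: grad_def)

lemma C1_grad_continuous: "C1 f \<Longrightarrow> continuous_on UNIV (grad f)"
  unfolding grad_def[abs_def] by (intro continuous_on_vec_lambda C1_partial_continuous)

lemma partial_line:
  fixes f :: "real^'n \<Rightarrow> 'b::real_normed_vector"
  assumes "C1 f"
  shows "((\<lambda>s. f (x + s *\<^sub>R axis i 1)) has_vector_derivative partial i f (x + s *\<^sub>R axis i 1)) (at s)"
proof -
  let ?D = "frechet_derivative f (at (x + s *\<^sub>R axis i 1))"
  have "((\<lambda>s. x + s *\<^sub>R axis i 1 :: real^'n) has_derivative (\<lambda>h. h *\<^sub>R axis i 1)) (at s)"
    by (auto intro!: derivative_eq_intros)
  from has_derivative_compose[OF this C1_has_derivative[OF assms]]
  have "((\<lambda>s. f (x + s *\<^sub>R axis i 1)) has_derivative (\<lambda>h. ?D (h *\<^sub>R axis i 1))) (at s)" .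
  moreover have "?D (h *\<^sub>R axis i 1) = h *\<^sub>R ?D (axis i 1)" for h
    using C1_has_derivative[OF assms] has_derivative_linear linear_cmul by blast
  ultimately show ?thesis by (simp add: has_vector_derivative_def partial_def)
qed

lemma grad_line:
  "C1 f \<Longrightarrow> ((\<lambda>s. f (x + s *\<^sub>R axis i 1)) has_real_derivative partial i f (x + s *\<^sub>R axis i 1)) (at s)"
  using partial_line[of f x i s] by (simp add: has_real_derivative_iff_has_vector_derivative)

text \<open>Restriction to coordinate lines: Laplacian, maximum principle and integration by parts are
  all reduced to functions of one real variable.\<close>

lemma grad_partial_line:
  fixes f :: "real^'n \<Rightarrow> real"
  assumes "C2 f"
  shows "((\<lambda>s. partial j f (x + s *\<^sub>R axis i 1)) has_real_derivative
           partial i (grad f) (x + s *\<^sub>R axis i 1) $ j) (at s)"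
proof -
  have "C1 (grad f)" using assms by (simp add: C2_def)
  from bounded_linear.has_vector_derivative[OF bounded_linear_vec_nth[of j] partial_line[OF this, of x i s]]
  show ?thesis by (simp add: has_real_derivative_iff_has_vector_derivative)
qed

lemma C2_continuous:
  assumes "C2 f"
  shows "continuous_on UNIV f" "continuous_on UNIV (partial i f)"
    "continuous_on UNIV (\<lambda>x. partial i (grad f) x $ j)"
  using assms unfolding C2_def
  by (blast intro: C1_continuous C1_partial_continuous continuous_on_component)+

lemma laplacian_eq: "laplacian f x = (\<Sum>i\<in>UNIV. partial i (grad f) x $ i)"
  by (simp add: laplacian_def divergence_def)

lemma C1_scale:
  fixes f :: "real^'n \<Rightarrow> 'b::real_normed_vector"
  assumes "C1 f"
  shows "C1 (\<lambda>x. a *\<^sub>R f (c *\<^sub>R x))"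
    and "partial i (\<lambda>x. a *\<^sub>R f (c *\<^sub>R x)) x = (a * c) *\<^sub>R partial i f (c *\<^sub>R x)"
proof -
  let ?D = "\<lambda>x. frechet_derivative f (at x)"
  have *: "((\<lambda>x. a *\<^sub>R f (c *\<^sub>R x)) has_derivative (\<lambda>h. a *\<^sub>R ?D (c *\<^sub>R x) (c *\<^sub>R h))) (at x)" for x
    by (intro has_derivative_scaleR_right has_derivative_compose[OF _ C1_has_derivative[OF assms]])
       (auto intro!: derivative_eq_intros)
  have "continuous_on UNIV (\<lambda>x. a *\<^sub>R ?D (c *\<^sub>R x) (c *\<^sub>R h))" for h
    by (intro continuous_intros continuous_on_compose2[OF C1_derivative_continuous[OF assms]]) auto
  then show "C1 (\<lambda>x. a *\<^sub>R f (c *\<^sub>R x))" using C1I[OF *] by blast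
  have "linear (?D (c *\<^sub>R x))"
    using C1_has_derivative[OF assms] has_derivative_linear by blast
  then show "partial i (\<lambda>x. a *\<^sub>R f (c *\<^sub>R x)) x = (a * c) *\<^sub>R partial i f (c *\<^sub>R x)"
    unfolding partial_eqI[OF *] by (simp add: partial_def linear_cmul)
qed

lemma C1_diff:
  fixes f g :: "real^'n \<Rightarrow> 'b::real_normed_vector"
  assumes "C1 f" "C1 g"
  shows "C1 (\<lambda>x. f x - g x)" and "partial i (\<lambda>x. f x - g x) x = partial i f x - partial i g x"
proof -
  have *: "((\<lambda>x. f x - g x) has_derivative
      (\<lambda>h. frechet_derivative f (at x) h - frechet_derivative g (at x) h)) (at x)" for x
    by (intro has_derivative_diff C1_has_derivative assms)
  show "C1 (\<lambda>x. f x - g x)"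
    by (rule C1I[OF *]) (intro continuous_on_diff C1_derivative_continuous assms)
  show "partial i (\<lambda>x. f x - g x) x = partial i f x - partial i g x"
    unfolding partial_eqI[OF *] by (simp add: partial_def)
qed

lemma C1_const: "C1 (\<lambda>x::real^'n. c)" "partial i (\<lambda>x. c) x = 0"
  by (rule C1I[where f'="\<lambda>_ _. 0"]) (auto simp: partial_eqI[OF has_derivative_const])

lemma C1_inner: "C1 (\<lambda>x::real^'n. P \<bullet> x)" "partial i (\<lambda>x. P \<bullet> x) x = P $ i"
proof -
  have *: "((\<lambda>x. P \<bullet> x) has_derivative (\<lambda>h. P \<bullet> h)) (at x)" for x :: "real^'n"
    by (auto intro!: derivative_eq_intros)
  show "C1 (\<lambda>x::real^'n. P \<bullet> x)" by (rule C1I[OF *]) auto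
  show "partial i (\<lambda>x. P \<bullet> x) x = P $ i"
    unfolding partial_eqI[OF *] by (simp add: inner_axis)
qed

lemma grad_inner: "grad (\<lambda>x. P \<bullet> x) = (\<lambda>x. P)"
  by (simp add: fun_eq_iff vec_eq_iff C1_inner)

lemma C2_inner: "C2 (\<lambda>x. P \<bullet> x)"
  by (simp add: C2_def C1_inner grad_inner C1_const)

lemma C2_scale:
  assumes "C2 f"
  shows "C2 (\<lambda>x. a * f (c *\<^sub>R x))"
    and "partial i (\<lambda>x. a * f (c *\<^sub>R x)) x = a * c * partial i f (c *\<^sub>R x)"
    and "partial i (grad (\<lambda>x. a * f (c *\<^sub>R x))) x = (a * c\<^sup>2) *\<^sub>R partial i (grad f) (c *\<^sub>R x)"
proof -
  have C1: "C1 f" "C1 (grad f)" using assms by (auto simp: C2_def)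
  have g: "grad (\<lambda>x. a * f (c *\<^sub>R x)) = (\<lambda>x. (a * c) *\<^sub>R grad f (c *\<^sub>R x))"
    using C1_scale(2)[OF C1(1), of _ a c] by (simp add: fun_eq_iff vec_eq_iff)
  show "C2 (\<lambda>x. a * f (c *\<^sub>R x))"
    unfolding C2_def g using C1_scale(1)[OF C1(1), of a c] C1_scale(1)[OF C1(2)] by simp
  show "partial i (\<lambda>x. a * f (c *\<^sub>R x)) x = a * c * partial i f (c *\<^sub>R x)"
    using C1_scale(2)[OF C1(1), of _ a c] by simp
  show "partial i (grad (\<lambda>x. a * f (c *\<^sub>R x))) x = (a * c\<^sup>2) *\<^sub>R partial i (grad f) (c *\<^sub>R x)"
    unfolding g C1_scale(2)[OF C1(2)] by (simp add: power2_eq_square)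
qed

lemma C2_diff:
  assumes "C2 f" "C2 g"
  shows "C2 (\<lambda>x. f x - g x)"
    and "partial i (\<lambda>x. f x - g x) x = partial i f x - partial i g x"
    and "partial i (grad (\<lambda>x. f x - g x)) x = partial i (grad f) x - partial i (grad g) x"
proof -
  have C1: "C1 f" "C1 (grad f)" "C1 g" "C1 (grad g)" using assms by (auto simp: C2_def)
  have g: "grad (\<lambda>x. f x - g x) = (\<lambda>x. grad f x - grad g x)"
    using C1_diff(2)[OF C1(1,3)] by (simp add: fun_eq_iff vec_eq_iff)
  show "C2 (\<lambda>x. f x - g x)" unfolding C2_def g by (intro conjI C1_diff C1)
  show "partial i (\<lambda>x. f x - g x) x = partial i f x - partial i g x" by (intro C1_diff C1)
  show "partial i (grad (\<lambda>x. f x - g x)) x = partial i (grad f) x - partial i (grad g) x"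
    unfolding g by (intro C1_diff C1)
qed

lemma C21_D:
  assumes "C21 T w"
  shows "continuous_on (UNIV \<times> {0..T}) (\<lambda>(x, t). w x t)"
    "t \<in> {0<..<T} \<Longrightarrow> C2 (\<lambda>x. w x t)"
    "t \<in> {0<..<T} \<Longrightarrow> (w x has_real_derivative deriv (w x) t) (at t)"
    "continuous_on (UNIV \<times> {0<..<T}) (\<lambda>(x, t). deriv (w x) t)"
    "continuous_on (UNIV \<times> {0<..<T}) (\<lambda>(x, t). partial i (\<lambda>y. w y t) x)"
    "continuous_on (UNIV \<times> {0<..<T}) (\<lambda>(x, t). partial i (grad (\<lambda>y. w y t)) x)"
proof -
  note w = assms[unfolded C21_def]
  show "continuous_on (UNIV \<times> {0..T}) (\<lambda>(x, t). w x t)" "t \<in> {0<..<T} \<Longrightarrow> C2 (\<lambda>x. w x t)"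
    "continuous_on (UNIV \<times> {0<..<T}) (\<lambda>(x, t). deriv (w x) t)"
    "continuous_on (UNIV \<times> {0<..<T}) (\<lambda>(x, t). partial i (grad (\<lambda>y. w y t)) x)"
    using w by simp_all
  show "t \<in> {0<..<T} \<Longrightarrow> (w x has_real_derivative deriv (w x) t) (at t)"
    using w by (metis DERIV_deriv_iff_real_differentiable)
  have "continuous_on (UNIV \<times> {0<..<T}) (\<lambda>(x, t). grad (\<lambda>y. w y t) x)" using w by blast
  from continuous_on_component[OF this, of i]
  show "continuous_on (UNIV \<times> {0<..<T}) (\<lambda>(x, t). partial i (\<lambda>y. w y t) x)"
    by (simp add: split_beta)
qed

lemma C21_I:
  fixes w :: "real^'n \<Rightarrow> real \<Rightarrow> real"
  assumes "continuous_on (UNIV \<times> {0..T}) (\<lambda>(x, t). w x t)"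
    "\<And>t. t \<in> {0<..<T} \<Longrightarrow> C2 (\<lambda>x. w x t)"
    "\<And>x t. t \<in> {0<..<T} \<Longrightarrow> (w x has_real_derivative wt x t) (at t)"
    "continuous_on (UNIV \<times> {0<..<T}) (\<lambda>(x, t). wt x t)"
    "\<And>i. continuous_on (UNIV \<times> {0<..<T}) (\<lambda>(x, t). partial i (\<lambda>y. w y t) x)"
    "\<And>i. continuous_on (UNIV \<times> {0<..<T}) (\<lambda>(x, t). partial i (grad (\<lambda>y. w y t)) x)"
  shows "C21 T w"
proof -
  have "continuous_on (UNIV \<times> {0<..<T}) (\<lambda>(x, t). deriv (w x) t)"
    using assms(4) by (rule continuous_on_eq) (auto simp: DERIV_imp_deriv[OF assms(3)])
  moreover have "continuous_on (UNIV \<times> {0<..<T}) (\<lambda>(x, t). grad (\<lambda>y. w y t) x)"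
    using assms(5) unfolding grad_def split_beta by (intro continuous_on_vec_lambda)
  moreover have "w x differentiable (at t)" if "t \<in> {0<..<T}" for x t
    using assms(3)[OF that] real_differentiable_def by blast
  ultimately show ?thesis unfolding C21_def by (intro conjI ballI allI assms)
qed

lemma C21_diff:
  assumes "C21 T w" "C21 T v"
  shows "C21 T (\<lambda>x t. w x t - v x t)"
    and "t \<in> {0<..<T} \<Longrightarrow> deriv (\<lambda>t. w x t - v x t) t = deriv (w x) t - deriv (v x) t"
proof -
  note W = C21_D[OF assms(1)] and V = C21_D[OF assms(2)]
  have d: "((\<lambda>t. w x t - v x t) has_real_derivative deriv (w x) t - deriv (v x) t) (at t)"
    if "t \<in> {0<..<T}" for x t
    using W(3) V(3) that by (intro DERIV_diff) auto
  then show "t \<in> {0<..<T} \<Longrightarrow> deriv (\<lambda>t. w x t - v x t) t = deriv (w x) t - deriv (v x) t"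
    using DERIV_imp_deriv by blast
  show "C21 T (\<lambda>x t. w x t - v x t)"
  proof (rule C21_I[OF _ _ d])
    show "continuous_on (UNIV \<times> {0..T}) (\<lambda>(x, t). w x t - v x t)"
      using continuous_on_diff[OF W(1) V(1)] by (simp add: split_beta)
    show "continuous_on (UNIV \<times> {0<..<T}) (\<lambda>(x, t). deriv (w x) t - deriv (v x) t)"
      using continuous_on_diff[OF W(4) V(4)] by (simp add: split_beta)
    show "C2 (\<lambda>x. w x t - v x t)" if "t \<in> {0<..<T}" for t
      using C2_diff(1)[OF W(2) V(2)] that by blast
    show "continuous_on (UNIV \<times> {0<..<T}) (\<lambda>(x, t). partial i (\<lambda>y. w y t - v y t) x)" for i
      by (rule continuous_on_eq[OF continuous_on_diff[OF W(5) V(5)]])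
         (use C2_diff(2)[OF W(2) V(2)] in auto)
    show "continuous_on (UNIV \<times> {0<..<T}) (\<lambda>(x, t). partial i (grad (\<lambda>y. w y t - v y t)) x)" for i
      by (rule continuous_on_eq[OF continuous_on_diff[OF W(6) V(6)]])
         (use C2_diff(3)[OF W(2) V(2)] in auto)
  qed
qed

lemma C21_scale:
  assumes "C21 T w"
  shows "C21 T (\<lambda>x t. a * w (c *\<^sub>R x) t)"
    and "t \<in> {0<..<T} \<Longrightarrow> deriv (\<lambda>t. a * w (c *\<^sub>R x) t) t = a * deriv (w (c *\<^sub>R x)) t"
proof -
  note W = C21_D[OF assms(1)]
  have d: "((\<lambda>t. a * w (c *\<^sub>R x) t) has_real_derivative a * deriv (w (c *\<^sub>R x)) t) (at t)"
    if "t \<in> {0<..<T}" for x t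
    using W(3) that by (intro DERIV_cmult) auto
  then show "t \<in> {0<..<T} \<Longrightarrow> deriv (\<lambda>t. a * w (c *\<^sub>R x) t) t = a * deriv (w (c *\<^sub>R x)) t"
    using DERIV_imp_deriv by blast
  have comp: "continuous_on (UNIV \<times> S) (\<lambda>(x, t). b *\<^sub>R h (c *\<^sub>R x) t)"
    if "continuous_on (UNIV \<times> S) (\<lambda>(x, t). h x t)"
    for S :: "real set" and h :: "real^'a \<Rightarrow> real \<Rightarrow> 'd::real_normed_vector" and b :: real
  proof -
    have "continuous_on (UNIV \<times> S) (\<lambda>p. (\<lambda>(x, t). h x t) (c *\<^sub>R fst p, snd p))"
      by (rule continuous_on_compose2[OF that]) (auto intro!: continuous_intros)
    then show ?thesis by (auto simp: split_beta intro!: continuous_intros)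
  qed
  show "C21 T (\<lambda>x t. a * w (c *\<^sub>R x) t)"
  proof (rule C21_I[OF _ _ d])
    show "continuous_on (UNIV \<times> {0..T}) (\<lambda>(x, t). a * w (c *\<^sub>R x) t)"
      using comp[OF W(1), of a] by simp
    show "continuous_on (UNIV \<times> {0<..<T}) (\<lambda>(x, t). a * deriv (w (c *\<^sub>R x)) t)"
      using comp[OF W(4), of a] by simp
    show "C2 (\<lambda>x. a * w (c *\<^sub>R x) t)" if "t \<in> {0<..<T}" for t
      using C2_scale(1)[OF W(2)] that by blast
    show "continuous_on (UNIV \<times> {0<..<T}) (\<lambda>(x, t). partial i (\<lambda>y. a * w (c *\<^sub>R y) t) x)" for i
      by (rule continuous_on_eq[OF comp[OF W(5), of "a*c"]])
         (use C2_scale(2)[OF W(2)] in auto)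
    show "continuous_on (UNIV \<times> {0<..<T}) (\<lambda>(x, t). partial i (grad (\<lambda>y. a * w (c *\<^sub>R y) t)) x)" for i
      by (rule continuous_on_eq[OF comp[OF W(6), of "a*c\<^sup>2"]])
         (use C2_scale(3)[OF W(2)] in auto)
  qed
qed

lemma partial_add_const: "partial i (\<lambda>x. f x + c) x = partial i f x"
proof -
  have "((\<lambda>x. f x + c) has_derivative f') (at x) \<longleftrightarrow> (f has_derivative f') (at x)" for f'
    using has_derivative_add_const[of f f' "at x" c] has_derivative_add_const[of "\<lambda>x. f x + c" f' "at x" "-c"]
    by auto
  then show ?thesis unfolding partial_def frechet_derivative_def by simp
qed

lemma grad_add_const: "grad (\<lambda>x. f x + c) = grad f"
  by (simp add: fun_eq_iff vec_eq_iff partial_add_const)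

lemma C2_add_const: "C2 f \<Longrightarrow> C2 (\<lambda>x. f x + c)"
  using C1_diff(1)[OF _ C1_const(1), of f "-c"] by (simp add: C2_def grad_add_const)

text \<open>Profiles that move in time only by an affine function: the comparison solution of the cell
  problem and the affine boundary data are of this form.\<close>

lemma C21_stationary:
  assumes "C2 v"
  shows "C21 T (\<lambda>x t. v x + b * (t - T))"
    and "deriv (\<lambda>t. v x + b * (t - T)) t = b"
proof -
  have d: "((\<lambda>t. v x + b * (t - T)) has_real_derivative b) (at t)" for x t
    by (auto intro!: derivative_eq_intros)
  then show "deriv (\<lambda>t. v x + b * (t - T)) t = b"
    using DERIV_imp_deriv by blast
  have c: "continuous_on S (\<lambda>p. h (fst p))" if "continuous_on UNIV h"
    for S :: "((real^'a) \<times> real) set" and h :: "real^'a \<Rightarrow> 'd::real_normed_vector"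
    by (rule continuous_on_compose2[OF that]) (auto intro!: continuous_intros)
  show "C21 T (\<lambda>x t. v x + b * (t - T))"
  proof (rule C21_I[where wt="\<lambda>_ _. b"])
    show "((\<lambda>t. v x + b * (t - T)) has_real_derivative b) (at t)" for x t by (rule d)
    show "continuous_on (UNIV \<times> {0..T}) (\<lambda>(x, t). v x + b * (t - T))"
      unfolding split_beta by (intro continuous_intros c C2_continuous assms)
    show "C2 (\<lambda>x. v x + b * (t - T))" for t by (intro C2_add_const assms)
    show "continuous_on (UNIV \<times> {0<..<T}) (\<lambda>(x, t). partial i (\<lambda>y. v y + b * (t - T)) x)" for i
      unfolding partial_add_const split_beta by (intro c C2_continuous assms)
    show "continuous_on (UNIV \<times> {0<..<T}) (\<lambda>(x, t). partial i (grad (\<lambda>y. v y + b * (t - T))) x)" for i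
      unfolding grad_add_const split_beta
      by (intro c C1_partial_continuous) (use assms in \<open>simp add: C2_def\<close>)
  qed (simp add: split_beta)
qed

section \<open>Integrals of periodic functions over the unit cell\<close>

lemma periodic_axis:
  assumes "periodic 1 f" shows "f (x + axis i 1) = f x" "f (x + of_int n *\<^sub>R axis i 1) = f x"
proof -
  have k: "(of_int n *\<^sub>R axis i 1 :: real^'a) $ j \<in> \<int>" for n j
    by (simp add: axis_def)
  show *: "f (x + of_int n *\<^sub>R axis i 1) = f x" for n
    using assms k[of n] unfolding periodic_def by (metis scaleR_one)
  show "f (x + axis i 1) = f x" using *[of 1] by simp
qed

lemma continuous_integrable: "continuous_on UNIV G \<Longrightarrow> G integrable_on cbox a b"
  for G :: "'a::euclidean_space \<Rightarrow> 'b::banach"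
  by (rule integrable_continuous) (rule continuous_on_subset, auto)

lemma integral_split_axis:
  fixes G :: "real^'n \<Rightarrow> real"
  assumes G: "continuous_on UNIV G" and c: "a $ i \<le> c" "c \<le> b $ i"
  shows "integral (cbox a b) G = integral (cbox a (b + (c - b $ i) *\<^sub>R axis i 1)) G
           + integral (cbox (a + (c - a $ i) *\<^sub>R axis i 1) b) G"
proof -
  let ?e = "axis i 1 :: real^'n"
  have e: "?e \<in> Basis" by (simp add: axis_in_Basis_iff)
  have ex: "x \<bullet> ?e = x $ i" for x by (simp add: inner_axis)
  have nth: "(v + (c - v $ i) *\<^sub>R ?e) $ j = (if j = i then c else v $ j)" for v j
    by (simp add: axis_def)
  have 1: "cbox a b \<inter> {x. x \<bullet> ?e \<le> c} = cbox a (b + (c - b $ i) *\<^sub>R ?e)"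
    using c unfolding set_eq_iff Int_iff mem_box_cart mem_Collect_eq ex nth by (smt (verit))
  have 2: "cbox a b \<inter> {x. x \<bullet> ?e \<ge> c} = cbox (a + (c - a $ i) *\<^sub>R ?e) b"
    using c unfolding set_eq_iff Int_iff mem_box_cart mem_Collect_eq ex nth by (smt (verit))
  show ?thesis
    using integral_split[OF continuous_integrable[OF G, of a b] e, of c] unfolding 1 2 .
qed

lemma integral_periodic_translate_box:
  fixes G :: "real^'n \<Rightarrow> real"
  assumes "periodic 1 G"
  shows "integral (cbox (a + of_int n *\<^sub>R axis i 1) (b + of_int n *\<^sub>R axis i 1)) G = integral (cbox a b) G"
  using integral_shift_cbox[of "a + of_int n *\<^sub>R axis i 1" "of_int n *\<^sub>R axis i 1" "b + of_int n *\<^sub>R axis i 1" G]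
  by (simp add: periodic_axis[OF assms])

text \<open>A shift by \<open>h\<close> moves the layer of height \<open>h\<close> at the bottom of the cell to its top, and
  periodicity identifies the two: both integrals are the one over the cell enlarged by that layer,
  minus the same amount.\<close>

lemma integral_periodic_shift_nonneg:
  fixes G :: "real^'n \<Rightarrow> real"
  assumes G: "continuous_on UNIV G" "periodic 1 G" and h: "0 \<le> h" "h \<le> 1"
  shows "integral (cbox 0 1) (\<lambda>x. G (x + h *\<^sub>R axis i 1)) = integral (cbox 0 1) G"
proof -
  let ?e = "axis i 1 :: real^'n"
  have e: "?e $ i = 1" by simp
  have "integral (cbox 0 1) (\<lambda>x. G (x + h *\<^sub>R ?e)) = integral (cbox (h *\<^sub>R ?e) (1 + h *\<^sub>R ?e)) G"
    using integral_shift_cbox[of "h *\<^sub>R ?e" "h *\<^sub>R ?e" "1 + h *\<^sub>R ?e" G] by simp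
  moreover have "integral (cbox 0 (1 + h *\<^sub>R ?e)) G
      = integral (cbox 0 (1 + (h - 1) *\<^sub>R ?e)) G + integral (cbox (h *\<^sub>R ?e) (1 + h *\<^sub>R ?e)) G"
    using integral_split_axis[OF G(1), of 0 i h "1 + h *\<^sub>R ?e"] h e by (simp add: algebra_simps)
  moreover have "integral (cbox 0 (1 + h *\<^sub>R ?e)) G
      = integral (cbox 0 1) G + integral (cbox ?e (1 + h *\<^sub>R ?e)) G"
    using integral_split_axis[OF G(1), of 0 i 1 "1 + h *\<^sub>R ?e"] h e by (simp add: algebra_simps)
  moreover have "integral (cbox ?e (1 + h *\<^sub>R ?e)) G = integral (cbox 0 (1 + (h - 1) *\<^sub>R ?e)) G"
    using integral_periodic_translate_box[OF G(2), of 0 1 i "1 + (h - 1) *\<^sub>R ?e"] by (simp add: algebra_simps)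
  ultimately show ?thesis by simp
qed

lemma integral_periodic_shift:
  fixes G :: "real^'n \<Rightarrow> real"
  assumes G: "continuous_on UNIV G" "periodic 1 G"
  shows "integral (cbox 0 1) (\<lambda>x. G (x + h *\<^sub>R axis i 1)) = integral (cbox 0 1) G"
proof -
  have "G (x + h *\<^sub>R axis i 1) = G (x + frac h *\<^sub>R axis i 1)" for x
    using periodic_axis(2)[OF G(2), of "x + frac h *\<^sub>R axis i 1" "\<lfloor>h\<rfloor>" i]
    by (simp add: frac_def algebra_simps)
  then show ?thesis
    using integral_periodic_shift_nonneg[OF G, of "frac h" i] frac_lt_1[of h] by simp
qed

text \<open>Integration by parts on the torus. The integral of a shifted periodic function does not
  depend on the shift, so its derivative with respect to the shift vanishes.\<close>

lemma integral_periodic_derivative: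
  fixes F D :: "real^'n \<Rightarrow> real"
  assumes F: "continuous_on UNIV F" "periodic 1 F" and D: "continuous_on UNIV D"
    and der: "\<And>x s. ((\<lambda>s. F (x + s *\<^sub>R axis i 1)) has_real_derivative D (x + s *\<^sub>R axis i 1)) (at s)"
  shows "integral (cbox 0 1) D = 0"
proof -
  have "((\<lambda>s. integral (cbox 0 1) (\<lambda>x. F (x + s *\<^sub>R axis i 1))) has_real_derivative
      integral (cbox 0 1) (\<lambda>x. D (x + 0 *\<^sub>R axis i 1))) (at 0 within UNIV)"
  proof (rule leibniz_rule_field_derivative)
    show "(\<lambda>x. F (x + s *\<^sub>R axis i 1)) integrable_on cbox 0 1" for s
      by (intro continuous_integrable continuous_on_compose2[OF F(1)] continuous_intros) auto
    show "continuous_on (UNIV \<times> cbox 0 1) (\<lambda>(s, x). D (x + s *\<^sub>R axis i 1))"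
      unfolding split_beta by (intro continuous_on_compose2[OF D] continuous_intros) auto
  qed (use der in auto)
  then have "((\<lambda>s. integral (cbox 0 1) F) has_real_derivative integral (cbox 0 1) D) (at 0)"
    by (simp add: integral_periodic_shift[OF F])
  then show ?thesis using DERIV_unique[OF _ DERIV_const] by blast
qed

lemma integral_periodic_stretch_axis:
  fixes G :: "real^'n \<Rightarrow> real"
  assumes G: "continuous_on UNIV G" "periodic 1 G" and b: "b $ i = 0"
  shows "integral (cbox 0 (b + real N *\<^sub>R axis i 1)) G = real N * integral (cbox 0 (b + axis i 1)) G"
proof (induction N)
  case 0
  have "measure lborel (cbox 0 b) = 0"
    using b by (auto simp: content_eq_0_interior interval_ne_empty_cart(2) interval_eq_empty_cart intro: exI[of _ i])
  then have "integral (cbox 0 b) G = 0"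
    using integral_null by blast
  then show ?case by simp
next
  case (Suc N)
  let ?e = "axis i 1 :: real^'n"
  have "integral (cbox 0 (b + real (Suc N) *\<^sub>R ?e)) G
    = integral (cbox 0 (b + real N *\<^sub>R ?e)) G + integral (cbox (real N *\<^sub>R ?e) (b + ?e + real N *\<^sub>R ?e)) G"
    using integral_split_axis[OF G(1), of 0 i "real N" "b + real (Suc N) *\<^sub>R ?e"] b
    by (simp add: algebra_simps)
  also have "integral (cbox (real N *\<^sub>R ?e) (b + ?e + real N *\<^sub>R ?e)) G = integral (cbox 0 (b + ?e)) G"
    using integral_periodic_translate_box[OF G(2), of 0 "int N" i "b + ?e"] by simp
  finally show ?case using Suc.IH by (simp add: algebra_simps)
qed

text \<open>A cube of integer side is tiled by unit cells; the tiling is done one coordinate at a time.\<close>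

lemma integral_periodic_cube:
  fixes G :: "real^'n \<Rightarrow> real"
  assumes G: "continuous_on UNIV G" "periodic 1 G"
  shows "integral (cbox 0 (real N *\<^sub>R 1)) G = real N ^ CARD('n) * integral (cbox 0 1) G"
proof -
  have "integral (cbox 0 (\<chi> j. if j \<in> S then real N else 1)) G = real N ^ card S * integral (cbox 0 1) G"
    if "finite S" for S :: "'n set"
    using that
  proof induction
    case empty
    have "(\<chi> j. 1) = (1 :: real^'n)" by (simp add: vec_eq_iff)
    then show ?case by simp
  next
    case (insert i S)
    let ?b = "\<chi> j. if j = i then 0 else if j \<in> S then real N else 1 :: real^'n"
    have "(\<chi> j. if j \<in> insert i S then real N else 1) = ?b + real N *\<^sub>R axis i 1"
      "(\<chi> j. if j \<in> S then real N else 1) = ?b + axis i 1"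
      using insert by (auto simp: vec_eq_iff axis_def)
    with integral_periodic_stretch_axis[OF G, of ?b i N] insert show ?case by simp
  qed
  from this[of UNIV] have "integral (cbox 0 (\<chi> j. real N)) G = real N ^ CARD('n) * integral (cbox 0 1) G"
    by simp
  moreover have "(\<chi> j. real N) = (real N *\<^sub>R 1 :: real^'n)" by (simp add: vec_eq_iff)
  ultimately show ?thesis by simp
qed

lemma integral_periodic_dilate:
  fixes G :: "real^'n \<Rightarrow> real"
  assumes G: "continuous_on UNIV G" "periodic 1 G" and k: "1 \<le> k"
  shows "integral (cbox 0 1) (\<lambda>x. G (real k *\<^sub>R x)) = integral (cbox 0 1) G"
proof -
  have "(G has_integral real k ^ CARD('n) * integral (cbox 0 1) G) (cbox 0 (real k *\<^sub>R 1))"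
    using integral_periodic_cube[OF G, of k] continuous_integrable[OF G(1)]
    by (metis integrable_integral)
  from has_integral_affinity'[OF this, of "real k" 0] k
  have "((\<lambda>x. G (real k *\<^sub>R x)) has_integral integral (cbox 0 1) G) (cbox 0 1)"
    by (simp add: field_simps)
  then show ?thesis by (rule integral_unique)
qed

lemma integral_periodic_symmetric_cube:
  fixes G :: "real^'n \<Rightarrow> real"
  assumes G: "continuous_on UNIV G" "periodic 1 G"
  shows "integral (cbox (- (real N *\<^sub>R 1)) (real N *\<^sub>R 1)) G = (2 * real N) ^ CARD('n) * integral (cbox 0 1) G"
proof -
  let ?v = "- (real N *\<^sub>R 1) :: real^'n"
  have v: "?v $ i \<in> \<int>" for i by simp
  have "G (x + ?v) = G x" for x
    using G(2)[unfolded periodic_def, rule_format, of ?v x] v by simp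
  then have "integral (cbox ?v (real N *\<^sub>R 1)) G = integral (cbox 0 (real N *\<^sub>R 1 - ?v)) G"
    using integral_shift_cbox[of ?v ?v "real N *\<^sub>R 1" G] by simp
  also have "real N *\<^sub>R 1 - ?v = real (2 * N) *\<^sub>R 1" by (simp add: vec_eq_iff)
  finally show ?thesis using integral_periodic_cube[OF G, of "2*N"] by simp
qed

lemma periodic_reduce:
  assumes "periodic 1 f"
  obtains y where "y \<in> cbox 0 1" "f y = f (x::real^'n)"
proof
  let ?k = "- (\<chi> i. of_int \<lfloor>x $ i\<rfloor>) :: real^'n"
  have "\<forall>i. ?k $ i \<in> \<int>" by simp
  with assms have "f (x + 1 *\<^sub>R ?k) = f x" unfolding periodic_def by blast
  then show "f (x + ?k) = f x" by simp
  have "0 \<le> (x + ?k) $ i \<and> (x + ?k) $ i \<le> 1" for i by (simp; linarith)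
  then show "x + ?k \<in> cbox 0 1" unfolding mem_box_cart by simp
qed

text \<open>Periodic functions attain their maximum although the space is not compact. The extra compact
  parameter is the time in the maximum principles, and the pair of distance and time in the estimate
  of the oscillation.\<close>

lemma periodic_attains_sup:
  fixes f :: "real^'n \<Rightarrow> 'p::topological_space \<Rightarrow> real"
  assumes f: "continuous_on (UNIV \<times> K) (\<lambda>(x, p). f x p)" and K: "compact K" "K \<noteq> {}"
    and per: "\<And>p. p \<in> K \<Longrightarrow> periodic 1 (\<lambda>x. f x p)"
  shows "\<exists>x. \<exists>p\<in>K. \<forall>y. \<forall>q\<in>K. f y q \<le> f x p"
proof -
  have "compact (cbox (0::real^'n) 1 \<times> K)" using K by (intro compact_Times) auto
  moreover have "cbox (0::real^'n) 1 \<times> K \<noteq> {}" using K by (auto simp: interval_ne_empty_cart)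
  moreover have "continuous_on (cbox 0 1 \<times> K) (\<lambda>(x, p). f x p)"
    by (rule continuous_on_subset[OF f]) auto
  ultimately obtain z where z: "z \<in> cbox 0 1 \<times> K"
    "\<forall>z'\<in>cbox 0 1 \<times> K. (\<lambda>(x, p). f x p) z' \<le> (\<lambda>(x, p). f x p) z"
    using continuous_attains_sup by blast
  have "f y q \<le> f (fst z) (snd z)" if q: "q \<in> K" for y q
  proof -
    obtain y' where "y' \<in> cbox 0 1" "f y' q = f y q"
      using periodic_reduce[OF per[OF q], of y] by blast
    moreover have "f y' q \<le> f (fst z) (snd z)" if "y' \<in> cbox 0 1"
      using z(2) q that by (auto simp: split_beta)
    ultimately show ?thesis by metis
  qed
  then show ?thesis using z(1) by (metis mem_Times_iff)
qed

lemma periodic_bounded: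
  fixes f :: "real^'n \<Rightarrow> 'p::topological_space \<Rightarrow> real"
  assumes f: "continuous_on (UNIV \<times> K) (\<lambda>(x, p). f x p)" and K: "compact K"
    and per: "\<And>p. p \<in> K \<Longrightarrow> periodic 1 (\<lambda>x. f x p)"
  obtains C where "0 \<le> C" "\<And>y q. q \<in> K \<Longrightarrow> \<bar>f y q\<bar> \<le> C"
proof (cases "K = {}")
  case False
  have "continuous_on (UNIV \<times> K) (\<lambda>(x, p). \<bar>f x p\<bar>)"
    using f by (auto simp: split_beta intro!: continuous_intros)
  moreover have "periodic 1 (\<lambda>x. \<bar>f x p\<bar>)" if "p \<in> K" for p
    using per[OF that] unfolding periodic_def by auto
  ultimately have "\<exists>x. \<exists>p\<in>K. \<forall>y. \<forall>q\<in>K. \<bar>f y q\<bar> \<le> \<bar>f x p\<bar>"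
    by (rule periodic_attains_sup[OF _ K False])
  then obtain x p where "\<And>y q. q \<in> K \<Longrightarrow> \<bar>f y q\<bar> \<le> \<bar>f x p\<bar>" by blast
  then show thesis using that[of "\<bar>f x p\<bar>"] by auto
qed (use that in auto)

lemma continuous_time_independent:
  fixes h :: "real^'n \<Rightarrow> 'b::topological_space"
  assumes "continuous_on UNIV h"
  shows "continuous_on S (\<lambda>(x, t::real). h x)"
  unfolding split_beta by (rule continuous_on_compose2[OF assms]) (auto intro!: continuous_intros)

lemma periodic_function_bounded:
  fixes f :: "real^'n \<Rightarrow> real"
  assumes "continuous_on UNIV f" "periodic 1 f"
  obtains C where "0 \<le> C" "\<And>y. \<bar>f y\<bar> \<le> C"
  using periodic_bounded[OF continuous_time_independent[OF assms(1), of "UNIV \<times> {0}"]] assms(2) by auto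

lemma second_derivative_local_max:
  fixes g :: "real \<Rightarrow> real"
  assumes g: "\<And>s. (g has_real_derivative g' s) (at s)" and g': "(g' has_real_derivative d) (at 0)"
    and \<delta>: "0 < \<delta>" "\<And>s. \<bar>s\<bar> < \<delta> \<Longrightarrow> g s \<le> g 0"
  shows "g' 0 = 0" "d \<le> 0"
proof -
  show 0: "g' 0 = 0" using DERIV_local_max[OF g \<delta>(1)] \<delta>(2) by auto
  show "d \<le> 0"
  proof (rule ccontr)
    assume "\<not> d \<le> 0"
    then obtain \<eta> where \<eta>: "\<eta> > 0" "\<And>h. 0 < h \<Longrightarrow> h < \<eta> \<Longrightarrow> 0 < g' h"
      using DERIV_pos_inc_right[OF g'] 0 by auto
    define s where "s = min \<delta> \<eta> / 2"
    have s: "0 < s" "s < \<delta>" "s < \<eta>" using \<delta>(1) \<eta>(1) by (auto simp: s_def)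
    obtain z where z: "0 < z" "z < s" "g s - g 0 = (s - 0) * g' z"
      using MVT2[OF s(1), of g g'] g by auto
    then have "g s - g 0 > 0" using \<eta>(2)[of z] s by simp
    with \<delta>(2)[of s] s show False by simp
  qed
qed

section \<open>Maximum principles\<close>

lemma derivative_le_0_at_right_max:
  fixes g :: "real \<Rightarrow> real"
  assumes "(g has_real_derivative d) (at t)" "t < b" "\<And>s. t \<le> s \<Longrightarrow> s \<le> b \<Longrightarrow> g s \<le> g t"
  shows "d \<le> 0"
proof (rule ccontr)
  assume "\<not> d \<le> 0"
  then obtain \<eta> where \<eta>: "\<eta> > 0" "\<And>h. 0 < h \<Longrightarrow> h < \<eta> \<Longrightarrow> g t < g (t + h)"
    using DERIV_pos_inc_right[OF assms(1)] by auto
  define h where "h = min \<eta> (b - t) / 2"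
  have "0 < h" "h < \<eta>" "h \<le> b - t" using \<eta>(1) assms(2) by (auto simp: h_def)
  then show False using \<eta>(2)[of h] assms(3)[of "t + h"] by simp
qed

lemma derivative_ge_0_at_left_max:
  fixes g :: "real \<Rightarrow> real"
  assumes "(g has_real_derivative d) (at t)" "a < t" "\<And>s. a \<le> s \<Longrightarrow> s \<le> t \<Longrightarrow> g s \<le> g t"
  shows "0 \<le> d"
proof -
  have "((\<lambda>s. g (- s)) has_real_derivative - d) (at (- t))"
    using assms(1) by (subst DERIV_mirror[symmetric]) simp
  from derivative_le_0_at_right_max[OF this, of "- a"] assms(2,3) show ?thesis by simp
qed

lemma C2_at_max:
  fixes f :: "real^'n \<Rightarrow> real"
  assumes "C2 f" "\<And>y. f y \<le> f x"
  shows "partial i f x = 0" "partial i (grad f) x $ i \<le> 0"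
proof -
  have C1: "C1 f" using assms(1) by (simp add: C2_def)
  show "partial i f x = 0"
    using second_derivative_local_max(1)[OF grad_line[OF C1, of x i], of _ 1]
      grad_partial_line[OF assms(1), of i x i 0] assms(2) by simp
  show "partial i (grad f) x $ i \<le> 0"
    using second_derivative_local_max(2)[OF grad_line[OF C1, of x i], of _ 1]
      grad_partial_line[OF assms(1), of i x i 0] assms(2) by simp
qed

lemma has_derivative_translate:
  fixes f :: "'a::real_normed_vector \<Rightarrow> 'b::real_normed_vector"
  shows "(f has_derivative D) (at (x + a)) \<longleftrightarrow> ((\<lambda>y. f (y + a)) has_derivative D) (at x)"
proof -
  have *: "((\<lambda>y. g (y + b)) has_derivative D) (at z)" if "(g has_derivative D) (at (z + b))"
    for g :: "'a \<Rightarrow> 'b" and z b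
  proof -
    have "((\<lambda>y. y + b) has_derivative (\<lambda>h. h)) (at z)"
      by (auto intro!: derivative_eq_intros)
    from has_derivative_compose[OF this that] show ?thesis .
  qed
  show ?thesis using *[of f x a] *[of "\<lambda>y. f (y + a)" "x + a" "- a"] by auto
qed

lemma periodic_partial:
  assumes "periodic r f" shows "periodic r (partial i f)"
  unfolding periodic_def
proof (intro allI impI)
  fix x k :: "real^'a" assume "\<forall>i. k $ i \<in> \<int>"
  then have "(\<lambda>y. f (y + r *\<^sub>R k)) = f" using assms by (auto simp: periodic_def)
  then show "partial i f (x + r *\<^sub>R k) = partial i f x"
    unfolding partial_def frechet_derivative_def has_derivative_translate by simp
qed

lemma periodic_grad: "periodic r f \<Longrightarrow> periodic r (grad f)"
  using periodic_partial[of r f] unfolding periodic_def by (auto simp: vec_eq_iff)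

lemma periodic_laplacian: "periodic r f \<Longrightarrow> periodic r (laplacian f)"
  using periodic_partial[OF periodic_grad, of r f] unfolding periodic_def laplacian_eq by simp

lemma periodic_diff: "periodic r f \<Longrightarrow> periodic r g \<Longrightarrow> periodic r (\<lambda>x. f x - g x :: real)"
  unfolding periodic_def by simp

text \<open>The system in the fast variable \<open>y = x / \<epsilon>\<close> with \<open>k = 1 / \<epsilon>\<close>: if \<open>u\<close> and \<open>m\<close> solve the oscillating
  problem, then \<open>w (y, t) = k u (y / k, t) - P \<bullet> y\<close> and \<open>m (y / k, t)\<close> have period one, and the small
  parameter is left only as a factor in front of the time derivatives. The source \<open>F\<close> stands for
  the coupling evaluated at the density.\<close>

definition hamilton_jacobi ::
  "real^'n \<Rightarrow> real \<Rightarrow> real \<Rightarrow> (real^'n \<Rightarrow> real \<Rightarrow> real) \<Rightarrow> (real^'n \<Rightarrow> real \<Rightarrow> real) \<Rightarrow> bool" where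
  "hamilton_jacobi P k T F w \<longleftrightarrow> C21 T w \<and> (\<forall>t\<in>{0..T}. periodic 1 (\<lambda>x. w x t)) \<and>
    (\<forall>x. \<forall>t\<in>{0<..<T}. deriv (w x) t =
       k * (1/2 * (norm (grad (\<lambda>y. w y t) x + P))\<^sup>2 - laplacian (\<lambda>y. w y t) x - F x t))"

definition fokker_planck ::
  "real^'n \<Rightarrow> real \<Rightarrow> real \<Rightarrow> (real^'n \<Rightarrow> real \<Rightarrow> real) \<Rightarrow> (real^'n \<Rightarrow> real \<Rightarrow> real) \<Rightarrow> bool" where
  "fokker_planck P k T w m \<longleftrightarrow> C21 T m \<and> (\<forall>t\<in>{0..T}. periodic 1 (\<lambda>x. m x t)) \<and>
    (\<forall>x. \<forall>t\<in>{0<..<T}. deriv (m x) t =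
       k * (laplacian (\<lambda>y. m y t) x + grad (\<lambda>y. m y t) x \<bullet> (grad (\<lambda>y. w y t) x + P)
            + m x t * laplacian (\<lambda>y. w y t) x))"

lemma hamilton_jacobi_deriv:
  assumes "hamilton_jacobi P k T F w" "t \<in> {0<..<T}"
  shows "deriv (w x) t =
       k * (1/2 * (norm (grad (\<lambda>y. w y t) x + P))\<^sup>2 - laplacian (\<lambda>y. w y t) x - F x t)"
  using assms unfolding hamilton_jacobi_def by blast

lemma fokker_planck_deriv:
  assumes "fokker_planck P k T w m" "t \<in> {0<..<T}"
  shows "deriv (m x) t =
       k * (laplacian (\<lambda>y. m y t) x + grad (\<lambda>y. m y t) x \<bullet> (grad (\<lambda>y. w y t) x + P)
            + m x t * laplacian (\<lambda>y. w y t) x)"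
  using assms unfolding fokker_planck_def by blast

lemma C21_laplacian_continuous:
  assumes "C21 T w"
  shows "continuous_on (UNIV \<times> {0<..<T}) (\<lambda>(x, t). laplacian (\<lambda>y. w y t) x)"
proof -
  have "continuous_on (UNIV \<times> {0<..<T}) (\<lambda>p. \<Sum>i\<in>UNIV. (\<lambda>(x, t). partial i (grad (\<lambda>y. w y t)) x) p $ i)"
    by (intro continuous_on_sum continuous_on_component C21_D(6)[OF assms])
  then show ?thesis by (simp add: laplacian_eq split_beta)
qed

lemma continuous_time:
  assumes "continuous_on (UNIV \<times> S) (\<lambda>(x, t). w x t)"
  shows "continuous_on S (w x)"
proof -
  have "continuous_on S (\<lambda>t. (x, t))" by (intro continuous_intros)
  from continuous_on_compose2[OF assms this] show ?thesis by auto
qed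

lemma time_closure_le:
  fixes h :: "real \<Rightarrow> real"
  assumes "continuous_on {0..T} h" "0 < T" "\<And>t. 0 < t \<Longrightarrow> t < T \<Longrightarrow> h t \<le> c" "t \<in> {0..T}"
  shows "h t \<le> c"
  using continuous_le_on_closure[of "{0<..<T}" h t c] assms by auto

text \<open>At a maximum of the difference the gradients coincide; the Hamiltonian does not depend on the
  space variable otherwise, so it drops out.\<close>

lemma hamilton_jacobi_le:
  fixes w w' :: "real^'n \<Rightarrow> real \<Rightarrow> real"
  assumes w: "hamilton_jacobi P k T F w" and w': "hamilton_jacobi P k T F' w'"
    and k: "0 < k" and T: "0 < T"
    and F: "\<And>x t. t \<in> {0<..<T} \<Longrightarrow> F x t = F' x t"
    and final: "\<And>x. w x T = w' x T" and t: "t \<in> {0..T}"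
  shows "w x t \<le> w' x t"
proof -
  note W = w[unfolded hamilton_jacobi_def] and W' = w'[unfolded hamilton_jacobi_def]
  have C: "C21 T w" "C21 T w'" using W W' by auto
  note D = C21_D[OF C21_diff(1)[OF C]] and Dt = C21_diff(2)[OF C]
  \<comment> \<open>The tilt by \<open>\<delta> * (T - s)\<close> makes the time derivative strictly negative at a maximum.\<close>
  have le: "w y s - w' y s \<le> 0 + \<delta> * (T - s)" if \<delta>: "\<delta> > 0" and s: "0 < s" "s < T" for \<delta> y s
  proof (rule ccontr)
    assume neg: "\<not> ?thesis"
    define z where "z x t = w x t - w' x t - \<delta> * (T - t)" for x t
    have "continuous_on (UNIV \<times> {0..T}) (\<lambda>(x, t). z x t)"
      unfolding z_def split_beta
      by (intro continuous_on_diff[OF D(1)[unfolded split_beta]] continuous_intros)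
    then have "continuous_on (UNIV \<times> {s..T}) (\<lambda>(x, t). z x t)"
      by (rule continuous_on_subset) (use s in auto)
    moreover have "periodic 1 (\<lambda>x. z x t)" if "t \<in> {s..T}" for t
      unfolding z_def using W W' that s by (intro periodic_diff) (auto simp: periodic_def)
    ultimately have "\<exists>x. \<exists>p\<in>{s..T}. \<forall>y. \<forall>q\<in>{s..T}. z y q \<le> z x p"
      using s by (intro periodic_attains_sup) auto
    then obtain x t where t: "t \<in> {s..T}" and mx: "\<And>y q. q \<in> {s..T} \<Longrightarrow> z y q \<le> z x t" by blast
    have pos: "z x t > 0" using mx[of s y] neg s by (simp add: z_def)
    have "t \<noteq> T" using pos final by (auto simp: z_def)
    then have tT: "t \<in> {0<..<T}" "t < T" using t s by auto
    have "C2 (\<lambda>y. w y t - w' y t)" using D(2) tT by blast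
    moreover have "w y t - w' y t \<le> w x t - w' x t" for y
      using mx[of t y] t by (simp add: z_def)
    ultimately have cr: "partial i (\<lambda>y. w y t - w' y t) x = 0"
       "partial i (grad (\<lambda>y. w y t - w' y t)) x $ i \<le> 0" for i
      by (rule C2_at_max)+
    have c2: "C2 (\<lambda>y. w y t)" "C2 (\<lambda>y. w' y t)" using C21_D(2)[OF C(1)] C21_D(2)[OF C(2)] tT by auto
    \<comment> \<open>Equal gradients cancel the quadratic Hamiltonians, so only the Laplacians are compared.\<close>
    have g: "grad (\<lambda>y. w y t) x = grad (\<lambda>y. w' y t) x"
      using cr(1) C2_diff(2)[OF c2] by (simp add: vec_eq_iff)
    have l: "laplacian (\<lambda>y. w y t) x \<le> laplacian (\<lambda>y. w' y t) x"
      unfolding laplacian_eq using cr(2) C2_diff(3)[OF c2] by (intro sum_mono) simp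
    have "((\<lambda>t. z x t) has_real_derivative deriv (w x) t - deriv (w' x) t + \<delta>) (at t)"
    proof -
      have "((\<lambda>t. \<delta> * (T - t)) has_real_derivative - \<delta>) (at t)"
        by (auto intro!: derivative_eq_intros)
      from DERIV_diff[OF D(3)[OF tT(1), of x, unfolded Dt[OF tT(1), of x]] this]
      show ?thesis by (simp add: z_def)
    qed
    then have "deriv (w x) t - deriv (w' x) t + \<delta> \<le> 0"
      using derivative_le_0_at_right_max[of "z x" _ t T] tT mx t by auto
    moreover have "deriv (w x) t - deriv (w' x) t = k * (laplacian (\<lambda>y. w' y t) x - laplacian (\<lambda>y. w y t) x)"
      unfolding hamilton_jacobi_deriv[OF w tT(1)] hamilton_jacobi_deriv[OF w' tT(1)] g F[OF tT(1)]
      by (simp add: algebra_simps)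
    moreover have "0 \<le> k * (laplacian (\<lambda>y. w' y t) x - laplacian (\<lambda>y. w y t) x)"
      using l k by simp
    ultimately show False using \<delta> by linarith
  qed
  have "w y s - w' y s \<le> 0" if s: "0 < s" "s < T" for y s
  proof (rule field_le_epsilon)
    fix e :: real assume "e > 0"
    then show "w y s - w' y s \<le> 0 + e" using le[of "e / (T - s)" s y] s by simp
  qed
  moreover have "continuous_on {0..T} (\<lambda>t. w x t - w' x t)"
    using continuous_time[OF D(1)] .
  ultimately have "w x t - w' x t \<le> 0" using time_closure_le T t by blast
  then show ?thesis by simp
qed

text \<open>The regularity class controls second derivatives only inside the time interval, so a maximum
  principle on all of it is not available. It is started at a small positive time, up to which the
  density is close to its initial value one.\<close>

lemma fokker_planck_nonneg:
  fixes w m :: "real^'n \<Rightarrow> real \<Rightarrow> real"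
  assumes w: "C21 T w" "\<And>t. t \<in> {0..T} \<Longrightarrow> periodic 1 (\<lambda>x. w x t)"
    and m: "fokker_planck P k T w m" and k: "0 < k" and T: "0 < T"
    and initial: "\<And>x. m x 0 = 1" and t: "t \<in> {0..T}"
  shows "0 \<le> m x t"
proof -
  note M = m[unfolded fokker_planck_def]
  have C: "C21 T m" and per: "\<And>t. t \<in> {0..T} \<Longrightarrow> periodic 1 (\<lambda>x. m x t)" using M by auto
  note D = C21_D[OF C] and W = C21_D[OF w(1)]
  have "uniformly_continuous_on (cbox (0::real^'n) 1 \<times> {0..T}) (\<lambda>(x, t). m x t)"
    by (intro compact_uniformly_continuous continuous_on_subset[OF D(1)] compact_Times) auto
  then obtain d where d: "d > 0" "\<And>p q. p \<in> cbox (0::real^'n) 1 \<times> {0..T} \<Longrightarrow> q \<in> cbox 0 1 \<times> {0..T} \<Longrightarrow>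
      dist p q < d \<Longrightarrow> dist ((\<lambda>(x, t). m x t) p) ((\<lambda>(x, t). m x t) q) < 1/2"
    unfolding uniformly_continuous_on_def by (metis zero_less_divide_1_iff zero_less_numeral)
  define s0 where "s0 = min (d / 2) (T / 2)"
  have s0: "0 < s0" "s0 < T" "s0 < d" using d(1) T by (auto simp: s0_def)
  \<comment> \<open>Near the initial time positivity comes from continuity alone; the Laplacian of \<open>w\<close> may blow up there.\<close>
  have early: "m y s \<ge> 1/2" if s: "0 \<le> s" "s \<le> s0" for y s
  proof -
    obtain y' where y': "y' \<in> cbox 0 1" "m y' s = m y s"
      using periodic_reduce[OF per[of s], of y] s s0 by auto
    have "dist (m y' s) (m y' 0) < 1/2"
      using d(2)[of "(y', s)" "(y', 0)"] y' s s0 by (auto simp: dist_Pair_Pair)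
    then have "\<bar>m y s - 1\<bar> < 1/2" unfolding y'(2) initial dist_real_def .
    then show ?thesis by linarith
  qed
  have "0 \<le> m y s" if s: "0 < s" "s < T" for y s
  proof (rule ccontr)
    assume neg: "\<not> 0 \<le> m y s"
    have ss: "s0 < s" using early[of s y] neg s by (cases "s \<le> s0") auto
    have "continuous_on (UNIV \<times> {s0..s}) (\<lambda>(x, t). laplacian (\<lambda>y. w y t) x)"
      by (rule continuous_on_subset[OF C21_laplacian_continuous[OF w(1)]]) (use s s0 in auto)
    moreover have "periodic 1 (\<lambda>x. laplacian (\<lambda>y. w y t) x)" if "t \<in> {s0..s}" for t
      using w(2)[of t] that s s0 by (intro periodic_laplacian) auto
    ultimately obtain L where L: "0 \<le> L" "\<And>y q. q \<in> {s0..s} \<Longrightarrow> \<bar>laplacian (\<lambda>y. w y q) y\<bar> \<le> L"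
      using periodic_bounded[of "{s0..s}" "\<lambda>x t. laplacian (\<lambda>y. w y t) x"] by auto
    \<comment> \<open>The zeroth order coefficient is at most \<open>k * L\<close>; a discount by more than that gives the equation a sign.\<close>
    define l where "l = k * L + 1"
    define z where "z x t = - exp (- l * t) * m x t" for x t
    have "continuous_on (UNIV \<times> {0..T}) (\<lambda>(x, t). z x t)"
      unfolding z_def split_beta
      by (intro continuous_intros) (use D(1) in \<open>simp add: split_beta\<close>)
    then have "continuous_on (UNIV \<times> {s0..s}) (\<lambda>(x, t). z x t)"
      by (rule continuous_on_subset) (use s s0 in auto)
    moreover have "periodic 1 (\<lambda>x. z x t)" if "t \<in> {s0..s}" for t
      unfolding z_def using per[of t] that s s0 by (auto simp: periodic_def)
    ultimately have "\<exists>x. \<exists>p\<in>{s0..s}. \<forall>y. \<forall>q\<in>{s0..s}. z y q \<le> z x p"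
      using ss by (intro periodic_attains_sup) auto
    then obtain x t where t: "t \<in> {s0..s}" and mx: "\<And>y q. q \<in> {s0..s} \<Longrightarrow> z y q \<le> z x t" by blast
    have "z y s > 0" using neg by (simp add: z_def mult_pos_neg)
    with mx[of s y] ss have "z x t > 0" by simp
    then have mneg: "m x t < 0" by (simp add: z_def zero_less_mult_iff mult_less_0_iff)
    then have "t \<noteq> s0" using early[of s0 x] s0 by auto
    then have tT: "t \<in> {0<..<T}" "s0 < t" using t s s0 by auto
    have lo: "m x t \<le> m y t" for y using mx[of t y] t by (simp add: z_def)
    have c2: "C2 (\<lambda>y. m y t)" using D(2) tT by blast
    have "C2 (\<lambda>y. - 1 * m (1 *\<^sub>R y) t)" by (rule C2_scale(1)[OF c2])
    then have "C2 (\<lambda>y. - 1 * m (1 *\<^sub>R y) t)" "\<And>y. - 1 * m (1 *\<^sub>R y) t \<le> - 1 * m (1 *\<^sub>R x) t"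
      using lo by auto
    note cr = C2_at_max[OF this, unfolded C2_scale[OF c2]]
    have g: "grad (\<lambda>y. m y t) x = 0" using cr(1) by (simp add: vec_eq_iff)
    have lap: "0 \<le> laplacian (\<lambda>y. m y t) x" unfolding laplacian_eq using cr(2) by (intro sum_nonneg) simp
    have "(z x has_real_derivative - exp (- l * t) * (deriv (m x) t - l * m x t)) (at t)"
      unfolding z_def using D(3)[OF tT(1), of x] by (auto intro!: derivative_eq_intros simp: algebra_simps)
    from derivative_ge_0_at_left_max[OF this tT(2)] mx t
    have "0 \<le> - exp (- l * t) * (deriv (m x) t - l * m x t)" by auto
    then have "deriv (m x) t \<le> l * m x t"
      by (simp add: mult_le_0_iff zero_le_mult_iff not_le[symmetric])
    moreover have "deriv (m x) t = k * (laplacian (\<lambda>y. m y t) x + m x t * laplacian (\<lambda>y. w y t) x)"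
      unfolding fokker_planck_deriv[OF m tT(1)] g by simp
    moreover have "k * (m x t * L) \<le> k * (laplacian (\<lambda>y. m y t) x + m x t * laplacian (\<lambda>y. w y t) x)"
    proof -
      have "m x t * L \<le> m x t * laplacian (\<lambda>y. w y t) x"
        using L(2)[OF t, of x] mneg by (intro mult_left_mono_neg) auto
      then show ?thesis using lap k by (intro mult_left_mono) auto
    qed
    ultimately have "k * (m x t * L) \<le> (k * L + 1) * m x t" unfolding l_def by linarith
    then show False using mneg by (simp add: algebra_simps)
  qed
  then have "- m x t \<le> 0"
    using time_closure_le[of T "\<lambda>t. - m x t" 0 t] continuous_time[OF D(1), of x] T t
    by (auto intro!: continuous_intros)
  then show ?thesis by simp
qed

text \<open>The oscillation in space is bounded independently of \<open>k\<close> and of the regularity of \<open>F\<close>. The reason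
  is a doubling of variables: at a maximum of \<open>w (x + r e) - w x - B r (1 - r)\<close> the gradients at
  both points coincide, so the Hamiltonians cancel, while the concavity of the penalty makes the
  difference of the Laplacians at most \<open>- 8 B\<close>, which beats the difference of the sources. The
  penalty vanishes at \<open>r = 0\<close> and at \<open>r = 1\<close>, as the difference of the values does by
  periodicity, so the maximum lies at an interior \<open>r\<close>.\<close>

lemma hamilton_jacobi_oscillation_axis:
  fixes w :: "real^'n \<Rightarrow> real \<Rightarrow> real"
  assumes w: "hamilton_jacobi P k T F w" and k: "0 < k" and T: "0 < T"
    and F: "\<And>x t. 0 \<le> F x t \<and> F x t \<le> C" and final: "\<And>x. w x T = 0"
    and B: "C < 8 * B" and t: "t \<in> {0..T}" and r: "r \<in> {0..1}"
  shows "w (x + r *\<^sub>R axis i 1) t - w x t \<le> B * (r * (1 - r))"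
proof -
  note W = w[unfolded hamilton_jacobi_def]
  have Cw: "C21 T w" and per: "\<And>t. t \<in> {0..T} \<Longrightarrow> periodic 1 (\<lambda>x. w x t)" using W by auto
  note D = C21_D[OF Cw]
  let ?e = "axis i 1 :: real^'n"
  have B0: "0 < B" using F[of 0 0] B by linarith
  have "w (y + q *\<^sub>R ?e) s - w y s \<le> B * (q * (1 - q))" if s: "0 < s" "s < T" and q: "q \<in> {0..1}" for y s q
  proof (rule ccontr)
    assume neg: "\<not> ?thesis"
    define z where "z x p = w (x + fst p *\<^sub>R ?e) (snd p) - w x (snd p) - B * (fst p * (1 - fst p))" for x p
    let ?K = "{0..1::real} \<times> {s..T}"
    have "continuous_on (UNIV \<times> ?K) (\<lambda>a. (\<lambda>(x, t). w x t) (fst a + fst (snd a) *\<^sub>R ?e, snd (snd a)))"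
      by (rule continuous_on_compose2[OF D(1)]) (use s in \<open>auto intro!: continuous_intros\<close>)
    moreover have "continuous_on (UNIV \<times> ?K) (\<lambda>a. (\<lambda>(x, t). w x t) (fst a, snd (snd a)))"
      by (rule continuous_on_compose2[OF D(1)]) (use s in \<open>auto intro!: continuous_intros\<close>)
    ultimately have "continuous_on (UNIV \<times> ?K) (\<lambda>(x, p). z x p)"
      unfolding z_def split_beta by (intro continuous_intros) auto
    moreover have "periodic 1 (\<lambda>x. z x p)" if "p \<in> ?K" for p
    proof -
      have "periodic 1 (\<lambda>x. w x (snd p))" using that s by (intro per) auto
      then have sh: "w (y + v) (snd p) = w y (snd p)" if "\<forall>i. v $ i \<in> \<int>" for y v
        using that unfolding periodic_def scaleR_one by blast
      have "w (y + v + fst p *\<^sub>R ?e) (snd p) = w (y + fst p *\<^sub>R ?e) (snd p)"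
        if "\<forall>i. v $ i \<in> \<int>" for y v
        using sh[OF that, of "y + fst p *\<^sub>R ?e"] by (simp only: add.assoc add.commute[of v])
      then show ?thesis unfolding z_def periodic_def using sh by simp
    qed
    moreover have "(0, s) \<in> ?K" using s by auto
    then have "?K \<noteq> {}" by blast
    ultimately have "\<exists>x. \<exists>p\<in>?K. \<forall>y. \<forall>q\<in>?K. z y q \<le> z x p"
      by (intro periodic_attains_sup compact_Times) auto
    then obtain x p where p: "p \<in> ?K" and mx: "\<And>y q. q \<in> ?K \<Longrightarrow> z y q \<le> z x p" by blast
    obtain r t where rt: "p = (r, t)" by force
    define X where "X = x + r *\<^sub>R ?e"
    have r01: "0 \<le> r" "r \<le> 1" and ts: "s \<le> t" "t \<le> T" using p rt by auto
    have "z y (q, s) > 0" using neg by (simp add: z_def)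
    then have "z x (r, t) > 0" using mx[of "(q, s)" y] q s rt by auto
    then have pos: "w X t - w x t - B * (r * (1 - r)) > 0" by (simp add: z_def X_def)
    have "t \<noteq> T"
    proof
      assume "t = T"
      moreover have "0 \<le> B * (r * (1 - r))" using B0 r01 by simp
      ultimately show False using pos final by simp
    qed
    then have tT: "t \<in> {0<..<T}" "t < T" using ts s by auto
    \<comment> \<open>Both end points of the unit interval give the value zero: trivially at \<open>0\<close>, by periodicity at \<open>1\<close>.\<close>
    have "r \<noteq> 0" using pos by (auto simp: X_def)
    moreover have "r \<noteq> 1"
    proof
      assume "r = 1"
      then show False using pos periodic_axis(1)[OF per[of t], of x i] tT by (simp add: X_def)
    qed
    ultimately have r: "0 < r" "r < 1" using r01 by auto
    have c2: "C2 (\<lambda>y. w y t)" and c1: "C1 (\<lambda>y. w y t)" using D(2) tT by (auto simp: C2_def)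
    define d2 where "d2 j y = partial j (grad (\<lambda>y. w y t)) y $ j" for j y
    \<comment> \<open>Moving both points in parallel leaves the concave penalty unchanged.\<close>
    have par: "partial j (\<lambda>y. w y t) X = partial j (\<lambda>y. w y t) x \<and> d2 j X - d2 j x \<le> 0" for j
    proof -
      let ?g = "\<lambda>s. w (X + s *\<^sub>R axis j 1) t - w (x + s *\<^sub>R axis j 1) t"
      let ?g' = "\<lambda>s. partial j (\<lambda>y. w y t) (X + s *\<^sub>R axis j 1) - partial j (\<lambda>y. w y t) (x + s *\<^sub>R axis j 1)"
      have 1: "(?g has_real_derivative ?g' s) (at s)" for s
        by (intro DERIV_diff grad_line c1)
      have 2: "(?g' has_real_derivative d2 j X - d2 j x) (at 0)"
        using DERIV_diff[OF grad_partial_line[OF c2, of j X j 0] grad_partial_line[OF c2, of j x j 0]]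
        by (simp add: d2_def)
      have 3: "?g s \<le> ?g 0" for s
      proof -
        have "X + s *\<^sub>R axis j 1 = x + s *\<^sub>R axis j 1 + r *\<^sub>R ?e" by (simp add: X_def)
        then show ?thesis using mx[of "(r, t)" "x + s *\<^sub>R axis j 1"] p rt
          by (simp add: z_def X_def add_ac)
      qed
      show ?thesis using second_derivative_local_max[OF 1 2, of 1] 3 by simp
    qed
    \<comment> \<open>Moving the points apart at unit speed changes the distance at speed \<open>2\<close>: the penalty
      contributes \<open>4\<close> times its second derivative \<open>- 2 * B\<close>.\<close>
    have anti: "d2 i X - d2 i x + 8 * B \<le> 0"
    proof -
      let ?b = "\<lambda>s. B * ((r + 2 * s) * (1 - (r + 2 * s)))"
      let ?g = "\<lambda>s. w (X + s *\<^sub>R ?e) t - w (x + (- s) *\<^sub>R ?e) t - ?b s"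
      let ?g' = "\<lambda>s. partial i (\<lambda>y. w y t) (X + s *\<^sub>R ?e) + partial i (\<lambda>y. w y t) (x + (- s) *\<^sub>R ?e)
          - B * (2 - 4 * (r + 2 * s))"
      have 1: "(?g has_real_derivative ?g' s) (at s)" for s
      proof -
        have "((\<lambda>s. w (x + (- s) *\<^sub>R ?e) t) has_real_derivative
            - partial i (\<lambda>y. w y t) (x + (- s) *\<^sub>R ?e)) (at s)"
          using grad_line[OF c1, of x i "- s"] by (subst (asm) DERIV_mirror) simp
        moreover have "(?b has_real_derivative B * (2 - 4 * (r + 2 * s))) (at s)"
          by (auto intro!: derivative_eq_intros simp: algebra_simps)
        ultimately show ?thesis
          using grad_line[OF c1, of X i s] by (auto intro!: derivative_eq_intros)
      qed
      have "((\<lambda>s. partial i (\<lambda>y. w y t) (x + (- s) *\<^sub>R ?e)) has_real_derivative - d2 i x) (at 0)"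
        using grad_partial_line[OF c2, of i x i 0] DERIV_mirror[of "\<lambda>s. partial i (\<lambda>y. w y t) (x + s *\<^sub>R ?e)" "d2 i x" 0]
        by (simp add: d2_def)
      moreover have "((\<lambda>s. B * (2 - 4 * (r + 2 * s))) has_real_derivative - 8 * B) (at 0)"
        by (auto intro!: derivative_eq_intros simp: algebra_simps)
      ultimately have 2: "(?g' has_real_derivative d2 i X - d2 i x + 8 * B) (at 0)"
        using grad_partial_line[OF c2, of i X i 0] by (auto simp: d2_def intro!: derivative_eq_intros)
      let ?\<delta> = "min r (1 - r) / 2"
      have 3: "?g s \<le> ?g 0" if "\<bar>s\<bar> < ?\<delta>" for s
      proof -
        have "(2 * s) *\<^sub>R ?e = s *\<^sub>R ?e + s *\<^sub>R ?e" by (metis mult_2 scaleR_add_left)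
        then have eq: "X + s *\<^sub>R ?e = x + (- s) *\<^sub>R ?e + (r + 2 * s) *\<^sub>R ?e"
          by (simp add: X_def scaleR_add_left)
        have "z (x + (- s) *\<^sub>R ?e) (r + 2 * s, t) = ?g s"
          unfolding z_def fst_conv snd_conv eq ..
        moreover have "z x (r, t) = ?g 0" by (simp add: z_def X_def)
        moreover have "0 \<le> r + 2 * s" "r + 2 * s \<le> 1" using that by (auto simp: abs_less_iff)
        ultimately show ?thesis using mx[of "(r + 2 * s, t)" "x + (- s) *\<^sub>R ?e"] ts rt
          by (metis atLeastAtMost_iff mem_Times_iff fst_conv snd_conv)
      qed
      show ?thesis using second_derivative_local_max(2)[OF 1 2, of ?\<delta>] 3 r by auto
    qed
    have lap: "laplacian (\<lambda>y. w y t) X - laplacian (\<lambda>y. w y t) x \<le> - 8 * B"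
    proof -
      have "laplacian (\<lambda>y. w y t) X - laplacian (\<lambda>y. w y t) x = (\<Sum>j\<in>UNIV. d2 j X - d2 j x)"
        by (simp add: laplacian_eq d2_def sum_subtractf)
      also have "\<dots> \<le> (\<Sum>j\<in>UNIV. if j = i then - 8 * B else 0)"
        using par anti by (intro sum_mono) auto
      finally show ?thesis by simp
    qed
    have "((\<lambda>t. w X t - w x t) has_real_derivative deriv (w X) t - deriv (w x) t) (at t)"
      using D(3)[OF tT(1)] by (intro DERIV_diff)
    moreover have "w X s' - w x s' \<le> w X t - w x t" if "t \<le> s'" "s' \<le> T" for s'
      using mx[of "(r, s')" x] that r01 ts rt by (simp add: z_def X_def)
    ultimately have "deriv (w X) t - deriv (w x) t \<le> 0"
      using derivative_le_0_at_right_max tT(2) by blast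
    moreover have "grad (\<lambda>y. w y t) X = grad (\<lambda>y. w y t) x" using par by (simp add: vec_eq_iff)
    then have "deriv (w X) t - deriv (w x) t
      = k * (laplacian (\<lambda>y. w y t) x - laplacian (\<lambda>y. w y t) X + F x t - F X t)"
      unfolding hamilton_jacobi_deriv[OF w tT(1)] by (simp add: algebra_simps)
    moreover have "laplacian (\<lambda>y. w y t) x - laplacian (\<lambda>y. w y t) X + F x t - F X t > 0"
      using lap F[of x t] F[of X t] B by linarith
    ultimately show False using k by (simp add: mult_le_0_iff)
  qed
  moreover have "continuous_on {0..T} (\<lambda>t. w (x + r *\<^sub>R ?e) t - w x t)"
    by (intro continuous_on_diff continuous_time[OF D(1)])
  ultimately show ?thesis using time_closure_le T t r by blast
qed

lemma hamilton_jacobi_oscillation: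
  fixes w :: "real^'n \<Rightarrow> real \<Rightarrow> real"
  assumes w: "hamilton_jacobi P k T F w" and k: "0 < k" and T: "0 < T"
    and F: "\<And>x t. 0 \<le> F x t \<and> F x t \<le> C" and final: "\<And>x. w x T = 0" and t: "t \<in> {0..T}"
  shows "\<bar>w x t - w y t\<bar> \<le> real CARD('n) * (C + 1)"
proof -
  have per: "periodic 1 (\<lambda>x. w x t)" using w t by (auto simp: hamilton_jacobi_def)
  have C0: "0 \<le> C" using F[of 0 0] by linarith
  have ax: "w (x + r *\<^sub>R axis i 1) t - w x t \<le> C + 1" for x r and i :: 'n
  proof -
    have f: "frac r \<in> {0..1}" using frac_lt_1[of r] by simp
    have "w (x + r *\<^sub>R axis i 1) t = w (x + frac r *\<^sub>R axis i 1) t"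
      using periodic_axis(2)[OF per, of "x + frac r *\<^sub>R axis i 1" "\<lfloor>r\<rfloor>" i]
      by (simp add: frac_def algebra_simps)
    moreover have "(C + 1) * (frac r * (1 - frac r)) \<le> (C + 1) * 1"
      using C0 f by (intro mult_left_mono mult_le_one) auto
    moreover have "w (x + frac r *\<^sub>R axis i 1) t - w x t \<le> (C + 1) * (frac r * (1 - frac r))"
      using hamilton_jacobi_oscillation_axis[OF w k T F final, of "C + 1" t "frac r" x i] C0 f t by simp
    ultimately show ?thesis by (metis mult.right_neutral order_trans)
  qed
  have path: "w (x + (\<Sum>i\<in>S. c i *\<^sub>R axis i 1)) t - w x t \<le> real (card S) * (C + 1)"
    if "finite S" for S :: "'n set" and x c
    using that
  proof induction
    case (insert j S)
    have "w (x + (\<Sum>i\<in>insert j S. c i *\<^sub>R axis i 1)) t - w (x + (\<Sum>i\<in>S. c i *\<^sub>R axis i 1)) t \<le> C + 1"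
      using ax[of "x + (\<Sum>i\<in>S. c i *\<^sub>R axis i 1)" "c j" j] insert by (simp add: add_ac)
    with insert show ?case by (simp add: algebra_simps)
  qed simp
  have one: "w x t - w y t \<le> real CARD('n) * (C + 1)" for x y
  proof -
    have "y + (\<Sum>i\<in>UNIV. (x - y) $ i *\<^sub>R axis i 1) = x"
      by (simp add: vec_eq_iff axis_def if_distrib[of "\<lambda>a. _ * a"] cong: if_cong)
    with path[of UNIV y "\<lambda>i. (x - y) $ i"] show ?thesis by simp
  qed
  from one[of x y] one[of y x] show ?thesis by (simp add: abs_le_iff)
qed

section \<open>The duality identity of Lasry and Lions\<close>

lemma C2_D:
  assumes "C2 f"
  shows "((\<lambda>s. f (x + s *\<^sub>R axis i 1)) has_real_derivative partial i f (x + s *\<^sub>R axis i 1)) (at s)"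
    and "((\<lambda>s. partial i f (x + s *\<^sub>R axis i 1)) has_real_derivative
            partial i (grad f) (x + s *\<^sub>R axis i 1) $ i) (at s)"
  by (rule grad_line) (use assms in \<open>simp add: C2_def\<close>, rule grad_partial_line[OF assms])

lemma laplacian_continuous: "C2 f \<Longrightarrow> continuous_on UNIV (laplacian f)"
  unfolding laplacian_eq[abs_def] by (intro continuous_on_sum C2_continuous)

text \<open>The Fokker-Planck operator is the adjoint of the linearised Hamilton-Jacobi operator.\<close>

lemma integral_adjoint:
  fixes z m w :: "real^'n \<Rightarrow> real"
  assumes z: "C2 z" "periodic 1 z" and m: "C2 m" "periodic 1 m" and w: "C2 w" "periodic 1 w"
  shows "integral (cbox 0 1) (\<lambda>x. z x * (laplacian m x + grad m x \<bullet> (grad w x + P) + m x * laplacian w x))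
       = integral (cbox 0 1) (\<lambda>x. m x * (laplacian z x - (grad w x + P) \<bullet> grad z x))" (is "?L = ?R")
proof -
  \<comment> \<open>The difference of both integrands is the divergence of the field with components \<open>F i\<close>.\<close>
  define F where "F i x = z x * partial i m x - m x * partial i z x
      + z x * m x * (partial i w x + P $ i)" for i x
  define D where "D i x = z x * partial i (grad m) x $ i - m x * partial i (grad z) x $ i
      + (partial i z x * m x + z x * partial i m x) * (partial i w x + P $ i)
      + z x * m x * partial i (grad w) x $ i" for i x
  note cont = C2_continuous[OF z(1)] C2_continuous[OF m(1)] C2_continuous[OF w(1)]
  have cD: "continuous_on UNIV (D i)" for i unfolding D_def by (intro continuous_intros cont)
  have 0: "integral (cbox 0 1) (D i) = 0" for i
  proof (rule integral_periodic_derivative)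
    show "continuous_on UNIV (F i)" unfolding F_def by (intro continuous_intros cont)
    show "periodic 1 (F i)"
      using z(2) m(2) periodic_partial[OF z(2), of i] periodic_partial[OF m(2), of i] periodic_partial[OF w(2), of i]
      unfolding periodic_def F_def by simp
    show "((\<lambda>s. F i (x + s *\<^sub>R axis i 1)) has_real_derivative D i (x + s *\<^sub>R axis i 1)) (at s)" for x s
      unfolding F_def D_def
      by (auto intro!: derivative_eq_intros C2_D[OF z(1)] C2_D[OF m(1)] C2_D(1)[OF w(1)] C2_D(2)[OF w(1)] simp: algebra_simps)
  qed (rule cD)
  have "z x * (laplacian m x + grad m x \<bullet> (grad w x + P) + m x * laplacian w x)
      - m x * (laplacian z x - (grad w x + P) \<bullet> grad z x) = (\<Sum>i\<in>UNIV. D i x)" for x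
    unfolding laplacian_eq inner_vec_def D_def
    by (simp add: sum_distrib_left sum_subtractf[symmetric] sum.distrib[symmetric] algebra_simps)
  moreover have "integral (cbox 0 1) (\<lambda>x. \<Sum>i\<in>UNIV. D i x) = 0"
    using 0 by (subst integral_sum) (auto intro: continuous_integrable[OF cD])
  moreover have "?L - ?R = integral (cbox 0 1) (\<lambda>x. z x * (laplacian m x + grad m x \<bullet> (grad w x + P) + m x * laplacian w x)
      - m x * (laplacian z x - (grad w x + P) \<bullet> grad z x))"
    by (intro integral_diff[symmetric] continuous_integrable continuous_intros cont
         laplacian_continuous z(1) m(1) w(1) C1_grad_continuous)
      (use z(1) m(1) w(1) in \<open>auto simp: C2_def\<close>)
  ultimately show ?thesis by simp
qed

lemma continuous_swap:
  assumes "continuous_on (UNIV \<times> S) (\<lambda>(x, t). f x t)"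
  shows "continuous_on (S \<times> A) (\<lambda>(t, x). f x t)"
proof -
  have "continuous_on (S \<times> A) (\<lambda>p. (snd p, fst p))" by (intro continuous_intros)
  from continuous_on_compose2[OF assms this] have "continuous_on (S \<times> A) (\<lambda>p. f (snd p) (fst p))" by fastforce
  then show ?thesis by (simp add: split_beta)
qed

lemma continuous_space:
  assumes "continuous_on (UNIV \<times> S) (\<lambda>(x, t). f x t)" "t \<in> S"
  shows "continuous_on UNIV (\<lambda>x. f x t)"
proof -
  have "continuous_on UNIV (\<lambda>x. (x, t))" by (intro continuous_intros)
  from continuous_on_compose2[OF assms(1) this] assms(2) show ?thesis by auto
qed

lemma cell_integral_continuous:
  fixes f :: "real^'n \<Rightarrow> real \<Rightarrow> real"
  assumes "continuous_on (UNIV \<times> S) (\<lambda>(x, t). f x t)"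
  shows "continuous_on S (\<lambda>t. integral (cbox 0 1) (\<lambda>x. f x t))"
  by (rule integral_continuous_on_param[OF continuous_swap[OF assms]])

lemma cell_integral_derivative:
  fixes f :: "real^'n \<Rightarrow> real \<Rightarrow> real"
  assumes f: "continuous_on (UNIV \<times> {0..T}) (\<lambda>(x, t). f x t)"
    and f': "\<And>x t. t \<in> {0<..<T} \<Longrightarrow> (f x has_real_derivative f' x t) (at t)"
      "continuous_on (UNIV \<times> {0<..<T}) (\<lambda>(x, t). f' x t)"
    and t: "t \<in> {0<..<T}"
  shows "((\<lambda>t. integral (cbox 0 1) (\<lambda>x. f x t)) has_real_derivative integral (cbox 0 1) (\<lambda>x. f' x t)) (at t)"
proof -
  have "((\<lambda>t. integral (cbox 0 1) (\<lambda>x. f x t)) has_real_derivative integral (cbox 0 1) (\<lambda>x. f' x t))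
      (at t within {0<..<T})"
    by (rule leibniz_rule_field_derivative[OF _ _ continuous_swap[OF f'(2)] t])
      (auto intro!: continuous_integrable continuous_space[OF f] has_field_derivative_at_within f'(1))
  then show ?thesis using t at_within_open[of t "{0<..<T}"] by simp
qed

text \<open>A weak notion of solution of the Fokker-Planck equation, tested with classical functions that
  may depend on time. It is shared by the classical densities and by the density of the cell problem,
  which is merely continuous with a weak gradient.\<close>

definition transported ::
  "real^'n \<Rightarrow> real \<Rightarrow> real \<Rightarrow> (real^'n \<Rightarrow> real \<Rightarrow> real) \<Rightarrow> (real^'n \<Rightarrow> real \<Rightarrow> real) \<Rightarrow> bool" where
  "transported P k T w m \<longleftrightarrow> continuous_on (UNIV \<times> {0..T}) (\<lambda>(x, t). m x t) \<and>
    (\<forall>z. C21 T z \<longrightarrow> (\<forall>t\<in>{0..T}. periodic 1 (\<lambda>x. z x t)) \<longrightarrow> (\<forall>t\<in>{0<..<T}.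
      ((\<lambda>t. integral (cbox 0 1) (\<lambda>x. z x t * m x t)) has_real_derivative
         integral (cbox 0 1) (\<lambda>x. deriv (z x) t * m x t + k * (m x t *
            (laplacian (\<lambda>y. z y t) x - (grad (\<lambda>y. w y t) x + P) \<bullet> grad (\<lambda>y. z y t) x)))) (at t)))"

lemma transportedD:
  assumes "transported P k T w m" "C21 T z" "\<And>t. t \<in> {0..T} \<Longrightarrow> periodic 1 (\<lambda>x. z x t)" "t \<in> {0<..<T}"
  shows "((\<lambda>t. integral (cbox 0 1) (\<lambda>x. z x t * m x t)) has_real_derivative
         integral (cbox 0 1) (\<lambda>x. deriv (z x) t * m x t + k * (m x t *
            (laplacian (\<lambda>y. z y t) x - (grad (\<lambda>y. w y t) x + P) \<bullet> grad (\<lambda>y. z y t) x)))) (at t)"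
  using assms unfolding transported_def by blast

lemma fokker_planck_transported:
  fixes w m :: "real^'n \<Rightarrow> real \<Rightarrow> real"
  assumes m: "fokker_planck P k T w m" and w: "C21 T w" "\<And>t. t \<in> {0..T} \<Longrightarrow> periodic 1 (\<lambda>x. w x t)"
  shows "transported P k T w m"
  unfolding transported_def
proof (intro conjI allI impI ballI)
  have Cm: "C21 T m" and mper: "\<And>t. t \<in> {0..T} \<Longrightarrow> periodic 1 (\<lambda>x. m x t)"
    using m by (auto simp: fokker_planck_def)
  note M = C21_D[OF Cm]
  show "continuous_on (UNIV \<times> {0..T}) (\<lambda>(x, t). m x t)" by (rule M)
  fix z :: "real^'n \<Rightarrow> real \<Rightarrow> real" and t assume Cz: "C21 T z"
    and zper: "\<forall>t\<in>{0..T}. periodic 1 (\<lambda>x. z x t)" and t: "t \<in> {0<..<T}"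
  note Z = C21_D[OF Cz]
  have c2: "C2 (\<lambda>x. z x t)" "C2 (\<lambda>x. m x t)" "C2 (\<lambda>x. w x t)"
    using Z(2) M(2) C21_D(2)[OF w(1)] t by auto
  have t': "t \<in> {0..T}" using t by auto
  have *: "((\<lambda>t. integral (cbox 0 1) (\<lambda>x. z x t * m x t)) has_real_derivative
      integral (cbox 0 1) (\<lambda>x. deriv (z x) t * m x t + z x t * deriv (m x) t)) (at t)"
  proof (rule cell_integral_derivative[OF _ _ _ t])
    show "continuous_on (UNIV \<times> {0..T}) (\<lambda>(x, t). z x t * m x t)"
      using continuous_on_mult[OF Z(1) M(1)] by (simp add: split_beta)
    show "((\<lambda>t. z x t * m x t) has_real_derivative deriv (z x) t * m x t + z x t * deriv (m x) t) (at t)"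
      if "t \<in> {0<..<T}" for x t
      using DERIV_mult[OF Z(3)[OF that, of x] M(3)[OF that, of x]] by (simp add: algebra_simps)
    have sub: "continuous_on (UNIV \<times> {0<..<T}) (\<lambda>(x, t). z x t)" "continuous_on (UNIV \<times> {0<..<T}) (\<lambda>(x, t). m x t)"
      by (rule continuous_on_subset[OF Z(1)] continuous_on_subset[OF M(1)]; auto)+
    show "continuous_on (UNIV \<times> {0<..<T}) (\<lambda>(x, t). deriv (z x) t * m x t + z x t * deriv (m x) t)"
      using continuous_on_add[OF continuous_on_mult[OF Z(4) sub(2)] continuous_on_mult[OF sub(1) M(4)]]
      by (simp add: split_beta)
  qed
  let ?a = "\<lambda>x. deriv (z x) t * m x t"
  let ?b = "\<lambda>x. m x t * (laplacian (\<lambda>y. z y t) x - (grad (\<lambda>y. w y t) x + P) \<bullet> grad (\<lambda>y. z y t) x)"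
  let ?c = "\<lambda>x. z x t * (laplacian (\<lambda>y. m y t) x + grad (\<lambda>y. m y t) x \<bullet> (grad (\<lambda>y. w y t) x + P)
            + m x t * laplacian (\<lambda>y. w y t) x)"
  note ci = continuous_intros continuous_space[OF Z(4) t] C2_continuous(1)[OF c2(1)]
     C2_continuous(1)[OF c2(2)] laplacian_continuous[OF c2(1)] laplacian_continuous[OF c2(2)] laplacian_continuous[OF c2(3)]
     C1_grad_continuous
  have c1: "C1 (\<lambda>x. z x t)" "C1 (\<lambda>x. m x t)" "C1 (\<lambda>x. w x t)" using c2 by (auto simp: C2_def)
  have int: "?a integrable_on cbox 0 1" "(\<lambda>x. k * ?b x) integrable_on cbox 0 1" "(\<lambda>x. k * ?c x) integrable_on cbox 0 1"
    by (intro continuous_integrable ci c1)+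
  have "integral (cbox 0 1) (\<lambda>x. ?a x + z x t * deriv (m x) t) = integral (cbox 0 1) (\<lambda>x. ?a x + k * ?c x)"
    unfolding fokker_planck_deriv[OF m t] by (simp add: mult.left_commute)
  also have "\<dots> = integral (cbox 0 1) (\<lambda>x. ?a x + k * ?b x)"
    using integral_adjoint[OF c2(1) _ c2(2) _ c2(3), of P] zper mper[OF t'] w(2)[OF t'] t'
    by (simp add: integral_add[OF int(1,2)] integral_add[OF int(1,3)])
  finally show "((\<lambda>t. integral (cbox 0 1) (\<lambda>x. z x t * m x t)) has_real_derivative
      integral (cbox 0 1) (\<lambda>x. ?a x + k * ?b x)) (at t)" using * by simp
qed

lemma stationary_transported:
  fixes v \<mu> :: "real^'n \<Rightarrow> real"
  assumes v: "C2 v" and \<mu>: "continuous_on UNIV \<mu>"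
    and weak: "\<And>\<phi>. C2 \<phi> \<Longrightarrow> periodic 1 \<phi> \<Longrightarrow>
      integral (cbox 0 1) (\<lambda>x. \<mu> x * (laplacian \<phi> x - (grad v x + P) \<bullet> grad \<phi> x)) = 0"
  shows "transported P k T (\<lambda>x t. v x + b * (t - T)) (\<lambda>x t. \<mu> x)"
  unfolding transported_def grad_add_const
proof (intro conjI allI impI ballI)
  note \<mu>2 = continuous_time_independent[OF \<mu>]
  show "continuous_on (UNIV \<times> {0..T}) (\<lambda>(x, t). \<mu> x)" by (rule \<mu>2)
  fix z :: "real^'n \<Rightarrow> real \<Rightarrow> real" and t assume Cz: "C21 T z"
    and zper: "\<forall>t\<in>{0..T}. periodic 1 (\<lambda>x. z x t)" and t: "t \<in> {0<..<T}"
  note Z = C21_D[OF Cz]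
  have *: "((\<lambda>t. integral (cbox 0 1) (\<lambda>x. z x t * \<mu> x)) has_real_derivative
      integral (cbox 0 1) (\<lambda>x. deriv (z x) t * \<mu> x)) (at t)"
  proof (rule cell_integral_derivative[OF _ _ _ t])
    show "continuous_on (UNIV \<times> {0..T}) (\<lambda>(x, t). z x t * \<mu> x)"
      using continuous_on_mult[OF Z(1) \<mu>2] by (simp add: split_beta)
    show "((\<lambda>t. z x t * \<mu> x) has_real_derivative deriv (z x) t * \<mu> x) (at t)" if "t \<in> {0<..<T}" for x t
      using DERIV_cmult_right[OF Z(3)[OF that, of x]] .
    show "continuous_on (UNIV \<times> {0<..<T}) (\<lambda>(x, t). deriv (z x) t * \<mu> x)"
      using continuous_on_mult[OF Z(4) \<mu>2] by (simp add: split_beta)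
  qed
  let ?b = "\<lambda>x. \<mu> x * (laplacian (\<lambda>y. z y t) x - (grad v x + P) \<bullet> grad (\<lambda>y. z y t) x)"
  have c2: "C2 (\<lambda>x. z x t)" using Z(2) t by auto
  have c1: "C1 (\<lambda>x. z x t)" "C1 v" using c2 v by (auto simp: C2_def)
  have int: "(\<lambda>x. deriv (z x) t * \<mu> x) integrable_on cbox 0 1" "(\<lambda>x. k * ?b x) integrable_on cbox 0 1"
    by (intro continuous_integrable continuous_intros continuous_space[OF Z(4) t] \<mu>
         laplacian_continuous c2 C1_grad_continuous c1)+
  have "integral (cbox 0 1) ?b = 0" using weak[OF c2] zper t by auto
  then have "integral (cbox 0 1) (\<lambda>x. deriv (z x) t * \<mu> x + k * ?b x) = integral (cbox 0 1) (\<lambda>x. deriv (z x) t * \<mu> x)"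
    by (simp add: integral_add[OF int])
  then show "((\<lambda>t. integral (cbox 0 1) (\<lambda>x. z x t * \<mu> x)) has_real_derivative
      integral (cbox 0 1) (\<lambda>x. deriv (z x) t * \<mu> x + k * ?b x)) (at t)" using * by simp
qed

text \<open>The pairing of the difference of two value functions with a density transported by one of the
  drifts. The gap between the linearised and the quadratic Hamiltonian is half the square of the
  difference of the gradients, and its sign depends on which drift transports the density.\<close>

lemma lasry_lions:
  fixes w1 w2 m :: "real^'n \<Rightarrow> real \<Rightarrow> real"
  assumes w1: "hamilton_jacobi P k T F1 w1" and w2: "hamilton_jacobi P k T F2 w2" and t: "t \<in> {0<..<T}"
  defines "e \<equiv> \<lambda>x t. 1/2 * (norm (grad (\<lambda>y. w1 y t) x - grad (\<lambda>y. w2 y t) x))\<^sup>2"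
  shows "transported P k T w1 m \<Longrightarrow>
      ((\<lambda>t. integral (cbox 0 1) (\<lambda>x. (w1 x t - w2 x t) * m x t)) has_real_derivative
        k * integral (cbox 0 1) (\<lambda>x. m x t * (- e x t - (F1 x t - F2 x t)))) (at t)"
    and "transported P k T w2 m \<Longrightarrow>
      ((\<lambda>t. integral (cbox 0 1) (\<lambda>x. (w1 x t - w2 x t) * m x t)) has_real_derivative
        k * integral (cbox 0 1) (\<lambda>x. m x t * (e x t - (F1 x t - F2 x t)))) (at t)"
proof -
  have C: "C21 T w1" "C21 T w2" using w1 w2 by (auto simp: hamilton_jacobi_def)
  have per: "periodic 1 (\<lambda>x. w1 x t - w2 x t)" if "t \<in> {0..T}" for t
    using w1 w2 that by (intro periodic_diff) (auto simp: hamilton_jacobi_def)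
  have c2: "C2 (\<lambda>x. w1 x t)" "C2 (\<lambda>x. w2 x t)" using C21_D(2)[OF C(1)] C21_D(2)[OF C(2)] t by auto
  have g: "grad (\<lambda>y. w1 y t - w2 y t) x = grad (\<lambda>y. w1 y t) x - grad (\<lambda>y. w2 y t) x" for x
    using C2_diff(2)[OF c2] by (simp add: vec_eq_iff)
  have l: "laplacian (\<lambda>y. w1 y t - w2 y t) x = laplacian (\<lambda>y. w1 y t) x - laplacian (\<lambda>y. w2 y t) x" for x
    using C2_diff(3)[OF c2] by (simp add: laplacian_eq sum_subtractf)
  note eqs = C21_diff(2)[OF C t] g l hamilton_jacobi_deriv[OF w1 t] hamilton_jacobi_deriv[OF w2 t]
  note tr = transportedD[OF _ C21_diff(1)[OF C] per t, unfolded eqs]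
  \<comment> \<open>The drift paired with \<open>\<nabla>(w1 - w2)\<close> is that of \<open>w1\<close> or of \<open>w2\<close>; completing the square leaves plus or minus half the square of the difference.\<close>
  have alg1: "(k * (1/2 * (norm (g1 + P))\<^sup>2 - l1 - f1) - k * (1/2 * (norm (g2 + P))\<^sup>2 - l2 - f2)) * \<mu>
      + k * (\<mu> * ((l1 - l2) - (g1 + P) \<bullet> (g1 - g2)))
      = k * (\<mu> * (- (1/2 * (norm (g1 - g2))\<^sup>2) - (f1 - f2)))"
    and alg2: "(k * (1/2 * (norm (g1 + P))\<^sup>2 - l1 - f1) - k * (1/2 * (norm (g2 + P))\<^sup>2 - l2 - f2)) * \<mu>
      + k * (\<mu> * ((l1 - l2) - (g2 + P) \<bullet> (g1 - g2)))
      = k * (\<mu> * (1/2 * (norm (g1 - g2))\<^sup>2 - (f1 - f2)))"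
    for g1 g2 :: "real^'n" and l1 l2 f1 f2 \<mu> :: real
    by (simp_all add: power2_norm_eq_inner inner_simps inner_commute algebra_simps)
  show "transported P k T w1 m \<Longrightarrow>
      ((\<lambda>t. integral (cbox 0 1) (\<lambda>x. (w1 x t - w2 x t) * m x t)) has_real_derivative
        k * integral (cbox 0 1) (\<lambda>x. m x t * (- e x t - (F1 x t - F2 x t)))) (at t)"
    using tr[where P=P and k=k and w=w1 and m=m] unfolding alg1 e_def integral_mult_right by blast
  show "transported P k T w2 m \<Longrightarrow>
      ((\<lambda>t. integral (cbox 0 1) (\<lambda>x. (w1 x t - w2 x t) * m x t)) has_real_derivative
        k * integral (cbox 0 1) (\<lambda>x. m x t * (e x t - (F1 x t - F2 x t)))) (at t)"
    using tr[where P=P and k=k and w=w2 and m=m] unfolding alg2 e_def integral_mult_right by blast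
qed

text \<open>Subtracting the two pairings makes all terms dissipative: the squares add up, and the coupling
  enters through its monotonicity.\<close>

lemma energy_identity:
  fixes w1 w2 m1 m2 :: "real^'n \<Rightarrow> real \<Rightarrow> real"
  assumes w1: "hamilton_jacobi P k T F1 w1" and w2: "hamilton_jacobi P k T F2 w2" and t: "t \<in> {0<..<T}"
    and m1: "transported P k T w1 m1" and m2: "transported P k T w2 m2"
    and F: "continuous_on UNIV (\<lambda>x. F1 x t)" "continuous_on UNIV (\<lambda>x. F2 x t)"
  defines "e \<equiv> \<lambda>x. 1/2 * (norm (grad (\<lambda>y. w1 y t) x - grad (\<lambda>y. w2 y t) x))\<^sup>2"
  shows "((\<lambda>t. integral (cbox 0 1) (\<lambda>x. (w1 x t - w2 x t) * m1 x t)
             - integral (cbox 0 1) (\<lambda>x. (w1 x t - w2 x t) * m2 x t)) has_real_derivative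
      - k * (integral (cbox 0 1) (\<lambda>x. m1 x t * e x) + integral (cbox 0 1) (\<lambda>x. m2 x t * e x)
             + integral (cbox 0 1) (\<lambda>x. (F1 x t - F2 x t) * (m1 x t - m2 x t)))) (at t)"
    and "continuous_on UNIV e"
proof -
  have C: "C21 T w1" "C21 T w2" using w1 w2 by (auto simp: hamilton_jacobi_def)
  have c1: "C1 (\<lambda>x. w1 x t)" "C1 (\<lambda>x. w2 x t)"
    using C21_D(2)[OF C(1)] C21_D(2)[OF C(2)] t by (auto simp: C2_def)
  show ce: "continuous_on UNIV e" unfolding e_def by (intro continuous_intros C1_grad_continuous c1)
  have t': "t \<in> {0..T}" using t by auto
  have cm: "continuous_on UNIV (\<lambda>x. m1 x t)" "continuous_on UNIV (\<lambda>x. m2 x t)"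
    using m1 m2 continuous_space[OF _ t'] unfolding transported_def by blast+
  let ?d = "\<lambda>x. F1 x t - F2 x t"
  have int: "(\<lambda>x. m1 x t * e x) integrable_on cbox 0 1" "(\<lambda>x. m1 x t * ?d x) integrable_on cbox 0 1"
     "(\<lambda>x. m2 x t * e x) integrable_on cbox 0 1" "(\<lambda>x. m2 x t * ?d x) integrable_on cbox 0 1"
    by (intro continuous_integrable continuous_intros cm ce F)+
  have 1: "integral (cbox 0 1) (\<lambda>x. m1 x t * (- e x - ?d x))
      = - integral (cbox 0 1) (\<lambda>x. m1 x t * e x) - integral (cbox 0 1) (\<lambda>x. m1 x t * ?d x)"
    using integral_diff[OF integrable_neg[OF int(1)] int(2)] by (simp add: algebra_simps)
  have 2: "integral (cbox 0 1) (\<lambda>x. m2 x t * (e x - ?d x))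
      = integral (cbox 0 1) (\<lambda>x. m2 x t * e x) - integral (cbox 0 1) (\<lambda>x. m2 x t * ?d x)"
    using integral_diff[OF int(3,4)] by (simp add: algebra_simps)
  have 3: "integral (cbox 0 1) (\<lambda>x. ?d x * (m1 x t - m2 x t))
      = integral (cbox 0 1) (\<lambda>x. m1 x t * ?d x) - integral (cbox 0 1) (\<lambda>x. m2 x t * ?d x)"
    using integral_diff[OF int(2,4)] by (simp add: algebra_simps)
  have "k * integral (cbox 0 1) (\<lambda>x. m1 x t * (- e x - ?d x)) - k * integral (cbox 0 1) (\<lambda>x. m2 x t * (e x - ?d x))
      = - k * (integral (cbox 0 1) (\<lambda>x. m1 x t * e x) + integral (cbox 0 1) (\<lambda>x. m2 x t * e x)
             + integral (cbox 0 1) (\<lambda>x. ?d x * (m1 x t - m2 x t)))"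
    unfolding 1 2 3 by (simp add: algebra_simps)
  with DERIV_diff[OF lasry_lions(1)[OF w1 w2 t m1] lasry_lions(2)[OF w1 w2 t m2]]
  show "((\<lambda>t. integral (cbox 0 1) (\<lambda>x. (w1 x t - w2 x t) * m1 x t)
             - integral (cbox 0 1) (\<lambda>x. (w1 x t - w2 x t) * m2 x t)) has_real_derivative
      - k * (integral (cbox 0 1) (\<lambda>x. m1 x t * e x) + integral (cbox 0 1) (\<lambda>x. m2 x t * e x)
             + integral (cbox 0 1) (\<lambda>x. ?d x * (m1 x t - m2 x t)))) (at t)"
    unfolding e_def by simp
qed

lemma antimono_of_derivative:
  fixes f :: "real \<Rightarrow> real"
  assumes "continuous_on {0..T} f" "\<And>t. 0 < t \<Longrightarrow> t < T \<Longrightarrow> \<exists>d. (f has_real_derivative d) (at t) \<and> d \<le> 0"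
    and "0 \<le> s" "s \<le> t" "t \<le> T"
  shows "f t \<le> f s"
  by (rule DERIV_nonpos_imp_decreasing_open[OF assms(4)])
     (use assms in \<open>auto intro: continuous_on_subset\<close>)

section \<open>Monotone couplings and uniqueness\<close>

definition mean_field ::
  "real^'n \<Rightarrow> real \<Rightarrow> real \<Rightarrow> (real^'n \<Rightarrow> real \<Rightarrow> real) \<Rightarrow> (real^'n \<Rightarrow> real \<Rightarrow> real) \<Rightarrow> (real^'n \<Rightarrow> real \<Rightarrow> real) \<Rightarrow> bool"
where
  "mean_field P k T V w m \<longleftrightarrow> hamilton_jacobi P k T (\<lambda>x t. V x (m x t)) w \<and> fokker_planck P k T w m \<and>
     (\<forall>x. w x T = 0 \<and> m x 0 = 1)"

lemma unit_cell_content: "measure lborel (cbox (0::real^'n) 1) = 1"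
  by (simp add: content_cbox_cart interval_ne_empty_cart)

locale monotone_coupling =
  fixes V :: "real^'n \<Rightarrow> real \<Rightarrow> real" and C :: real
  assumes V_continuous: "continuous_on UNIV (\<lambda>(y, s). V y s)"
    and V_periodic: "periodic 1 (\<lambda>y. V y s)"
    and V_bounds: "0 \<le> V y s \<and> V y s \<le> C"
    and V_monotone: "\<exists>\<gamma>>0. \<forall>y. \<forall>s\<in>{a..b}. \<forall>s'\<in>{a..b}. s' \<le> s \<longrightarrow> \<gamma> * (s - s') \<le> V y s - V y s'"
begin

lemma V_less: "s' < s \<Longrightarrow> V y s' < V y s"
proof -
  assume s: "s' < s"
  then obtain \<gamma> where "\<gamma> > 0" "\<gamma> * (s - s') \<le> V y s - V y s'"
    using V_monotone[of s' s] by fastforce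
  then show ?thesis using s by (smt (verit) mult_pos_pos)
qed

lemma V_le: "s' \<le> s \<Longrightarrow> V y s' \<le> V y s"
  using V_less[of s' s y] by (cases "s' = s") auto

lemma V_defect_nonneg: "0 \<le> (V y s - V y s') * (s - s')"
  using V_le[of s s' y] V_le[of s' s y] by (cases "s \<le> s'") (auto intro: mult_nonpos_nonpos)

lemma V_defect_eq_0: "(V y s - V y s') * (s - s') = 0 \<Longrightarrow> s = s'"
  using V_less[of s s' y] V_less[of s' s y] by (cases s s' rule: linorder_cases) auto

lemma V_compose_continuous: "continuous_on S f \<Longrightarrow> continuous_on S g \<Longrightarrow> continuous_on S (\<lambda>p. V (f p) (g p))"
  using continuous_on_compose2[OF V_continuous, of S "\<lambda>p. (f p, g p)"] by (auto intro!: continuous_intros)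

text \<open>The smallness of the monotonicity defect controls the distance of densities, even though the
  density \<open>s\<close> is not bounded: for distances below one the defect is at least quadratic, and beyond it is
  still at least linear.\<close>

lemma V_coercive:
  assumes b: "0 \<le> b"
  obtains \<gamma> where "\<gamma> > 0"
    "\<And>y s s' \<delta>. 0 \<le> s \<Longrightarrow> s' \<in> {0..b} \<Longrightarrow> 0 < \<delta> \<Longrightarrow> \<delta> \<le> 1 \<Longrightarrow>
       \<bar>s - s'\<bar> \<le> \<delta> + (V y s - V y s') * (s - s') / (\<gamma> * \<delta>)"
proof -
  obtain \<gamma> where \<gamma>: "\<gamma> > 0" "\<And>y s s'. s \<in> {0..b+1} \<Longrightarrow> s' \<in> {0..b+1} \<Longrightarrow> s' \<le> s \<Longrightarrow> \<gamma> * (s - s') \<le> V y s - V y s'"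
    using V_monotone[of 0 "b + 1"] by auto
  have "\<bar>s - s'\<bar> \<le> \<delta> + (V y s - V y s') * (s - s') / (\<gamma> * \<delta>)"
    if s: "0 \<le> s" "s' \<in> {0..b}" and \<delta>: "0 < \<delta>" "\<delta> \<le> 1" for y s s' \<delta>
  proof (cases "\<bar>s - s'\<bar> \<le> \<delta>")
    case True
    have "0 \<le> (V y s - V y s') * (s - s') / (\<gamma> * \<delta>)"
      using V_defect_nonneg[of y s s'] \<gamma>(1) \<delta> by simp
    with True show ?thesis by linarith
  next
    case False
    \<comment> \<open>Above \<open>b + 1\<close> the modulus of monotonicity on \<open>{0..b + 1}\<close> is only available up to \<open>b + 1\<close>; plain monotonicity takes over from there.\<close>
    have "\<gamma> * \<delta> \<le> \<bar>V y s - V y s'\<bar>"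
    proof (cases "s \<le> b + 1")
      case True
      have "\<gamma> * \<bar>s - s'\<bar> \<le> \<bar>V y s - V y s'\<bar>"
        using \<gamma>(2)[of s s' y] \<gamma>(2)[of s' s y] s True by (cases "s' \<le> s") auto
      moreover have "\<gamma> * \<delta> \<le> \<gamma> * \<bar>s - s'\<bar>" using False \<gamma>(1) by (intro mult_left_mono) auto
      ultimately show ?thesis by linarith
    next
      case F: False
      have "\<gamma> * (b + 1 - s') \<le> V y (b + 1) - V y s'" using \<gamma>(2)[of "b+1" s' y] s b by auto
      moreover have "V y (b + 1) \<le> V y s" using F by (intro V_le) auto
      moreover have "\<gamma> * \<delta> \<le> \<gamma> * (b + 1 - s')" using \<delta> s \<gamma>(1) by (intro mult_left_mono) auto
      ultimately show ?thesis by linarith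
    qed
    then have "\<gamma> * \<delta> * \<bar>s - s'\<bar> \<le> \<bar>V y s - V y s'\<bar> * \<bar>s - s'\<bar>" by (rule mult_right_mono) simp
    also have "\<dots> = (V y s - V y s') * (s - s')"
      using V_defect_nonneg[of y s s'] by (simp flip: abs_mult)
    finally have "\<bar>s - s'\<bar> \<le> (V y s - V y s') * (s - s') / (\<gamma> * \<delta>)"
      using \<gamma>(1) \<delta> by (simp add: field_simps)
    then show ?thesis using \<delta> by linarith
  qed
  then show thesis using that \<gamma>(1) by blast
qed

text \<open>Uniform continuity on bounded densities and boundedness of the coupling give an affine modulus
  that also holds for unbounded densities.\<close>

lemma V_modulus:
  assumes b: "0 \<le> b" and \<eta>: "0 < \<eta>"
  obtains K where "0 \<le> K" "\<And>y s s'. 0 \<le> s \<Longrightarrow> s' \<in> {0..b} \<Longrightarrow> \<bar>V y s - V y s'\<bar> \<le> \<eta> + K * \<bar>s - s'\<bar>"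
proof -
  have "uniformly_continuous_on (cbox (0::real^'n) 1 \<times> {0..b+1}) (\<lambda>(y, s). V y s)"
    by (intro compact_uniformly_continuous continuous_on_subset[OF V_continuous] compact_Times) auto
  then obtain d where d: "d > 0" "\<And>p q. p \<in> cbox (0::real^'n) 1 \<times> {0..b+1} \<Longrightarrow> q \<in> cbox 0 1 \<times> {0..b+1} \<Longrightarrow>
      dist p q < d \<Longrightarrow> dist ((\<lambda>(y, s). V y s) p) ((\<lambda>(y, s). V y s) q) < \<eta>"
    unfolding uniformly_continuous_on_def using \<eta> by metis
  \<comment> \<open>Beyond the distance of uniform continuity the bound \<open>C\<close> is at most \<open>K\<close> times the distance.\<close>
  define K where "K = C / min d 1"
  have C0: "0 \<le> C" using V_bounds[of 0 0] by linarith
  have K: "0 \<le> K" using C0 d(1) by (simp add: K_def)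
  have "\<bar>V y s - V y s'\<bar> \<le> \<eta> + K * \<bar>s - s'\<bar>" if s: "0 \<le> s" "s' \<in> {0..b}" for y s s'
  proof (cases "\<bar>s - s'\<bar> < min d 1")
    case True
    have "periodic 1 (\<lambda>y. (V y s, V y s'))" using V_periodic unfolding periodic_def by simp
    from periodic_reduce[OF this, of y] obtain y' where y': "y' \<in> cbox 0 1" "V y' s = V y s" "V y' s' = V y s'"
      by auto
    have "dist (y', s) (y', s') < d" using True by (simp add: dist_Pair_Pair dist_real_def)
    then have "\<bar>V y' s - V y' s'\<bar> < \<eta>"
      using d(2)[of "(y', s)" "(y', s')"] y' s True by (auto simp: dist_real_def)
    moreover have "0 \<le> K * \<bar>s - s'\<bar>" using K by simp
    ultimately show ?thesis using y' by simp
  next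
    case False
    have "\<bar>V y s - V y s'\<bar> \<le> C" using V_bounds[of y s] V_bounds[of y s'] by linarith
    also have "C = K * min d 1" using d(1) by (simp add: K_def)
    also have "\<dots> \<le> K * \<bar>s - s'\<bar>" using False K by (intro mult_left_mono) auto
    finally show ?thesis using \<eta> by linarith
  qed
  then show thesis using that K by blast
qed

lemma mean_field_nonneg:
  assumes mf: "mean_field P k T V w m" and k: "0 < k" and T: "0 < T" and t: "t \<in> {0..T}"
  shows "0 \<le> m x t"
  using mf fokker_planck_nonneg[of T w P k m t x] k T t unfolding mean_field_def hamilton_jacobi_def by auto

lemma mean_field_transported:
  assumes "mean_field P k T V w m" shows "transported P k T w m"
  using assms fokker_planck_transported unfolding mean_field_def hamilton_jacobi_def by blast

lemma source_continuous:
  assumes "transported P k T w m" "t \<in> {0..T}"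
  shows "continuous_on UNIV (\<lambda>x. V x (m x t))" "continuous_on UNIV (\<lambda>x. m x t)"
proof -
  show "continuous_on UNIV (\<lambda>x. m x t)"
    using assms continuous_space unfolding transported_def by blast
  then show "continuous_on UNIV (\<lambda>x. V x (m x t))" by (intro V_compose_continuous continuous_intros)
qed

text \<open>The energy vanishes at both ends of the time interval and does not increase, hence it is
  constant. Its dissipation is then zero, so strict monotonicity identifies the densities. The value
  functions solve the same equation afterwards, and the comparison principle applies.\<close>

theorem mean_field_unique:
  assumes 1: "mean_field P k T V w1 m1" and 2: "mean_field P k T V w2 m2" and k: "0 < k" and T: "0 < T"
    and t: "t \<in> {0..T}"
  shows "w1 x t = w2 x t" "m1 x t = m2 x t"
proof -
  have hj: "hamilton_jacobi P k T (\<lambda>x t. V x (m1 x t)) w1" "hamilton_jacobi P k T (\<lambda>x t. V x (m2 x t)) w2"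
    using 1 2 by (auto simp: mean_field_def)
  have tr: "transported P k T w1 m1" "transported P k T w2 m2" using 1 2 mean_field_transported by auto
  note nonneg = mean_field_nonneg[OF 1 k T] mean_field_nonneg[OF 2 k T]
  define f where "f t = integral (cbox 0 1) (\<lambda>x. (w1 x t - w2 x t) * m1 x t)
             - integral (cbox 0 1) (\<lambda>x. (w1 x t - w2 x t) * m2 x t)" for t
  define q where "q x t = (V x (m1 x t) - V x (m2 x t)) * (m1 x t - m2 x t)" for x t
  have C: "C21 T w1" "C21 T w2" using hj by (auto simp: hamilton_jacobi_def)
  note cz = C21_D(1)[OF C21_diff(1)[OF C]]
  have cm: "continuous_on (UNIV \<times> {0..T}) (\<lambda>(x, t). m1 x t)" "continuous_on (UNIV \<times> {0..T}) (\<lambda>(x, t). m2 x t)"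
    using tr by (simp_all add: transported_def)
  have cf: "continuous_on {0..T} f"
    unfolding f_def
    by (intro continuous_on_diff cell_integral_continuous)
       (use continuous_on_mult[OF cz cm(1)] continuous_on_mult[OF cz cm(2)] in \<open>simp_all add: split_beta\<close>)
  have q_nonneg: "0 \<le> q x t" for x t unfolding q_def by (rule V_defect_nonneg)
  have qc: "continuous_on UNIV (\<lambda>x. q x t)" if "t \<in> {0..T}" for t
    unfolding q_def by (intro continuous_intros source_continuous[OF tr(1) that] source_continuous[OF tr(2) that])
  have q0: "0 \<le> integral (cbox 0 1) (\<lambda>x. q x t)" if "t \<in> {0..T}" for t
    by (intro integral_nonneg continuous_integrable qc that q_nonneg)
  have d: "\<exists>d. (f has_real_derivative d) (at t) \<and> d \<le> - k * integral (cbox 0 1) (\<lambda>x. q x t)"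
    if t: "t \<in> {0<..<T}" for t
  proof -
    have t': "t \<in> {0..T}" using t by auto
    define e where "e x = 1/2 * (norm (grad (\<lambda>y. w1 y t) x - grad (\<lambda>y. w2 y t) x))\<^sup>2" for x
    note id = energy_identity[OF hj t tr source_continuous(1)[OF tr(1) t'] source_continuous(1)[OF tr(2) t'],
        folded e_def f_def q_def]
    have "0 \<le> integral (cbox 0 1) (\<lambda>x. m1 x t * e x)" "0 \<le> integral (cbox 0 1) (\<lambda>x. m2 x t * e x)"
      by (intro integral_nonneg continuous_integrable continuous_on_mult[OF _ id(2)]
          source_continuous(2)[OF tr(1) t'] source_continuous(2)[OF tr(2) t'],
          simp add: nonneg[OF t'] e_def)+
    then have "- k * (integral (cbox 0 1) (\<lambda>x. m1 x t * e x) + integral (cbox 0 1) (\<lambda>x. m2 x t * e x)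
         + integral (cbox 0 1) (\<lambda>x. q x t)) \<le> - k * integral (cbox 0 1) (\<lambda>x. q x t)"
      using k by (intro mult_left_mono_neg) auto
    then show ?thesis using id(1) by (intro exI conjI)
  qed
  \<comment> \<open>At each end one factor of the pairing vanishes: the value functions agree at \<open>T\<close>, the densities at \<open>0\<close>.\<close>
  have ends: "f T = 0" "f 0 = 0" using 1 2 by (simp_all add: mean_field_def f_def)
  have anti: "f t \<le> f s" if "0 \<le> s" "s \<le> t" "t \<le> T" for s t
  proof (rule antimono_of_derivative[OF cf _ that])
    fix t assume t: "0 < t" "t < T"
    have neg: "- k * integral (cbox 0 1) (\<lambda>x. q x t) \<le> 0" using q0[of t] t k by simp
    obtain d where "(f has_real_derivative d) (at t)" "d \<le> - k * integral (cbox 0 1) (\<lambda>x. q x t)"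
      using d[of t] t by auto
    with neg show "\<exists>d. (f has_real_derivative d) (at t) \<and> d \<le> 0" by (intro exI[of _ d] conjI) auto
  qed
  have f0: "f t = 0" if "t \<in> {0..T}" for t
    using anti[of 0 t] anti[of t T] ends that by auto
  have m_eq: "m1 x t = m2 x t" if t: "t \<in> {0<..<T}" for x t
  proof -
    have t': "t \<in> {0..T}" using t by auto
    obtain d where d: "(f has_real_derivative d) (at t)" "d \<le> - k * integral (cbox 0 1) (\<lambda>x. q x t)"
      using d[OF t] by blast
    have "d = 0"
    proof (rule DERIV_local_const[OF d(1)])
      show "0 < min t (T - t)" using t by auto
      have "s \<in> {0..T}" if "\<bar>t - s\<bar> < min t (T - t)" for s using that by auto
      then show "\<forall>s. \<bar>t - s\<bar> < min t (T - t) \<longrightarrow> f t = f s" using f0 t' by metis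
    qed
    then have "integral (cbox 0 1) (\<lambda>x. q x t) \<le> 0"
      using d(2) k by (simp add: mult_le_0_iff zero_le_mult_iff)
    then have i0: "integral (cbox 0 1) (\<lambda>x. q x t) = 0" using q0[OF t'] by simp
    have "box (0::real^'n) 1 \<noteq> {}" by (simp add: interval_ne_empty_cart)
    then have z: "\<forall>x\<in>cbox 0 1. q x t = 0"
      using integral_cbox_eq_0_iff[OF continuous_on_subset[OF qc[OF t'] subset_UNIV], of 0 1] q_nonneg i0 by blast
    have "periodic 1 (\<lambda>x. (m1 x t, m2 x t))"
      using 1 2 t' unfolding mean_field_def fokker_planck_def periodic_def by simp
    from periodic_reduce[OF this, of x] obtain x' where x': "x' \<in> cbox 0 1" "m1 x' t = m1 x t" "m2 x' t = m2 x t"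
      by auto
    have "q x' t = 0" using z x'(1) by blast
    from V_defect_eq_0[OF this[unfolded q_def]] show ?thesis using x' by simp
  qed
  have cmd: "continuous_on {0..T} (\<lambda>t. m1 x t - m2 x t)" for x
    by (intro continuous_on_diff continuous_time[OF cm(1)] continuous_time[OF cm(2)])
  have "\<bar>m1 x t - m2 x t\<bar> \<le> 0"
    by (rule time_closure_le[OF _ T _ t]) (auto intro!: continuous_on_rabs cmd m_eq)
  then show "m1 x t = m2 x t" by simp
  show "w1 x t = w2 x t"
  proof (rule antisym)
    show "w1 x t \<le> w2 x t"
      by (rule hamilton_jacobi_le[OF hj k T _ _ t]) (use m_eq 1 2 in \<open>auto simp: mean_field_def\<close>)
    show "w2 x t \<le> w1 x t"
      by (rule hamilton_jacobi_le[OF hj(2,1) k T _ _ t]) (use m_eq 1 2 in \<open>auto simp: mean_field_def\<close>)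
  qed
qed

end

section \<open>Comparison with the solution of the cell problem\<close>

locale cell_corrector = monotone_coupling V C for V :: "real^'n \<Rightarrow> real \<Rightarrow> real" and C :: real +
  fixes P :: "real^'n" and H :: real and v \<mu> :: "real^'n \<Rightarrow> real" and A b :: real
  assumes v_C2: "C2 v" and v_periodic: "periodic 1 v"
    and \<mu>_continuous: "continuous_on UNIV \<mu>" and \<mu>_periodic: "periodic 1 \<mu>" and \<mu>_pos: "0 < \<mu> y"
    and \<mu>_mass: "integral (cbox 0 1) \<mu> = 1"
    and cell_equation: "- laplacian v y + 1/2 * (norm (grad v y + P))\<^sup>2 - V y (\<mu> y) = H"
    and cell_weak: "C2 \<phi> \<Longrightarrow> periodic 1 \<phi> \<Longrightarrow>
      integral (cbox 0 1) (\<lambda>x. \<mu> x * (laplacian \<phi> x - (grad v x + P) \<bullet> grad \<phi> x)) = 0"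
    and v_bound: "\<bar>v y\<bar> \<le> A" and \<mu>_bound: "\<mu> y \<le> b"
begin

text \<open>Up to the affine term in time, the solution of the cell problem is stationary: it solves the
  same rescaled system as the oscillating solutions, with other data at the two ends of the time interval.\<close>

definition stationary :: "real \<Rightarrow> real \<Rightarrow> real^'n \<Rightarrow> real \<Rightarrow> real" where
  "stationary k T = (\<lambda>x t. v x + (k * H) * (t - T))"

lemma stationary_hj: "hamilton_jacobi P k T (\<lambda>x t. V x (\<mu> x)) (stationary k T)"
  unfolding hamilton_jacobi_def stationary_def
proof (intro conjI ballI allI)
  show "C21 T (\<lambda>x t. v x + (k * H) * (t - T))" by (rule C21_stationary[OF v_C2])
  show "periodic 1 (\<lambda>x. v x + (k * H) * (t - T))" for t using v_periodic unfolding periodic_def by simp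
  have "laplacian (\<lambda>y. v y + c) x = laplacian v x" for c x by (simp add: laplacian_eq grad_add_const)
  moreover have "H = 1/2 * (norm (grad v x + P))\<^sup>2 - laplacian v x - V x (\<mu> x)" for x
    using cell_equation[of x] by simp
  ultimately show "deriv (\<lambda>t. v x + (k * H) * (t - T)) t =
       k * (1/2 * (norm (grad (\<lambda>y. v y + (k * H) * (t - T)) x + P))\<^sup>2
          - laplacian (\<lambda>y. v y + (k * H) * (t - T)) x - V x (\<mu> x))" for x t
    unfolding C21_stationary(2)[OF v_C2] grad_add_const by simp
qed

lemma stationary_density: "transported P k T (stationary k T) (\<lambda>x t. \<mu> x)"
  unfolding stationary_def by (rule stationary_transported[OF v_C2 \<mu>_continuous cell_weak])

lemma \<mu>_le: "\<mu> y \<in> {0..b}" and b_nonneg: "0 \<le> b"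
  using \<mu>_pos[of y] \<mu>_bound[of y] by auto

abbreviation gap :: "real \<Rightarrow> real \<Rightarrow> (real^'n \<Rightarrow> real \<Rightarrow> real) \<Rightarrow> real^'n \<Rightarrow> real \<Rightarrow> real" where
  "gap k T w x t \<equiv> w x t - stationary k T x t"

definition mean_gap :: "real \<Rightarrow> real \<Rightarrow> (real^'n \<Rightarrow> real \<Rightarrow> real) \<Rightarrow> real \<Rightarrow> real" where
  "mean_gap k T w t = integral (cbox 0 1) (\<lambda>x. gap k T w x t * \<mu> x)"

definition energy :: "real \<Rightarrow> real \<Rightarrow> (real^'n \<Rightarrow> real \<Rightarrow> real) \<Rightarrow> (real^'n \<Rightarrow> real \<Rightarrow> real) \<Rightarrow> real \<Rightarrow> real" where
  "energy k T w m t = integral (cbox 0 1) (\<lambda>x. gap k T w x t * m x t) - mean_gap k T w t"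

definition kinetic :: "real \<Rightarrow> real \<Rightarrow> (real^'n \<Rightarrow> real \<Rightarrow> real) \<Rightarrow> real \<Rightarrow> real" where
  "kinetic k T w t = integral (cbox 0 1) (\<lambda>x. \<mu> x *
      (1/2 * (norm (grad (\<lambda>y. w y t) x - grad (\<lambda>y. stationary k T y t) x))\<^sup>2))"

definition defect :: "(real^'n \<Rightarrow> real \<Rightarrow> real) \<Rightarrow> real \<Rightarrow> real" where
  "defect m t = integral (cbox 0 1) (\<lambda>x. (V x (m x t) - V x (\<mu> x)) * (m x t - \<mu> x))"

definition density_gap :: "(real^'n \<Rightarrow> real \<Rightarrow> real) \<Rightarrow> real \<Rightarrow> real" where
  "density_gap m t = integral (cbox 0 1) (\<lambda>x. \<bar>m x t - \<mu> x\<bar>)"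

context
  fixes k T :: real and w m :: "real^'n \<Rightarrow> real \<Rightarrow> real"
  assumes mf: "mean_field P k T V w m" and k: "0 < k" and T: "0 < T"
begin

lemma hj: "hamilton_jacobi P k T (\<lambda>x t. V x (m x t)) w" and final: "w x T = 0" and initial: "m x 0 = 1"
  using mf by (auto simp: mean_field_def)

lemmas tr = mean_field_transported[OF mf]

lemma w_C21: "C21 T w" "t \<in> {0..T} \<Longrightarrow> periodic 1 (\<lambda>x. w x t)"
  using hj by (auto simp: hamilton_jacobi_def)

lemma m_continuous: "continuous_on (UNIV \<times> {0..T}) (\<lambda>(x, t). m x t)"
  using tr by (simp add: transported_def)

lemmas \<mu>_continuous_pair = continuous_time_independent[OF \<mu>_continuous]

lemma gap_continuous: "continuous_on (UNIV \<times> {0..T}) (\<lambda>(x, t). gap k T w x t)"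
  using C21_D(1)[OF C21_diff(1)[OF w_C21(1), of "stationary k T"]] stationary_hj[of k T]
  by (auto simp: hamilton_jacobi_def)

lemma mean_gap_continuous: "continuous_on {0..T} (mean_gap k T w)"
  unfolding mean_gap_def[abs_def]
  by (rule cell_integral_continuous)
     (use continuous_on_mult[OF gap_continuous \<mu>_continuous_pair] in \<open>simp add: split_beta\<close>)

lemma energy_continuous: "continuous_on {0..T} (energy k T w m)"
  unfolding energy_def[abs_def]
  by (intro continuous_on_diff mean_gap_continuous cell_integral_continuous)
     (use continuous_on_mult[OF gap_continuous m_continuous] in \<open>simp add: split_beta\<close>)

lemma density_gap_continuous: "continuous_on {0..T} (density_gap m)"
  unfolding density_gap_def[abs_def]
  by (rule cell_integral_continuous)
     (use continuous_on_rabs[OF continuous_on_diff[OF m_continuous \<mu>_continuous_pair]] in \<open>simp add: split_beta\<close>)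

lemma mass:
  assumes t: "t \<in> {0..T}" shows "integral (cbox 0 1) (\<lambda>x. m x t) = 1"
proof -
  have c: "C2 (\<lambda>x::real^'n. 1::real)" using C2_add_const[OF C2_inner, of 0 1] by simp
  have z: "C21 T (\<lambda>(x::real^'n) t. 1)" using C21_stationary(1)[OF c, of T 0] by simp
  have g0: "grad (\<lambda>x::real^'n. 1) = (\<lambda>x. 0)" by (simp add: fun_eq_iff vec_eq_iff C1_const)
  have l0: "laplacian (\<lambda>x::real^'n. 1) x = 0" for x by (simp add: laplacian_eq g0 C1_const)
  have d: "((\<lambda>t. integral (cbox 0 1) (\<lambda>x. m x t)) has_real_derivative 0) (at t)" if "t \<in> {0<..<T}" for t
    using transportedD[OF tr z _ that] by (simp add: g0 l0 periodic_def)
  have cont: "continuous_on {0..T} (\<lambda>t. integral (cbox 0 1) (\<lambda>x. m x t))"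
    by (rule cell_integral_continuous[OF m_continuous])
  have "integral (cbox 0 1) (\<lambda>x. m x t) \<le> integral (cbox 0 1) (\<lambda>x. m x 0)"
    by (rule antimono_of_derivative[OF cont]) (use d t in auto)
  moreover have "- integral (cbox 0 1) (\<lambda>x. m x t) \<le> - integral (cbox 0 1) (\<lambda>x. m x 0)"
    by (rule antimono_of_derivative[OF continuous_on_minus[OF cont]]) (use d t in \<open>auto intro!: exI[of _ 0] derivative_eq_intros\<close>)
  moreover have "integral (cbox 0 1) (\<lambda>x::real^'n. m x 0) = 1"
    using initial integral_const[of "0::real^'n" 1 "1::real"] by (simp add: unit_cell_content)
  ultimately show ?thesis by simp
qed

lemma m_nonneg: "t \<in> {0..T} \<Longrightarrow> 0 \<le> m x t"
  by (rule mean_field_nonneg[OF mf k T])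

lemma m_cont: "t \<in> {0..T} \<Longrightarrow> continuous_on UNIV (\<lambda>x. m x t)"
  and Vm_cont: "t \<in> {0..T} \<Longrightarrow> continuous_on UNIV (\<lambda>x. V x (m x t))"
  using source_continuous[OF tr] by auto

lemma V\<mu>_cont: "continuous_on UNIV (\<lambda>x. V x (\<mu> x))"
  by (intro V_compose_continuous continuous_intros \<mu>_continuous)

lemma gap_cont: "t \<in> {0..T} \<Longrightarrow> continuous_on UNIV (\<lambda>x. gap k T w x t)"
  using continuous_space[OF gap_continuous] .

lemma defect_nonneg: "t \<in> {0..T} \<Longrightarrow> 0 \<le> defect m t"
  unfolding defect_def
  by (intro integral_nonneg continuous_integrable continuous_intros V_defect_nonneg m_cont Vm_cont V\<mu>_cont \<mu>_continuous)

text \<open>The dissipation of the density \<open>m\<close> is dropped; what is kept is weighted with the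
  density of the cell problem.\<close>

lemma energy_derivative:
  assumes t: "t \<in> {0<..<T}"
  shows "\<exists>d. (energy k T w m has_real_derivative d) (at t) \<and> d \<le> - k * (kinetic k T w t + defect m t)"
    and "0 \<le> kinetic k T w t"
proof -
  have t': "t \<in> {0..T}" using t by auto
  note id = energy_identity[OF hj stationary_hj t tr stationary_density Vm_cont[OF t'] V\<mu>_cont,
    folded mean_gap_def energy_def kinetic_def defect_def]
  have "0 \<le> integral (cbox 0 1) (\<lambda>x. m x t * (1/2 * (norm (grad (\<lambda>y. w y t) x - grad (\<lambda>y. stationary k T y t) x))\<^sup>2))"
    by (intro integral_nonneg continuous_integrable continuous_on_mult[OF _ id(2)] m_cont[OF t'])
       (simp add: m_nonneg[OF t'])
  then have "k * (kinetic k T w t + defect m t) \<le> k * (integral (cbox 0 1) (\<lambda>x. m x t *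
     (1/2 * (norm (grad (\<lambda>y. w y t) x - grad (\<lambda>y. stationary k T y t) x))\<^sup>2)) + kinetic k T w t + defect m t)"
    using k by (intro mult_left_mono) auto
  with id(1) show "\<exists>d. (energy k T w m has_real_derivative d) (at t) \<and> d \<le> - k * (kinetic k T w t + defect m t)"
    by (intro exI[of _ "- k * (integral (cbox 0 1) (\<lambda>x. m x t * (1/2 * (norm (grad (\<lambda>y. w y t) x - grad (\<lambda>y. stationary k T y t) x))\<^sup>2))
          + kinetic k T w t + defect m t)"] conjI)
      (simp_all add: energy_def[abs_def])
  show "0 \<le> kinetic k T w t"
    unfolding kinetic_def
    by (intro integral_nonneg continuous_integrable continuous_on_mult[OF _ id(2)] \<mu>_continuous)
       (simp add: less_imp_le[OF \<mu>_pos])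
qed

text \<open>Paired with the density of the cell problem alone, the gap grows only through quantities that
  the energy dissipates, up to the difference of the sources.\<close>

lemma mean_gap_derivative:
  assumes t: "t \<in> {0<..<T}"
  shows "(mean_gap k T w has_real_derivative
     k * (kinetic k T w t - integral (cbox 0 1) (\<lambda>x. \<mu> x * (V x (m x t) - V x (\<mu> x))))) (at t)"
proof -
  have t': "t \<in> {0..T}" using t by auto
  note id = energy_identity(2)[OF hj stationary_hj t tr stationary_density Vm_cont[OF t'] V\<mu>_cont]
  have "(\<lambda>x. \<mu> x * (1/2 * (norm (grad (\<lambda>y. w y t) x - grad (\<lambda>y. stationary k T y t) x))\<^sup>2)) integrable_on cbox 0 1"
    "(\<lambda>x. \<mu> x * (V x (m x t) - V x (\<mu> x))) integrable_on cbox 0 1"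
    by (rule continuous_integrable[OF continuous_on_mult[OF \<mu>_continuous id]])
       (rule continuous_integrable[OF continuous_on_mult[OF \<mu>_continuous continuous_on_diff[OF Vm_cont[OF t'] V\<mu>_cont]]])
  from integral_diff[OF this] show ?thesis
    using lasry_lions(2)[OF hj stationary_hj t stationary_density]
    unfolding mean_gap_def[abs_def] kinetic_def by (simp add: right_diff_distrib)
qed

definition osc :: real where "osc = real CARD('n) * (C + 1) + 2 * A"

lemma gap_oscillation:
  assumes t: "t \<in> {0..T}" shows "\<bar>gap k T w x t - gap k T w y t\<bar> \<le> osc"
proof -
  have "\<bar>w x t - w y t\<bar> \<le> real CARD('n) * (C + 1)"
    using hamilton_jacobi_oscillation[OF hj k T _ final t] V_bounds by blast
  then show ?thesis using v_bound[of x] v_bound[of y] unfolding stationary_def osc_def by linarith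
qed

text \<open>The decisive bound: it does not depend on \<open>k\<close>, so the total dissipation, which carries a
  factor \<open>k\<close>, is of order \<open>1 / k\<close>. At time zero both densities have mass one, so constants drop out
  and only the oscillation of the gap counts; at time \<open>T\<close> the gap is the bounded corrector.\<close>

lemma energy_bound:
  assumes t: "t \<in> {0..T}"
  shows "energy k T w m t \<le> 2 * osc" "- (2 * A) \<le> energy k T w m t"
proof -
  have anti: "energy k T w m t \<le> energy k T w m s" if "0 \<le> s" "s \<le> t" "t \<le> T" for s t
  proof (rule antimono_of_derivative[OF energy_continuous _ that])
    fix t assume "0 < t" "t < T"
    then have t: "t \<in> {0<..<T}" "t \<in> {0..T}" by auto
    have "- k * (kinetic k T w t + defect m t) \<le> 0"
      using energy_derivative(2)[OF t(1)] defect_nonneg[OF t(2)] k by simp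
    then show "\<exists>d. (energy k T w m has_real_derivative d) (at t) \<and> d \<le> 0"
      using energy_derivative(1)[OF t(1)] by force
  qed
  have T0: "0 \<in> {0..T}" "T \<in> {0..T}" using T by auto
  have int\<mu>: "\<mu> integrable_on cbox 0 1" by (rule continuous_integrable[OF \<mu>_continuous])
  define c where "c = gap k T w 0 0"
  note gc = gap_cont[OF T0(1)]
  have "energy k T w m 0 = integral (cbox 0 1) (\<lambda>x. gap k T w x 0) - integral (cbox 0 1) (\<lambda>x. gap k T w x 0 * \<mu> x)"
    by (simp add: energy_def mean_gap_def initial)
  moreover have "integral (cbox 0 1) (\<lambda>x. gap k T w x 0) \<le> integral (cbox 0 1) (\<lambda>x::real^'n. c + osc)"
    using gap_oscillation[OF T0(1), of _ 0]
    by (intro integral_le continuous_integrable gc continuous_intros) (auto simp: c_def abs_le_iff algebra_simps)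
  moreover have "integral (cbox 0 1) (\<lambda>x. (c - osc) * \<mu> x) \<le> integral (cbox 0 1) (\<lambda>x. gap k T w x 0 * \<mu> x)"
  proof (intro integral_le continuous_integrable continuous_on_mult gc continuous_intros \<mu>_continuous mult_right_mono less_imp_le[OF \<mu>_pos])
    show "c - osc \<le> gap k T w x 0" for x
      using gap_oscillation[OF T0(1), of x 0] by (auto simp: c_def abs_le_iff algebra_simps)
  qed
  moreover have "integral (cbox 0 1) (\<lambda>x::real^'n. c + osc) = c + osc"
    by (simp add: unit_cell_content del: content_eq_0)
  moreover have "integral (cbox 0 1) (\<lambda>x. (c - osc) * \<mu> x) = c - osc" by (simp add: \<mu>_mass)
  ultimately have "energy k T w m 0 \<le> 2 * osc" by linarith
  then show "energy k T w m t \<le> 2 * osc" using anti[of 0 t] t by simp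
  have gT: "gap k T w x T = - v x" for x by (simp add: stationary_def final)
  have mT: "(\<lambda>x. m x T) integrable_on cbox 0 1" by (rule continuous_integrable[OF m_cont[OF T0(2)]])
  have "integral (cbox 0 1) (\<lambda>x. - A * m x T) \<le> integral (cbox 0 1) (\<lambda>x. gap k T w x T * m x T)"
    unfolding gT using v_bound
    by (intro integral_le continuous_integrable continuous_on_mult continuous_intros m_cont[OF T0(2)]
        C2_continuous(1)[OF v_C2] mult_right_mono m_nonneg[OF T0(2)]) (auto simp: abs_le_iff)
  moreover have "mean_gap k T w T \<le> integral (cbox 0 1) (\<lambda>x. A * \<mu> x)"
    unfolding mean_gap_def gT using v_bound
    by (intro integral_le continuous_integrable continuous_on_mult continuous_intros \<mu>_continuous
        C2_continuous(1)[OF v_C2] mult_right_mono less_imp_le[OF \<mu>_pos]) (auto simp: abs_le_iff minus_le_iff)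
  ultimately have "- (2 * A) \<le> energy k T w m T"
    using mass[OF T0(2)] by (simp add: energy_def \<mu>_mass)
  then show "- (2 * A) \<le> energy k T w m t" using anti[of t T] t by simp
qed

lemma gap_bound:
  assumes t: "t \<in> {0..T}" shows "\<bar>gap k T w x t\<bar> \<le> osc + \<bar>mean_gap k T w t\<bar>"
proof -
  note gc = gap_cont[OF t]
  have "gap k T w x t - osc \<le> gap k T w y t \<and> gap k T w y t \<le> gap k T w x t + osc" for y
    using gap_oscillation[OF t, of x y] by (auto simp: abs_le_iff algebra_simps)
  then have "integral (cbox 0 1) (\<lambda>y. (gap k T w x t - osc) * \<mu> y) \<le> mean_gap k T w t"
    "mean_gap k T w t \<le> integral (cbox 0 1) (\<lambda>y. (gap k T w x t + osc) * \<mu> y)"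
    unfolding mean_gap_def
    by (intro integral_le continuous_integrable continuous_on_mult gc continuous_on_const \<mu>_continuous
        mult_right_mono less_imp_le[OF \<mu>_pos]; blast)+
  then show ?thesis by (simp add: \<mu>_mass; linarith)
qed

context
  fixes \<gamma> \<delta> :: real
  assumes \<gamma>: "0 < \<gamma>" and coercive: "\<And>y s s' \<delta>. 0 \<le> s \<Longrightarrow> s' \<in> {0..b} \<Longrightarrow> 0 < \<delta> \<Longrightarrow> \<delta> \<le> 1 \<Longrightarrow>
       \<bar>s - s'\<bar> \<le> \<delta> + (V y s - V y s') * (s - s') / (\<gamma> * \<delta>)"
    and \<delta>: "0 < \<delta>" "\<delta> \<le> 1"
begin

lemma density_gap_le_defect:
  assumes t: "t \<in> {0..T}"
  shows "density_gap m t \<le> \<delta> + defect m t / (\<gamma> * \<delta>)"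
proof -
  let ?q = "\<lambda>x. (V x (m x t) - V x (\<mu> x)) * (m x t - \<mu> x)"
  have qc: "continuous_on UNIV ?q"
    by (intro continuous_intros m_cont Vm_cont V\<mu>_cont \<mu>_continuous t)
  have "density_gap m t \<le> integral (cbox 0 1) (\<lambda>x. \<delta> + 1 / (\<gamma> * \<delta>) * ?q x)"
    unfolding density_gap_def
  proof (intro integral_le continuous_integrable)
    show "continuous_on UNIV (\<lambda>x. \<bar>m x t - \<mu> x\<bar>)"
      by (intro continuous_on_rabs continuous_on_diff m_cont t \<mu>_continuous)
    show "continuous_on UNIV (\<lambda>x. \<delta> + 1 / (\<gamma> * \<delta>) * ?q x)"
      by (rule continuous_on_add[OF continuous_on_const continuous_on_mult[OF continuous_on_const qc]])
    show "\<bar>m x t - \<mu> x\<bar> \<le> \<delta> + 1 / (\<gamma> * \<delta>) * ?q x" for x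
      using coercive[OF m_nonneg[OF t] \<mu>_le \<delta>, of x x] by simp
  qed
  also have "\<dots> = \<delta> + 1 / (\<gamma> * \<delta>) * defect m t"
    using integral_add[of "\<lambda>x::real^'n. \<delta>" "cbox 0 1" "\<lambda>x. 1 / (\<gamma> * \<delta>) * ?q x"]
      continuous_integrable[OF continuous_on_mult[OF continuous_on_const qc]]
    by (simp only: integral_mult_right integrable_const defect_def integral_const unit_cell_content) simp
  finally show ?thesis by simp
qed

lemma density_gap_integral:
  "integral {0..T} (density_gap m) \<le> \<delta> * T + (2 * osc + 2 * A) / (k * (\<gamma> * \<delta>))"
proof -
  define c where "c = 1 / (k * (\<gamma> * \<delta>))"
  have c: "0 < c" using k \<gamma> \<delta> by (simp add: c_def)
  \<comment> \<open>Monotonicity of this combination replaces integrating the dissipation up to the end points,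
    where the derivatives need not be bounded.\<close>
  define g where "g t = integral {0..t} (density_gap m) + c * energy k T w m t - \<delta> * t" for t
  have "g T \<le> g 0"
  proof (rule antimono_of_derivative[of T g])
    show "continuous_on {0..T} g"
      unfolding g_def
      by (intro continuous_intros energy_continuous indefinite_integral_continuous_1
          integrable_continuous_real density_gap_continuous)
    fix t assume t0: "0 < t" "t < T"
    then have t: "t \<in> {0<..<T}" "t \<in> {0..T}" by auto
    obtain d where d: "(energy k T w m has_real_derivative d) (at t)" "d \<le> - k * (kinetic k T w t + defect m t)"
      using energy_derivative(1)[OF t(1)] by blast
    have "((\<lambda>t. integral {0..t} (density_gap m)) has_real_derivative density_gap m t) (at t within {0..T})"
      by (rule integral_has_real_derivative[OF density_gap_continuous t(2)])
    then have "((\<lambda>t. integral {0..t} (density_gap m)) has_real_derivative density_gap m t) (at t)"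
      using t0 at_within_interior[of t "{0..T}"] by simp
    then have "(g has_real_derivative density_gap m t + c * d - \<delta>) (at t)"
      unfolding g_def using d(1) by (auto intro!: derivative_eq_intros)
    moreover have "density_gap m t + c * d - \<delta> \<le> 0"
    proof -
      have "d \<le> - k * defect m t"
      proof -
        have "0 \<le> k * kinetic k T w t" using energy_derivative(2)[OF t(1)] k by simp
        then show ?thesis using d(2) by (simp add: algebra_simps)
      qed
      then have "c * d \<le> c * (- k * defect m t)" using c by (intro mult_left_mono) auto
      also have "\<dots> = - (defect m t / (\<gamma> * \<delta>))" using k \<gamma> \<delta> by (simp add: c_def)
      finally show ?thesis using density_gap_le_defect[OF t(2)] by linarith
    qed
    ultimately show "\<exists>d. (g has_real_derivative d) (at t) \<and> d \<le> 0" by blast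
  qed (use T in auto)
  then have "integral {0..T} (density_gap m) \<le> \<delta> * T + c * (energy k T w m 0 - energy k T w m T)"
    by (simp add: g_def right_diff_distrib)
  also have "c * (energy k T w m 0 - energy k T w m T) \<le> c * (2 * osc + 2 * A)"
    using energy_bound(1)[of 0] energy_bound(2)[of T] T c by (intro mult_left_mono) auto
  finally show ?thesis by (simp add: c_def)
qed

lemma mean_gap_bound:
  assumes K: "0 \<le> K" and modulus: "\<And>y s s'. 0 \<le> s \<Longrightarrow> s' \<in> {0..b} \<Longrightarrow> \<bar>V y s - V y s'\<bar> \<le> \<eta> + K * \<bar>s - s'\<bar>"
    and \<eta>: "0 \<le> \<eta>" and t: "t \<in> {0..T}"
  shows "\<bar>mean_gap k T w t\<bar> \<le> A + (1 + K * b / (\<gamma> * \<delta>)) * (2 * osc + 2 * A) + k * (\<eta> + K * b * \<delta>) * T"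
proof -
  \<comment> \<open>\<open>L\<close> is the price of trading the density gap for the decay of the energy, \<open>c\<close> the rate of the remaining error.\<close>
  define L where "L = 1 + K * b / (\<gamma> * \<delta>)"
  define c where "c = k * (\<eta> + K * b * \<delta>)"
  have L: "1 \<le> L" using K b_nonneg \<gamma> \<delta> by (simp add: L_def)
  have c: "0 \<le> c" using K b_nonneg k \<delta> \<eta> by (simp add: c_def)
  have rate: "\<exists>d e. (mean_gap k T w has_real_derivative d) (at t) \<and> (energy k T w m has_real_derivative e) (at t)
      \<and> \<bar>d\<bar> \<le> c - L * e" if t: "t \<in> {0<..<T}" for t
  proof -
    have t': "t \<in> {0..T}" using t by auto
    obtain e where e: "(energy k T w m has_real_derivative e) (at t)" "e \<le> - k * (kinetic k T w t + defect m t)"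
      using energy_derivative(1)[OF t] by blast
    let ?i = "integral (cbox 0 1) (\<lambda>x. \<mu> x * (V x (m x t) - V x (\<mu> x)))"
    have rc: "continuous_on UNIV (\<lambda>x. \<bar>m x t - \<mu> x\<bar>)"
      by (intro continuous_on_rabs continuous_on_diff m_cont t' \<mu>_continuous)
    have "norm ?i \<le> integral (cbox 0 1) (\<lambda>x. \<eta> * \<mu> x + (K * b) * \<bar>m x t - \<mu> x\<bar>)"
    proof (rule integral_norm_bound_integral)
      show "(\<lambda>x. \<mu> x * (V x (m x t) - V x (\<mu> x))) integrable_on cbox 0 1"
        by (rule continuous_integrable[OF continuous_on_mult[OF \<mu>_continuous continuous_on_diff[OF Vm_cont[OF t'] V\<mu>_cont]]])
      show "(\<lambda>x. \<eta> * \<mu> x + (K * b) * \<bar>m x t - \<mu> x\<bar>) integrable_on cbox 0 1"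
        by (rule continuous_integrable[OF continuous_on_add[OF continuous_on_mult[OF continuous_on_const \<mu>_continuous]
             continuous_on_mult[OF continuous_on_const rc]]])
      show "norm (\<mu> x * (V x (m x t) - V x (\<mu> x))) \<le> \<eta> * \<mu> x + (K * b) * \<bar>m x t - \<mu> x\<bar>" for x
      proof -
        have "norm (\<mu> x * (V x (m x t) - V x (\<mu> x))) \<le> \<mu> x * (\<eta> + K * \<bar>m x t - \<mu> x\<bar>)"
          using modulus[OF m_nonneg[OF t'] \<mu>_le, of x x] \<mu>_pos[of x] by (simp add: abs_mult)
        moreover have "\<mu> x * (K * \<bar>m x t - \<mu> x\<bar>) \<le> b * (K * \<bar>m x t - \<mu> x\<bar>)"
          using \<mu>_bound[of x] K by (intro mult_right_mono) auto
        ultimately show ?thesis by (simp add: algebra_simps)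
      qed
    qed
    also have "\<dots> = \<eta> + (K * b) * density_gap m t"
      using integral_add[OF continuous_integrable[OF continuous_on_mult[OF continuous_on_const[of _ \<eta>] \<mu>_continuous]]
           continuous_integrable[OF continuous_on_mult[OF continuous_on_const[of _ "K * b"] rc]], of 0 1]
      by (simp only: integral_mult_right density_gap_def \<mu>_mass)
    also have "\<dots> \<le> \<eta> + (K * b) * (\<delta> + defect m t / (\<gamma> * \<delta>))"
      using density_gap_le_defect[OF t'] K b_nonneg by (intro add_left_mono mult_left_mono) auto
    also have "\<dots> = \<eta> + K * b * \<delta> + (L - 1) * defect m t" by (simp add: L_def algebra_simps)
    finally have i: "\<bar>?i\<bar> \<le> \<eta> + K * b * \<delta> + (L - 1) * defect m t" by simp
    have "\<bar>k * (kinetic k T w t - ?i)\<bar> = k * \<bar>kinetic k T w t - ?i\<bar>" using k by (simp add: abs_mult)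
    also have "\<dots> \<le> k * (L * (kinetic k T w t + defect m t) + (\<eta> + K * b * \<delta>))"
    proof (intro mult_left_mono)
      have "kinetic k T w t \<le> L * kinetic k T w t" "0 \<le> defect m t" "0 \<le> kinetic k T w t"
        using L energy_derivative(2)[OF t] defect_nonneg[OF t'] mult_right_mono[of 1 L "kinetic k T w t"] by auto
      then show "\<bar>kinetic k T w t - ?i\<bar> \<le> L * (kinetic k T w t + defect m t) + (\<eta> + K * b * \<delta>)"
        using i by (simp add: algebra_simps; linarith)
    qed (use k in auto)
    also have "\<dots> = c + L * (k * (kinetic k T w t + defect m t))" by (simp add: c_def algebra_simps)
    also have "\<dots> \<le> c + L * (- e)" using e(2) L by (intro add_left_mono mult_left_mono) auto
    finally show ?thesis using mean_gap_derivative[OF t] e(1) by (intro exI conjI) auto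
  qed
  have t0: "0 \<le> t" "t \<le> T" using t by auto
  \<comment> \<open>The two signs give the lower and the upper bound.\<close>
  have one: "\<sigma> * mean_gap k T w T + L * energy k T w m T - c * T \<le> \<sigma> * mean_gap k T w t + L * energy k T w m t - c * t"
    if \<sigma>: "\<sigma> = 1 \<or> \<sigma> = -1" for \<sigma>
  proof (rule antimono_of_derivative[of T "\<lambda>t. \<sigma> * mean_gap k T w t + L * energy k T w m t - c * t"])
    show "continuous_on {0..T} (\<lambda>t. \<sigma> * mean_gap k T w t + L * energy k T w m t - c * t)"
      by (intro continuous_intros mean_gap_continuous energy_continuous)
    fix s assume "0 < s" "s < T"
    then obtain d e where de: "(mean_gap k T w has_real_derivative d) (at s)" "(energy k T w m has_real_derivative e) (at s)"
      "\<bar>d\<bar> \<le> c - L * e" using rate[of s] by auto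
    have "((\<lambda>t. \<sigma> * mean_gap k T w t + L * energy k T w m t - c * t) has_real_derivative \<sigma> * d + L * e - c) (at s)"
      using de(1,2) by (auto intro!: derivative_eq_intros)
    moreover have "\<sigma> * d + L * e - c \<le> 0" using de(3) \<sigma> by auto
    ultimately show "\<exists>d. ((\<lambda>t. \<sigma> * mean_gap k T w t + L * energy k T w m t - c * t) has_real_derivative d) (at s) \<and> d \<le> 0"
      by blast
  qed (use t0 in auto)
  have T0: "T \<in> {0..T}" using T by auto
  have "\<bar>mean_gap k T w T\<bar> \<le> A"
  proof -
    have "norm (mean_gap k T w T) \<le> integral (cbox 0 1) (\<lambda>x. A * \<mu> x)"
      unfolding mean_gap_def
    proof (rule integral_norm_bound_integral)
      show "(\<lambda>x. gap k T w x T * \<mu> x) integrable_on cbox 0 1"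
        by (rule continuous_integrable[OF continuous_on_mult[OF gap_cont[OF T0] \<mu>_continuous]])
      show "(\<lambda>x. A * \<mu> x) integrable_on cbox 0 1"
        by (rule continuous_integrable[OF continuous_on_mult[OF continuous_on_const \<mu>_continuous]])
      show "norm (gap k T w x T * \<mu> x) \<le> A * \<mu> x" for x
        using v_bound[of x] \<mu>_pos[of x] by (simp add: stationary_def final abs_mult)
    qed
    then show ?thesis by (simp add: \<mu>_mass)
  qed
  moreover have "L * (energy k T w m t - energy k T w m T) \<le> L * (2 * osc + 2 * A)"
    using energy_bound(1)[OF t] energy_bound(2)[OF T0] L by (intro mult_left_mono) auto
  moreover have "0 \<le> c * t" using c t0 by simp
  ultimately have "\<bar>mean_gap k T w t\<bar> \<le> A + L * (2 * osc + 2 * A) + c * T"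
    using one[of 1] one[of "-1"] by (simp add: right_diff_distrib abs_le_iff; linarith)
  then show ?thesis by (simp add: L_def c_def)
qed

end

end

text \<open>Both errors consist of a part that is bounded independently of \<open>k\<close> and divided by \<open>k\<close>, and a part
  that is as small as desired.\<close>

theorem homogenization:
  assumes T: "0 < T" and \<epsilon>: "0 < \<epsilon>"
  shows "\<exists>N\<ge>1. \<forall>k\<ge>N. \<forall>w m. mean_field P (real k) T V w m \<longrightarrow>
      (\<forall>x. \<forall>t\<in>{0..T}. \<bar>w x t - real k * H * (t - T)\<bar> \<le> \<epsilon> * real k)
      \<and> integral {0..T} (density_gap m) \<le> \<epsilon>"
proof -
  obtain \<gamma> where \<gamma>: "\<gamma> > 0"
    and co: "\<And>y s s' \<delta>. 0 \<le> s \<Longrightarrow> s' \<in> {0..b} \<Longrightarrow> 0 < \<delta> \<Longrightarrow> \<delta> \<le> 1 \<Longrightarrow>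
       \<bar>s - s'\<bar> \<le> \<delta> + (V y s - V y s') * (s - s') / (\<gamma> * \<delta>)"
    using V_coercive[OF b_nonneg] by blast
  \<comment> \<open>First \<open>\<eta>\<close>, which fixes the modulus \<open>K\<close>, then \<open>\<delta>\<close>, and only then \<open>k\<close>: the errors without a factor \<open>1 / k\<close>
    are the two that \<open>\<eta>\<close> and \<open>\<delta>\<close> make small.\<close>
  define \<eta> where "\<eta> = \<epsilon> / (4 * T)"
  have \<eta>: "0 < \<eta>" using T \<epsilon> by (simp add: \<eta>_def)
  obtain K where K: "0 \<le> K"
    and mo: "\<And>y s s'. 0 \<le> s \<Longrightarrow> s' \<in> {0..b} \<Longrightarrow> \<bar>V y s - V y s'\<bar> \<le> \<eta> + K * \<bar>s - s'\<bar>"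
    using V_modulus[OF b_nonneg \<eta>] by blast
  define \<delta> where "\<delta> = min 1 (\<epsilon> / (4 * T * (K * b + 1)))"
  have Kb: "0 \<le> K * b" using K b_nonneg by simp
  have \<delta>: "0 < \<delta>" "\<delta> \<le> 1" using T \<epsilon> Kb by (auto simp: \<delta>_def)
  have "\<delta> * (4 * T * (K * b + 1)) \<le> \<epsilon> / (4 * T * (K * b + 1)) * (4 * T * (K * b + 1))"
    using T Kb by (intro mult_right_mono) (auto simp: \<delta>_def)
  then have "\<delta> * (4 * T * (K * b + 1)) \<le> \<epsilon>" using T Kb by simp
  then have \<delta>T: "(K * b * \<delta>) * T + \<delta> * T \<le> \<epsilon> / 4" by (simp add: algebra_simps)
  have nn: "0 \<le> (K * b * \<delta>) * T" "0 \<le> \<delta> * T" using Kb \<delta> T by auto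
  define R where "R = osc + 2 * A + (1 + K * b / (\<gamma> * \<delta>)) * (2 * osc + 2 * A)"
  define S where "S = (2 * osc + 2 * A) / (\<gamma> * \<delta>)"
  obtain N1 :: nat where N1: "real N1 > 2 * R / \<epsilon>" using reals_Archimedean2 by blast
  obtain N2 :: nat where N2: "real N2 > 2 * S / \<epsilon>" using reals_Archimedean2 by blast
  have big: "R \<le> \<epsilon> / 2 * real k \<and> S \<le> \<epsilon> / 2 * real k \<and> 0 < real k" if "max 1 (max N1 N2) \<le> k" for k
  proof -
    have "2 * R / \<epsilon> \<le> real k" "2 * S / \<epsilon> \<le> real k" using N1 N2 that by auto
    then show ?thesis using \<epsilon> that by (auto simp: field_simps)
  qed
  have "(\<forall>x. \<forall>t\<in>{0..T}. \<bar>w x t - real k * H * (t - T)\<bar> \<le> \<epsilon> * real k)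
      \<and> integral {0..T} (density_gap m) \<le> \<epsilon>"
    if k: "max 1 (max N1 N2) \<le> k" and mf: "mean_field P (real k) T V w m" for k w m
  proof (intro conjI allI ballI)
    note B = big[OF k]
    then have k0: "0 < real k" by simp
    show "\<bar>w x t - real k * H * (t - T)\<bar> \<le> \<epsilon> * real k" if t: "t \<in> {0..T}" for x t
    proof -
      have "\<bar>w x t - real k * H * (t - T)\<bar> \<le> \<bar>gap (real k) T w x t\<bar> + A"
        using v_bound[of x] unfolding stationary_def by linarith
      also have "\<bar>gap (real k) T w x t\<bar> \<le> osc + \<bar>mean_gap (real k) T w t\<bar>"
        by (rule gap_bound[OF mf k0 T t])
      also have "\<bar>mean_gap (real k) T w t\<bar> \<le> A + (1 + K * b / (\<gamma> * \<delta>)) * (2 * osc + 2 * A) + real k * (\<eta> + K * b * \<delta>) * T"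
        by (rule mean_gap_bound[OF mf k0 T \<gamma> co \<delta> K mo less_imp_le[OF \<eta>] t])
      finally have "\<bar>w x t - real k * H * (t - T)\<bar> \<le> R + real k * (\<eta> * T + K * b * \<delta> * T)"
        by (simp add: R_def algebra_simps)
      also have "\<eta> * T = \<epsilon> / 4" using T by (simp add: \<eta>_def)
      also have "real k * (\<epsilon> / 4 + K * b * \<delta> * T) \<le> real k * (\<epsilon> / 2)"
        using \<delta>T nn by (intro mult_left_mono) auto
      also have "R + real k * (\<epsilon> / 2) \<le> \<epsilon> * real k" using B by (simp add: algebra_simps)
      finally show ?thesis by simp
    qed
    have "integral {0..T} (density_gap m) \<le> \<delta> * T + (2 * osc + 2 * A) / (real k * (\<gamma> * \<delta>))"
      by (rule density_gap_integral[OF mf k0 T \<gamma> co \<delta>])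
    also have "(2 * osc + 2 * A) / (real k * (\<gamma> * \<delta>)) = S / real k" by (simp add: S_def)
    also have "S / real k \<le> \<epsilon> / 2" using B by (simp add: field_simps)
    finally show "integral {0..T} (density_gap m) \<le> \<epsilon>" using \<delta>T nn \<epsilon> by linarith
  qed
  then show ?thesis by (intro exI[of _ "max 1 (max N1 N2)"]) simp
qed

end

section \<open>From the oscillating and the cell problem to the rescaled system\<close>

lemma divergence_scaleR:
  fixes m :: "real^'n \<Rightarrow> real" and G :: "real^'n \<Rightarrow> real^'n"
  assumes "C1 m" "C1 G"
  shows "divergence (\<lambda>y. m y *\<^sub>R G y) x = grad m x \<bullet> G x + m x * divergence G x"
proof -
  have *: "((\<lambda>y. m y *\<^sub>R G y) has_derivative
      (\<lambda>h. m x *\<^sub>R frechet_derivative G (at x) h + frechet_derivative m (at x) h *\<^sub>R G x)) (at x)"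
    by (intro has_derivative_scaleR C1_has_derivative assms)
  have "partial i (\<lambda>y. m y *\<^sub>R G y) x = m x *\<^sub>R partial i G x + partial i m x *\<^sub>R G x" for i
    unfolding partial_eqI[OF *] by (simp add: partial_def)
  then show ?thesis
    by (simp add: divergence_def inner_vec_def sum.distrib sum_distrib_left)
qed

lemma rescaled_mean_field:
  fixes u m :: "real^'n \<Rightarrow> real \<Rightarrow> real"
  assumes sol: "periodic_mfg_solution V P T (1 / real k) u m" and k: "1 \<le> k"
  shows "mean_field P (real k) T V (\<lambda>x t. real k * u ((1 / real k) *\<^sub>R x) t - P \<bullet> x)
           (\<lambda>x t. m ((1 / real k) *\<^sub>R x) t)"
proof -
  define c where "c = 1 / real k"
  have kc: "real k * c = 1" "c \<noteq> 0" using k by (auto simp: c_def)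
  have S: "C21 T u" "C21 T m"
    "\<And>x t. t \<in> {0<..<T} \<Longrightarrow> - deriv (u x) t - c * laplacian (\<lambda>y. u y t) x + 1/2 * (norm (grad (\<lambda>y. u y t) x))\<^sup>2
          = V (x /\<^sub>R c) (m x t)"
    "\<And>x t. t \<in> {0<..<T} \<Longrightarrow> deriv (m x) t - c * laplacian (\<lambda>y. m y t) x
          - divergence (\<lambda>y. m y t *\<^sub>R grad (\<lambda>z. u z t) y) x = 0"
    "\<And>x. u x T = P \<bullet> x" "\<And>x. m x 0 = 1"
    "\<And>t. t \<in> {0..T} \<Longrightarrow> periodic c (\<lambda>x. u x t - P \<bullet> x)" "\<And>t. t \<in> {0..T} \<Longrightarrow> periodic c (\<lambda>x. m x t)"
    using sol unfolding periodic_mfg_solution_def mfg_solution_def c_def by blast+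
  \<comment> \<open>The vanishing term \<open>0 * (t - T)\<close> gives the subtracted function the form that \<open>C21_stationary\<close> treats.\<close>
  define w where "w x t = real k * u (c *\<^sub>R x) t - (P \<bullet> x + 0 * (t - T))" for x t
  define M where "M x t = 1 * m (c *\<^sub>R x) t" for x t
  note us = C21_scale[OF S(1), where a = "real k" and c = c] and ms = C21_scale[OF S(2), where a = 1 and c = c]
  note st = C21_stationary[OF C2_inner[of P], where T = T and b = 0]
  have Cw: "C21 T w" unfolding w_def by (rule C21_diff(1)[OF us(1) st(1)])
  have CM: "C21 T M" unfolding M_def by (rule ms(1))
  have perw: "periodic 1 (\<lambda>x. w x t)" and perM: "periodic 1 (\<lambda>x. M x t)" if t: "t \<in> {0..T}" for t
  proof -
    have 1: "u (c *\<^sub>R x + c *\<^sub>R v) t - P \<bullet> (c *\<^sub>R x + c *\<^sub>R v) = u (c *\<^sub>R x) t - P \<bullet> (c *\<^sub>R x)"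
      if "\<forall>i. v $ i \<in> \<int>" for x v using S(7)[OF t] that unfolding periodic_def by blast
    have 2: "m (c *\<^sub>R x + c *\<^sub>R v) t = m (c *\<^sub>R x) t"
      if "\<forall>i. v $ i \<in> \<int>" for x v using S(8)[OF t] that unfolding periodic_def by blast
    show "periodic 1 (\<lambda>x. M x t)" using 2 unfolding periodic_def M_def by (simp add: scaleR_add_right)
    show "periodic 1 (\<lambda>x. w x t)" unfolding periodic_def
    proof (intro allI impI)
      fix x v :: "real^'n" assume v: "\<forall>i. v $ i \<in> \<int>"
      have "u (c *\<^sub>R x + c *\<^sub>R v) t = u (c *\<^sub>R x) t + c * (P \<bullet> v)"
        using 1[OF v, of x] by (simp add: inner_add_right)
      then have "w (x + v) t = real k * u (c *\<^sub>R x) t + (real k * c) * (P \<bullet> v) - P \<bullet> x - P \<bullet> v"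
        unfolding w_def by (simp only: scaleR_add_right inner_add_right) (simp add: algebra_simps)
      then show "w (x + 1 *\<^sub>R v) t = w x t" unfolding kc by (simp add: w_def)
    qed
  qed
  have key: "deriv (w x) t = real k * (1/2 * (norm (grad (\<lambda>y. w y t) x + P))\<^sup>2 - laplacian (\<lambda>y. w y t) x - V x (M x t)) \<and>
     deriv (M x) t = real k * (laplacian (\<lambda>y. M y t) x + grad (\<lambda>y. M y t) x \<bullet> (grad (\<lambda>y. w y t) x + P)
            + M x t * laplacian (\<lambda>y. w y t) x)" if t: "t \<in> {0<..<T}" for x t
  proof -
    let ?X = "c *\<^sub>R x"
    have c2: "C2 (\<lambda>x. u x t)" "C2 (\<lambda>x. m x t)" using C21_D(2)[OF S(1)] C21_D(2)[OF S(2)] t by auto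
    have c1: "C1 (\<lambda>x. m x t)" "C1 (grad (\<lambda>x. u x t))" using c2 by (auto simp: C2_def)
    note d = C2_diff[OF C2_scale(1)[OF c2(1), of "real k" c] C2_inner]
    have gw: "grad (\<lambda>y. w y t) x + P = grad (\<lambda>y. u y t) ?X"
      unfolding w_def using d(2)[of _ P x] C2_scale(2)[OF c2(1), of _ "real k" c x] kc
      by (simp add: vec_eq_iff C1_inner)
    have lw: "laplacian (\<lambda>y. w y t) x = c * laplacian (\<lambda>y. u y t) ?X"
      unfolding w_def laplacian_eq
      using d(3)[of _ P x] C2_scale(3)[OF c2(1), of _ "real k" c x] kc
      by (simp add: grad_inner C1_const power2_eq_square sum_distrib_left mult.assoc[symmetric])
    have gM: "grad (\<lambda>y. M y t) x = c *\<^sub>R grad (\<lambda>y. m y t) ?X"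
      unfolding M_def using C2_scale(2)[OF c2(2), of _ 1 c x] by (simp add: vec_eq_iff)
    have lM: "laplacian (\<lambda>y. M y t) x = c\<^sup>2 * laplacian (\<lambda>y. m y t) ?X"
      unfolding M_def laplacian_eq using C2_scale(3)[OF c2(2), of _ 1 c x] by (simp add: sum_distrib_left)
    have dw: "deriv (w x) t = real k * deriv (u ?X) t"
      unfolding w_def[abs_def] C21_diff(2)[OF us(1) st(1) t] us(2)[OF t] st(2) by simp
    have dM: "deriv (M x) t = deriv (m ?X) t"
      unfolding M_def[abs_def] ms(2)[OF t] by simp
    have Xx: "?X /\<^sub>R c = x" using kc by simp
    have "deriv (u ?X) t = 1/2 * (norm (grad (\<lambda>y. u y t) ?X))\<^sup>2 - c * laplacian (\<lambda>y. u y t) ?X - V x (m ?X t)"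
      using S(3)[OF t, of ?X] unfolding Xx by linarith
    then have 1: "deriv (w x) t = real k * (1/2 * (norm (grad (\<lambda>y. w y t) x + P))\<^sup>2 - laplacian (\<lambda>y. w y t) x - V x (M x t))"
      unfolding dw gw lw by (simp add: M_def)
    have "deriv (m ?X) t = c * laplacian (\<lambda>y. m y t) ?X + (grad (\<lambda>y. m y t) ?X \<bullet> grad (\<lambda>z. u z t) ?X
         + m ?X t * laplacian (\<lambda>z. u z t) ?X)"
      using S(4)[OF t, of ?X] unfolding divergence_scaleR[OF c1] laplacian_def by linarith
    also have "\<dots> = (real k * c) * (c * laplacian (\<lambda>y. m y t) ?X + (grad (\<lambda>y. m y t) ?X \<bullet> grad (\<lambda>z. u z t) ?X
         + m ?X t * laplacian (\<lambda>z. u z t) ?X))" using kc by simp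
    also have "\<dots> = real k * (laplacian (\<lambda>y. M y t) x + grad (\<lambda>y. M y t) x \<bullet> (grad (\<lambda>y. w y t) x + P)
            + M x t * laplacian (\<lambda>y. w y t) x)"
      unfolding gw lw gM lM by (simp add: M_def power2_eq_square algebra_simps)
    finally show ?thesis using 1 dM by simp
  qed
  have "w x T = 0" for x unfolding w_def S(5) using kc by (simp add: mult.assoc[symmetric])
  moreover have "M x 0 = 1" for x by (simp add: M_def S(6))
  ultimately have "mean_field P (real k) T V w M"
    unfolding mean_field_def hamilton_jacobi_def fokker_planck_def using Cw CM perw perM key by blast
  moreover have "w = (\<lambda>x t. real k * u ((1 / real k) *\<^sub>R x) t - P \<bullet> x)" "M = (\<lambda>x t. m ((1 / real k) *\<^sub>R x) t)"
    by (auto simp: w_def M_def c_def fun_eq_iff)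
  ultimately show ?thesis by simp
qed

lemma continuous_set_integrable:
  fixes f :: "'a::euclidean_space \<Rightarrow> 'b::euclidean_space"
  assumes "continuous_on UNIV f" shows "set_integrable lborel (cbox a b) f"
  unfolding set_integrable_def
  by (rule borel_integrable_compact) (use assms continuous_on_subset in auto)

text \<open>The weak gradient is an arbitrary integrable function, and so are its products with derivatives
  of test functions.\<close>

lemma set_integrable_scaleR_bounded:
  fixes g :: "'a::euclidean_space \<Rightarrow> 'b::euclidean_space"
  assumes g: "set_integrable lborel S g" and \<psi>: "\<psi> \<in> borel_measurable borel" "\<And>y. y \<in> S \<Longrightarrow> \<bar>\<psi> y\<bar> \<le> K"
  shows "set_integrable lborel S (\<lambda>y. \<psi> y *\<^sub>R g y)"
proof -
  have gi: "integrable lborel (\<lambda>x. indicator S x *\<^sub>R g x)"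
    using g by (simp add: set_integrable_def)
  show ?thesis unfolding set_integrable_def
  proof (rule Bochner_Integration.integrable_bound[OF integrable_scaleR_right[OF gi, of K]])
    have "(\<lambda>x. \<psi> x *\<^sub>R (indicator S x *\<^sub>R g x)) \<in> borel_measurable lborel"
      by (rule borel_measurable_scaleR[OF _ borel_measurable_integrable[OF gi]]) (simp add: \<psi>)
    then show "(\<lambda>x. indicator S x *\<^sub>R \<psi> x *\<^sub>R g x) \<in> borel_measurable lborel"
      by (simp add: mult.commute)
    show "AE x in lborel. norm (indicator S x *\<^sub>R \<psi> x *\<^sub>R g x) \<le> norm (K *\<^sub>R indicator S x *\<^sub>R g x)"
    proof (intro AE_I2)
      fix x
      have "\<bar>\<psi> x\<bar> * norm (g x) \<le> \<bar>K\<bar> * norm (g x)" if "x \<in> S"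
        using \<psi>(2)[OF that] by (intro mult_right_mono) auto
      then show "norm (indicator S x *\<^sub>R \<psi> x *\<^sub>R g x) \<le> norm (K *\<^sub>R indicator S x *\<^sub>R g x)"
        by (simp add: indicator_def)
    qed
  qed
qed

lemma set_integrable_scaleR_continuous:
  fixes g :: "'a::euclidean_space \<Rightarrow> 'b::euclidean_space"
  assumes g: "set_integrable lborel (cbox a b) g" and \<psi>: "continuous_on UNIV \<psi>"
  shows "set_integrable lborel (cbox a b) (\<lambda>y. \<psi> y *\<^sub>R g y)"
proof -
  have "compact (\<psi> ` cbox a b)" by (intro compact_continuous_image continuous_on_subset[OF \<psi>]) auto
  then obtain K where K: "\<And>y. y \<in> cbox a b \<Longrightarrow> \<bar>\<psi> y\<bar> \<le> K"
    using compact_imp_bounded[THEN bounded_iff[THEN iffD1]] by (metis image_eqI real_norm_def)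
  then show ?thesis
    by (rule set_integrable_scaleR_bounded[OF g borel_measurable_continuous_onI[OF \<psi>]])
qed

lemma C1_component:
  fixes G :: "real^'n \<Rightarrow> real^'m"
  assumes "C1 G"
  shows "C1 (\<lambda>x. G x $ i)" "partial j (\<lambda>x. G x $ i) x = partial j G x $ i"
proof -
  have *: "((\<lambda>x. G x $ i) has_derivative (\<lambda>h. frechet_derivative G (at x) h $ i)) (at x)" for x
    by (rule bounded_linear.has_derivative[OF bounded_linear_vec_nth C1_has_derivative[OF assms]])
  show "C1 (\<lambda>x. G x $ i)"
    by (rule C1I[OF *]) (intro continuous_on_component C1_derivative_continuous assms)
  show "partial j (\<lambda>x. G x $ i) x = partial j G x $ i"
    unfolding partial_eqI[OF *] by (simp add: partial_def)
qed

text \<open>For test functions of class \<open>C2\<close> the weak gradient of the density disappears by a second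
  integration by parts; this is the form that \<open>transported\<close> asks for.\<close>

lemma weak_fokker_planck_C2:
  fixes m :: "real^'n \<Rightarrow> real" and g p :: "real^'n \<Rightarrow> real^'n"
  assumes m: "continuous_on UNIV m" and p: "continuous_on UNIV p" and g: "weak_grad m g"
    and weak: "\<And>\<phi>. C1 \<phi> \<Longrightarrow> periodic 1 \<phi> \<Longrightarrow>
           (LINT y:unit_cell|lborel. (g y + m y *\<^sub>R p y) \<bullet> grad \<phi> y) = 0"
    and \<phi>: "C2 \<phi>" "periodic 1 \<phi>"
  shows "integral (cbox 0 1) (\<lambda>x. m x * (laplacian \<phi> x - p x \<bullet> grad \<phi> x)) = 0"
proof -
  have gi: "set_integrable lborel (cbox 0 1) g" using g by (simp add: weak_grad_def)
  have c1: "C1 \<phi>" "C1 (grad \<phi>)" using \<phi> by (auto simp: C2_def)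
  let ?h = "\<lambda>i y. partial i \<phi> y *\<^sub>R g y"
  have hi: "set_integrable lborel (cbox 0 1) (?h i)" for i
    by (rule set_integrable_scaleR_continuous[OF gi C1_partial_continuous[OF c1(1)]])
  have HK: "(\<lambda>y. partial i \<phi> y * g y $ i) integrable_on cbox 0 1"
    "integral (cbox 0 1) (\<lambda>y. partial i \<phi> y * g y $ i) = - integral (cbox 0 1) (\<lambda>y. m y * partial i (grad \<phi>) y $ i)" for i
  proof -
    have int: "?h i integrable_on cbox 0 1" by (rule set_borel_integral_eq_integral(1)[OF hi])
    show "(\<lambda>y. partial i \<phi> y * g y $ i) integrable_on cbox 0 1"
      using integrable_linear[OF int bounded_linear_vec_nth[of i]] by (simp add: o_def)
    have C: "C1 (partial i \<phi>)" "grad (partial i \<phi>) y $ i = partial i (grad \<phi>) y $ i" for y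
      using C1_component[OF c1(2), of i] by auto
    have cg: "continuous_on UNIV (\<lambda>y. m y *\<^sub>R grad (partial i \<phi>) y)"
      by (intro continuous_on_scaleR m C1_grad_continuous C)
    \<comment> \<open>Tested with \<open>partial i \<phi>\<close>, the weak gradient is traded for \<open>m\<close> and a second derivative of \<open>\<phi>\<close>.\<close>
    have "(LINT y:unit_cell|lborel. m y *\<^sub>R grad (partial i \<phi>) y) = - (LINT y:unit_cell|lborel. ?h i y)"
      using g C(1) periodic_partial[OF \<phi>(2)] unfolding weak_grad_def by blast
    then have eq: "integral (cbox 0 1) (\<lambda>y. m y *\<^sub>R grad (partial i \<phi>) y) = - integral (cbox 0 1) (?h i)"
      unfolding set_borel_integral_eq_integral(2)[OF hi]
        set_borel_integral_eq_integral(2)[OF continuous_set_integrable[OF cg]] .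
    have "integral (cbox 0 1) (\<lambda>y. partial i \<phi> y * g y $ i) = integral (cbox 0 1) (?h i) $ i"
      using integral_component_eq_cart[OF int, of i] by simp
    also have "\<dots> = - (integral (cbox 0 1) (\<lambda>y. m y *\<^sub>R grad (partial i \<phi>) y) $ i)" unfolding eq by simp
    also have "integral (cbox 0 1) (\<lambda>y. m y *\<^sub>R grad (partial i \<phi>) y) $ i
        = integral (cbox 0 1) (\<lambda>y. m y * partial i (grad \<phi>) y $ i)"
      unfolding integral_component_eq_cart[OF continuous_integrable[OF cg], symmetric] by (simp only: vector_scaleR_component C(2) real_scaleR_def)
    finally show "integral (cbox 0 1) (\<lambda>y. partial i \<phi> y * g y $ i) = - integral (cbox 0 1) (\<lambda>y. m y * partial i (grad \<phi>) y $ i)" .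
  qed
  have cp: "continuous_on UNIV (\<lambda>y. m y * (p y \<bullet> grad \<phi> y))"
    by (intro continuous_intros m p C1_grad_continuous c1)
  have cl: "continuous_on UNIV (\<lambda>y. m y * partial i (grad \<phi>) y $ i)" for i
    by (intro continuous_intros m C2_continuous(3)[OF \<phi>(1)])
  have expand: "(g y + m y *\<^sub>R p y) \<bullet> grad \<phi> y
      = (\<Sum>i\<in>UNIV. partial i \<phi> y * g y $ i) + m y * (p y \<bullet> grad \<phi> y)" for y
    by (simp add: inner_vec_def sum.distrib sum_distrib_left algebra_simps)
  have si: "set_integrable lborel (cbox 0 1) (\<lambda>y. (g y + m y *\<^sub>R p y) \<bullet> grad \<phi> y)"
  proof -
    have "set_integrable lborel (cbox 0 1) (\<lambda>y. partial i \<phi> y * g y $ i)" for i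
    proof -
      have "integrable lborel (\<lambda>x. (indicator (cbox 0 1) x *\<^sub>R ?h i x) $ i)"
        using hi[of i] integrable_bounded_linear[OF bounded_linear_vec_nth] unfolding set_integrable_def by blast
      then show ?thesis unfolding set_integrable_def by (simp add: mult.assoc)
    qed
    then have "set_integrable lborel (cbox 0 1) (\<lambda>y. \<Sum>i\<in>UNIV. partial i \<phi> y * g y $ i)"
      unfolding set_integrable_def scaleR_sum_right by (intro Bochner_Integration.integrable_sum)
    then show ?thesis unfolding expand by (rule set_integral_add(1)[OF _ continuous_set_integrable[OF cp]])
  qed
  have "0 = integral (cbox 0 1) (\<lambda>y. (g y + m y *\<^sub>R p y) \<bullet> grad \<phi> y)"
    using weak[OF c1(1) \<phi>(2)] set_borel_integral_eq_integral(2)[OF si] by simp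
  also have "\<dots> = integral (cbox 0 1) (\<lambda>y. \<Sum>i\<in>UNIV. partial i \<phi> y * g y $ i) + integral (cbox 0 1) (\<lambda>y. m y * (p y \<bullet> grad \<phi> y))"
    unfolding expand by (intro integral_add integrable_sum HK continuous_integrable cp) auto
  also have "integral (cbox 0 1) (\<lambda>y. \<Sum>i\<in>UNIV. partial i \<phi> y * g y $ i)
      = - (\<Sum>i\<in>UNIV. integral (cbox 0 1) (\<lambda>y. m y * partial i (grad \<phi>) y $ i))"
    by (subst integral_sum) (auto simp: HK sum_negf)
  also have "(\<Sum>i\<in>UNIV. integral (cbox 0 1) (\<lambda>y. m y * partial i (grad \<phi>) y $ i))
      = integral (cbox 0 1) (\<lambda>y. m y * laplacian \<phi> y)"
    unfolding laplacian_eq sum_distrib_left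
    by (rule integral_sum[symmetric]) (auto intro: continuous_integrable[OF cl])
  finally have "integral (cbox 0 1) (\<lambda>y. m y * laplacian \<phi> y) - integral (cbox 0 1) (\<lambda>y. m y * (p y \<bullet> grad \<phi> y)) = 0"
    by simp
  moreover have "(\<lambda>y. m y * laplacian \<phi> y) integrable_on cbox 0 1"
    by (intro continuous_integrable continuous_on_mult m laplacian_continuous \<phi>(1))
  ultimately show ?thesis
    using integral_diff[OF _ continuous_integrable[OF cp], of "\<lambda>y. m y * laplacian \<phi> y" 0 1]
    by (simp add: right_diff_distrib)
qed

lemma cell_solution_corrector:
  assumes V: "monotone_coupling V C" and sol: "cell_solution V P 1 H v \<mu>"
  shows "\<exists>A b. cell_corrector V C P H v \<mu> A b"
proof -
  have v: "C2 v" "periodic 1 v"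
  proof -
    have "C2_holder (1/2) v" using sol unfolding cell_solution_def by auto
    then show "C2 v" by (simp add: C2_holder_def)
    show "periodic 1 v" using sol by (simp add: cell_solution_def)
  qed
  have \<mu>: "periodic 1 \<mu>" "continuous_on UNIV \<mu>" "\<And>y. 0 < \<mu> y" "(LINT y:unit_cell|lborel. \<mu> y) = 1"
    and eq: "\<And>y. - laplacian v y + 1/2 * (norm (grad v y + P))\<^sup>2 - V y (1 * \<mu> y) = H"
    and ex: "\<exists>g. weak_grad \<mu> g \<and> (\<forall>p>1. Lp_cell p \<mu> \<and> Lp_cell p g) \<and>
        (\<forall>\<phi>. C1 \<phi> \<and> periodic 1 \<phi> \<longrightarrow>
           (LINT y:unit_cell|lborel. (g y + \<mu> y *\<^sub>R (grad v y + P)) \<bullet> grad \<phi> y) = 0)"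
    using sol unfolding cell_solution_def by simp_all
  from ex obtain g where g: "weak_grad \<mu> g"
    "\<And>\<phi>. C1 \<phi> \<Longrightarrow> periodic 1 \<phi> \<Longrightarrow>
           (LINT y:unit_cell|lborel. (g y + \<mu> y *\<^sub>R (grad v y + P)) \<bullet> grad \<phi> y) = 0" by blast
  have c1: "C1 v" using v by (simp add: C2_def)
  have p: "continuous_on UNIV (\<lambda>y. grad v y + P)" by (intro continuous_intros C1_grad_continuous c1)
  obtain A where A: "\<And>y. \<bar>v y\<bar> \<le> A"
    using periodic_function_bounded[OF C2_continuous(1)[OF v(1)] v(2)] by blast
  obtain b where b: "\<And>y. \<bar>\<mu> y\<bar> \<le> b"
    using periodic_function_bounded[OF \<mu>(2,1)] by blast
  have mass: "integral (cbox 0 1) \<mu> = 1"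
    using \<mu>(4) set_borel_integral_eq_integral(2)[OF continuous_set_integrable[OF \<mu>(2)]] by simp
  have "cell_corrector_axioms V P H v \<mu> A b"
    by unfold_locales
      (use v \<mu> eq mass A b abs_le_D1[OF b] weak_fokker_planck_C2[OF \<mu>(2) p g] in auto)
  then show ?thesis using V by (auto simp: cell_corrector_def)
qed

lemma effective_problem_solution:
  fixes Hbar :: "real^'n \<Rightarrow> real \<Rightarrow> real"
  shows "effective_solution Hbar bbar P T (\<lambda>x t. P \<bullet> x + (t - T) * Hbar P 1) (\<lambda>x t. 1)"
proof -
  have g: "grad (\<lambda>y. P \<bullet> y + (t - T) * Hbar P 1) = (\<lambda>x. P)" for t
    unfolding grad_add_const grad_inner ..
  have d: "((\<lambda>t. P \<bullet> x + (t - T) * Hbar P 1) has_real_derivative Hbar P 1) (at t)" for x t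
    by (auto intro!: derivative_eq_intros)
  have dd: "(\<lambda>t. P \<bullet> x + (t - T) * Hbar P 1) differentiable (at t)" for x t
    using d real_differentiable_def by blast
  have "(\<lambda>y. P \<bullet> y + (t - T) * Hbar P 1) differentiable (at x)" for x t
    by (intro differentiable_add differentiable_const differentiableI[OF C1_has_derivative[OF C1_inner(1)]])
  then show ?thesis
    unfolding effective_solution_def g DERIV_imp_deriv[OF d]
    using dd
    by (auto simp: split_beta divergence_def C1_const intro!: continuous_intros)
qed

section \<open>Weak limits of oscillating functions\<close>

lemma integral_periodic_translate:
  fixes G :: "real^'n \<Rightarrow> real"
  assumes G: "continuous_on UNIV G" "periodic 1 G"
  shows "integral (cbox 0 1) (\<lambda>y. G (v + y)) = integral (cbox 0 1) G"
proof -
  have "integral (cbox 0 1) (\<lambda>y. G ((\<Sum>i\<in>S. v $ i *\<^sub>R axis i 1) + y)) = integral (cbox 0 1) G"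
    if "finite S" for S :: "'n set"
    using that
  proof induction
    case (insert i S)
    let ?F = "\<lambda>y. G ((\<Sum>i\<in>S. v $ i *\<^sub>R axis i 1) + y)"
    have "continuous_on UNIV ?F"
      by (intro continuous_on_compose2[OF G(1)] continuous_intros) auto
    moreover have "periodic 1 ?F"
      using G(2) unfolding periodic_def by (simp add: add.assoc[symmetric])
    ultimately have "integral (cbox 0 1) (\<lambda>y. ?F (y + v $ i *\<^sub>R axis i 1)) = integral (cbox 0 1) ?F"
      by (rule integral_periodic_shift)
    with insert show ?case by (simp add: add_ac)
  qed simp
  from this[of UNIV] have "integral (cbox 0 1) (\<lambda>y. G ((\<Sum>i\<in>UNIV. v $ i *\<^sub>R axis i 1) + y)) = integral (cbox 0 1) G"
    by simp
  moreover have "(\<Sum>i\<in>UNIV. v $ i *\<^sub>R axis i 1) = v"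
    by (simp add: vec_eq_iff axis_def if_distrib[of "\<lambda>a. _ * a"] cong: if_cong)
  ultimately show ?thesis by simp
qed

lemma norm_unit_cell: "y \<in> cbox 0 1 \<Longrightarrow> norm y \<le> norm (1 :: real^'n)"
  for y :: "real^'n"
  by (rule norm_le_componentwise_cart) (auto simp: mem_box_cart)

lemma mem_symmetric_cube: "x \<in> cbox (- (r *\<^sub>R 1)) (r *\<^sub>R 1) \<longleftrightarrow> (\<forall>i. \<bar>x $ i\<bar> \<le> r)" for x :: "real^'n"
  by (auto simp: mem_box_cart abs_le_iff minus_le_iff)

abbreviation slab :: "real \<Rightarrow> real \<Rightarrow> ((real^'n) \<times> real) set" where
  "slab r T \<equiv> cbox (- (r *\<^sub>R 1), 0) (r *\<^sub>R 1, T)"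

lemma mem_slab: "(x, t) \<in> slab r T \<longleftrightarrow> (\<forall>i. \<bar>x $ i\<bar> \<le> r) \<and> 0 \<le> t \<and> t \<le> T"
  by (auto simp: mem_symmetric_cube cbox_Pair_eq)

lemma borel_measurable_lebesgue_on: "f \<in> borel_measurable borel \<Longrightarrow> f \<in> borel_measurable (lebesgue_on S)"
  by (intro measurable_restrict_space1 measurable_completion) simp

text \<open>Translating the integration variable by \<open>y / k\<close> does not change the integral but turns \<open>g (k x)\<close>
  into \<open>g (k x + y)\<close>. Averaging over all \<open>y\<close> in the cell replaces the oscillating factor by its mean
  value zero; the error is the modulus of continuity of \<open>\<phi>\<close> at distance of order \<open>1 / k\<close>.\<close>

lemma oscillating_mean_zero_continuous:
  fixes g :: "real^'n \<Rightarrow> real" and \<phi> :: "(real^'n) \<times> real \<Rightarrow> real"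
  assumes g: "continuous_on UNIV g" "periodic 1 g" "integral (cbox 0 1) g = 0"
    and \<phi>: "continuous_on UNIV \<phi>" "\<And>x t. \<exists>i. \<bar>x $ i\<bar> > r \<Longrightarrow> \<phi> (x, t) = 0"
  shows "(\<lambda>k. integral (slab (r + 1) T) (\<lambda>z. g (real k *\<^sub>R fst z) * \<phi> z)) \<longlonglongrightarrow> 0"
proof (rule LIMSEQ_I)
  fix e :: real assume e: "0 < e"
  let ?B = "slab (r + 1) T :: ((real^'n) \<times> real) set"
  obtain G where G: "0 \<le> G" "\<And>y. \<bar>g y\<bar> \<le> G"
    using periodic_function_bounded[OF g(1,2)] by blast
  define vol where "vol = measure lborel ?B"
  have vol: "0 \<le> vol" by (simp add: vol_def)
  define \<omega> where "\<omega> = e / (2 * (G * vol + 1))"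
  have Gv: "0 \<le> G * vol" using G(1) vol by simp
  have \<omega>: "0 < \<omega>" using e Gv by (simp add: \<omega>_def)
  have "\<omega> * (2 * (G * vol + 1)) = e" using Gv by (simp add: \<omega>_def)
  moreover have "0 \<le> \<omega> * (G * vol)" using \<omega> Gv by simp
  ultimately have \<omega>e: "G * \<omega> * vol < e" using \<omega> by (simp add: algebra_simps; linarith)
  have "uniformly_continuous_on (slab (r + 2) T) \<phi>"
    by (intro compact_uniformly_continuous continuous_on_subset[OF \<phi>(1)]) auto
  then obtain d where d: "d > 0" "\<And>p q. p \<in> slab (r + 2) T \<Longrightarrow> q \<in> slab (r + 2) T \<Longrightarrow>
      dist p q < d \<Longrightarrow> dist (\<phi> p) (\<phi> q) < \<omega>"
    unfolding uniformly_continuous_on_def using \<omega> by metis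
  obtain N :: nat where N: "real N > norm (1 :: real^'n) / d" using reals_Archimedean2 by blast
  have "\<bar>integral ?B (\<lambda>z. g (real k *\<^sub>R fst z) * \<phi> z)\<bar> < e" if k: "max 1 N \<le> k" for k
  proof -
    have k0: "real k > 0" "1 / real k \<le> 1" using k by auto
    have "norm (1 :: real^'n) / d < real k" using N k by auto
    then have kd: "norm (1 :: real^'n) / real k < d" using d(1) k0 by (simp add: field_simps)
    define F where "F z = g (real k *\<^sub>R fst z) * \<phi> z" for z
    define s where "s y = ((1 / real k) *\<^sub>R y, 0 :: real)" for y :: "real^'n"
    have Fs: "F (z + s y) = g (real k *\<^sub>R fst z + y) * \<phi> (z + s y)" for z y
      using k0 by (simp add: F_def s_def scaleR_add_right)
    \<comment> \<open>The two slabs differ only where the shifted integrand vanishes.\<close>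
    have J: "integral ?B (\<lambda>z. F (z + s y)) = integral ?B F" if y: "y \<in> cbox 0 1" for y
    proof -
      let ?A = "cbox ((- ((r + 1) *\<^sub>R 1), 0) - s y) (((r + 1) *\<^sub>R 1, T) - s y)"
      have sy: "0 \<le> (1 / real k) * y $ i" "(1 / real k) * y $ i \<le> 1" for i
        using y k0 mult_mono[of "1 / real k" 1 "y $ i" 1] by (auto simp: mem_box_cart)
      have "integral ?B F = integral (?A) (\<lambda>z. F (z + s y))"
        by (rule integral_shift_cbox[symmetric])
      also have "\<dots> = integral ?B (\<lambda>z. F (z + s y))"
      proof (rule integral_spike_set)
        have supp: "\<bar>x $ i + (1 / real k) * y $ i\<bar> \<le> r" if "F ((x, t) + s y) \<noteq> 0" for x t i
        proof (rule ccontr)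
          assume "\<not> \<bar>x $ i + (1 / real k) * y $ i\<bar> \<le> r"
          then have "\<exists>i. \<bar>(x + (1 / real k) *\<^sub>R y) $ i\<bar> > r" by (intro exI[of _ i]) simp
          then have "\<phi> ((x, t) + s y) = 0" using \<phi>(2) by (simp add: s_def)
          then show False using that by (simp add: F_def)
        qed
        have "{z \<in> ?A - ?B. F (z + s y) \<noteq> 0} = {}"
        proof -
          have "(x, t) \<in> ?B" if "F ((x, t) + s y) \<noteq> 0" "(x, t) \<in> ?A" for x t
          proof -
            have "\<bar>x $ i\<bar> \<le> r + 1" for i using supp[OF that(1), of i] sy[of i] by linarith
            moreover have "0 \<le> t \<and> t \<le> T" using that(2) by (auto simp: s_def cbox_Pair_eq)
            ultimately show ?thesis unfolding mem_slab by blast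
          qed
          then show ?thesis by auto
        qed
        then show "negligible {z \<in> ?A - ?B. F (z + s y) \<noteq> 0}"
          by (simp only: negligible_empty)
        have "{z \<in> ?B - ?A. F (z + s y) \<noteq> 0} = {}"
        proof -
          have "(x, t) \<in> ?A" if "F ((x, t) + s y) \<noteq> 0" "(x, t) \<in> ?B" for x t
          proof -
            have "- (r + 1) - (1 / real k) * y $ i \<le> x $ i \<and> x $ i \<le> r + 1 - (1 / real k) * y $ i" for i
              using supp[OF that(1), of i] sy[of i] by linarith
            moreover have "0 \<le> t \<and> t \<le> T" using that(2) by (simp add: mem_slab)
            ultimately show ?thesis by (simp add: s_def cbox_Pair_eq mem_box_cart)
          qed
          then show ?thesis by auto
        qed
        then show "negligible {z \<in> ?B - ?A. F (z + s y) \<noteq> 0}"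
          by (simp only: negligible_empty)
      qed
      finally show ?thesis ..
    qed
    have cs: "continuous_on X s" for X unfolding s_def by (intro continuous_intros)
    have cg: "continuous_on X (\<lambda>(y, z). g (real k *\<^sub>R fst z + y))" for X :: "((real^'n) \<times> ((real^'n) \<times> real)) set"
      unfolding split_beta by (intro continuous_on_compose2[OF g(1)] continuous_intros) auto
    have c\<phi>: "continuous_on X (\<lambda>(y, z). \<phi> (z + s y))" for X :: "((real^'n) \<times> ((real^'n) \<times> real)) set"
      unfolding split_beta by (intro continuous_on_compose2[OF \<phi>(1)] continuous_intros continuous_on_compose2[OF cs]) auto
    have c\<phi>0: "continuous_on X (\<lambda>(y, z). \<phi> z)" for X :: "((real^'n) \<times> ((real^'n) \<times> real)) set"
      unfolding split_beta by (intro continuous_on_compose2[OF \<phi>(1)] continuous_intros) auto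
    \<comment> \<open>\<open>F2\<close> has cell average zero in \<open>y\<close>; \<open>F1\<close> is small because the shift \<open>s y\<close> is.\<close>
    define F1 where "F1 y z = g (real k *\<^sub>R fst z + y) * (\<phi> (z + s y) - \<phi> z)" for y z
    define F2 where "F2 y z = g (real k *\<^sub>R fst z + y) * \<phi> z" for y z
    have cF1: "continuous_on X (\<lambda>(y, z). F1 y z)" for X
      using continuous_on_mult[OF cg[of X] continuous_on_diff[OF c\<phi>[of X] c\<phi>0[of X]]] by (simp add: F1_def split_beta)
    have cF2: "continuous_on X (\<lambda>(y, z). F2 y z)" for X
      using continuous_on_mult[OF cg[of X] c\<phi>0[of X]] by (simp add: F2_def split_beta)
    have sec: "continuous_on X (h y)" if "\<And>X. continuous_on X (\<lambda>(y, z). h y z)" for h :: "real^'n \<Rightarrow> (real^'n) \<times> real \<Rightarrow> real" and X y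
    proof -
      have "continuous_on X (\<lambda>z. (\<lambda>(y, z). h y z) (y, z))"
        by (rule continuous_on_compose2[OF that[of UNIV]]) (auto intro!: continuous_intros)
      then show ?thesis by simp
    qed
    have i1: "F1 y integrable_on ?B" and i2: "F2 y integrable_on ?B" for y
      using integrable_continuous[OF sec[OF cF1]] integrable_continuous[OF sec[OF cF2]] by auto
    have j1: "(\<lambda>y. integral ?B (F1 y)) integrable_on cbox 0 1" and j2: "(\<lambda>y. integral ?B (F2 y)) integrable_on cbox 0 1"
      by (intro integrable_continuous integral_continuous_on_param cF1 cF2)+
    have "integral ?B F = integral (cbox 0 1) (\<lambda>y::real^'n. integral ?B F)"
      by (simp add: unit_cell_content del: content_eq_0)
    also have "\<dots> = integral (cbox 0 1) (\<lambda>y. integral ?B (F1 y) + integral ?B (F2 y))"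
    proof (rule integral_cong)
      fix y :: "real^'n" assume y: "y \<in> cbox 0 1"
      have "F (z + s y) = F1 y z + F2 y z" for z
        unfolding Fs F1_def F2_def by (simp add: algebra_simps)
      with J[OF y] have "integral ?B F = integral ?B (\<lambda>z. F1 y z + F2 y z)" by simp
      then show "integral ?B F = integral ?B (F1 y) + integral ?B (F2 y)"
        by (simp add: integral_add[OF i1 i2])
    qed
    also have "\<dots> = integral (cbox 0 1) (\<lambda>y. integral ?B (F1 y)) + integral (cbox 0 1) (\<lambda>y. integral ?B (F2 y))"
      by (rule integral_add[OF j1 j2])
    also have "integral (cbox 0 1) (\<lambda>y. integral ?B (F2 y)) = integral ?B (\<lambda>z. integral (cbox 0 1) (\<lambda>y. F2 y z))"
      by (rule integral_swap_continuous[OF cF2])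
    also have "\<dots> = 0"
      using integral_periodic_translate[OF g(1,2)] g(3) by (simp add: F2_def)
    finally have "\<bar>integral ?B F\<bar> = norm (integral (cbox 0 1) (\<lambda>y. integral ?B (F1 y)))" by simp
    also have "\<dots> \<le> integral (cbox 0 1) (\<lambda>y::real^'n. G * \<omega> * vol)"
    proof (rule integral_norm_bound_integral[OF j1])
      fix y :: "real^'n" assume y: "y \<in> cbox 0 1"
      have "norm (integral ?B (F1 y)) \<le> integral ?B (\<lambda>z. G * \<omega>)"
      proof (rule integral_norm_bound_integral[OF i1])
        fix z :: "(real^'n) \<times> real" assume z: "z \<in> ?B"
        obtain x t where zx: "z = (x, t)" by force
        have yi: "0 \<le> y $ i / real k" "y $ i / real k \<le> 1" for i
          using y k0 mult_mono[of "1 / real k" 1 "y $ i" 1] by (auto simp: mem_box_cart)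
        have xi: "\<bar>x $ i\<bar> \<le> r + 1" for i using z unfolding zx mem_slab by blast
        have "\<bar>x $ i\<bar> \<le> r + 2 \<and> \<bar>x $ i + y $ i / real k\<bar> \<le> r + 2" for i
          using yi[of i] xi[of i] by linarith
        then have in2: "z \<in> slab (r + 2) T" "z + s y \<in> slab (r + 2) T"
          using z by (simp_all only: zx s_def add_Pair mem_slab add_0_right) (simp_all add: mem_slab)
        have "dist (z + s y) z = norm y / real k" using k0 by (simp add: dist_norm s_def norm_Pair)
        also have "\<dots> \<le> norm (1 :: real^'n) / real k"
          using norm_unit_cell[OF y] k0 by (intro divide_right_mono) auto
        finally have "dist (z + s y) z < d" using kd by simp
        then have "\<bar>\<phi> (z + s y) - \<phi> z\<bar> < \<omega>" using d(2)[OF in2(2,1)] by (simp add: dist_real_def)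
        then show "norm (F1 y z) \<le> G * \<omega>"
          unfolding F1_def real_norm_def abs_mult using G by (intro mult_mono) auto
      qed auto
      then show "norm (integral ?B (F1 y)) \<le> G * \<omega> * vol" by (simp add: vol_def mult_ac)
    qed auto
    also have "\<dots> = G * \<omega> * vol" by (simp add: unit_cell_content del: content_eq_0)
    finally show ?thesis using \<omega>e unfolding F_def by linarith
  qed
  then show "\<exists>N. \<forall>k\<ge>N. norm (integral ?B (\<lambda>z. g (real k *\<^sub>R fst z) * \<phi> z) - 0) < e"
    by (intro exI[of _ "max 1 N"]) auto
qed

text \<open>Bounded Borel functions with bounded support are limits almost everywhere of continuous
  functions, which can be truncated and cut off without losing the limit. By dominated convergence
  they are close in the mean, which is enough since \<open>g\<close> is bounded.\<close>

lemma oscillating_mean_zero: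
  fixes g :: "real^'n \<Rightarrow> real" and \<xi> :: "(real^'n) \<times> real \<Rightarrow> real"
  assumes g: "continuous_on UNIV g" "periodic 1 g" "integral (cbox 0 1) g = 0"
    and \<xi>: "\<xi> \<in> borel_measurable borel" "\<And>z. \<bar>\<xi> z\<bar> \<le> C" "\<And>x t. \<exists>i. \<bar>x $ i\<bar> > r \<Longrightarrow> \<xi> (x, t) = 0"
  shows "(\<lambda>k. integral (slab (r + 2) T) (\<lambda>z. g (real k *\<^sub>R fst z) * \<xi> z)) \<longlonglongrightarrow> 0"
proof (rule LIMSEQ_I)
  fix e :: real assume e: "0 < e"
  let ?B = "slab (r + 2) T :: ((real^'n) \<times> real) set"
  have C0: "0 \<le> C" using \<xi>(2)[of 0] by linarith
  obtain G where G: "0 \<le> G" "\<And>y. \<bar>g y\<bar> \<le> G"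
    using periodic_function_bounded[OF g(1,2)] by blast
  have "\<xi> measurable_on UNIV"
    using measurable_on_iff_borel_measurable[of UNIV \<xi>] borel_measurable_lebesgue_on[OF \<xi>(1)] by simp
  then obtain Z \<psi> where Z: "negligible Z" and \<psi>: "\<And>n. continuous_on UNIV (\<psi> n)"
    "\<And>z. z \<notin> Z \<Longrightarrow> (\<lambda>n. \<psi> n z) \<longlonglongrightarrow> \<xi> z"
    unfolding measurable_on_def by auto
  \<comment> \<open>A cutoff that is \<open>1\<close> on the cube of radius \<open>r\<close> and \<open>0\<close> off the cube of radius \<open>r + 1\<close>.\<close>
  define \<eta> where "\<eta> z = (\<Prod>i\<in>UNIV. max 0 (min 1 (r + 1 - \<bar>fst z $ i\<bar>)))" for z :: "(real^'n) \<times> real"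
  define \<phi> where "\<phi> n z = \<eta> z * max (- C) (min C (\<psi> n z))" for n z
  have c\<eta>: "continuous_on UNIV \<eta>" unfolding \<eta>_def by (intro continuous_intros)
  have c\<phi>: "continuous_on UNIV (\<phi> n)" for n
    unfolding \<phi>_def by (intro continuous_intros c\<eta> \<psi>)
  have \<eta>01: "0 \<le> \<eta> z" "\<eta> z \<le> 1" for z
    unfolding \<eta>_def by (intro prod_nonneg; simp) (intro prod_le_1; simp)
  have \<eta>0: "\<eta> (x, t) = 0" if far: "\<exists>i. \<bar>x $ i\<bar> > r + 1" for x t
  proof -
    obtain i where "\<bar>x $ i\<bar> > r + 1" using far by blast
    then have "max 0 (min 1 (r + 1 - \<bar>x $ i\<bar>)) = 0" by simp
    then show ?thesis unfolding \<eta>_def by (intro prod_zero bexI[of _ i]) auto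
  qed
  have \<eta>1: "\<eta> (x, t) = 1" if "\<And>i. \<bar>x $ i\<bar> \<le> r" for x t
  proof -
    have "max 0 (min 1 (r + 1 - \<bar>x $ i\<bar>)) = 1" for i using that[of i] by simp
    then show ?thesis by (simp add: \<eta>_def)
  qed
  have \<phi>C: "\<bar>\<phi> n z\<bar> \<le> C" for n z
  proof -
    have "\<bar>max (- C) (min C (\<psi> n z))\<bar> \<le> C" using C0 by auto
    then have "\<eta> z * \<bar>max (- C) (min C (\<psi> n z))\<bar> \<le> 1 * C" using \<eta>01 by (intro mult_mono) auto
    then show ?thesis using \<eta>01(1)[of z] by (simp add: \<phi>_def abs_mult)
  qed
  have lim: "(\<lambda>n. \<phi> n z) \<longlonglongrightarrow> \<xi> z" if "z \<notin> Z" for z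
  proof -
    obtain x t where z: "z = (x, t)" by force
    have "(\<lambda>n. \<phi> n z) \<longlonglongrightarrow> \<eta> z * max (- C) (min C (\<xi> z))"
      unfolding \<phi>_def by (intro tendsto_intros \<psi> that)
    moreover have "max (- C) (min C (\<xi> z)) = \<xi> z" using \<xi>(2)[of z] by auto
    moreover have "\<eta> z * \<xi> z = \<xi> z"
      using \<eta>1[of x t] \<xi>(3)[of x t] z by (cases "\<exists>i. \<bar>x $ i\<bar> > r") (auto simp: not_less)
    ultimately show ?thesis by simp
  qed
  have \<xi>i: "\<xi> integrable_on ?B"
    by (rule measurable_bounded_by_integrable_imp_integrable[where g = "\<lambda>_. C"])
       (use \<xi>(2) borel_measurable_lebesgue_on[OF \<xi>(1)] in auto)
  have g\<xi>i: "(\<lambda>z. g (real k *\<^sub>R fst z) * \<xi> z) integrable_on ?B" for k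
  proof (rule measurable_bounded_by_integrable_imp_integrable[where g = "\<lambda>_. G * C"])
    have "continuous_on UNIV (\<lambda>z::(real^'n) \<times> real. g (real k *\<^sub>R fst z))"
      by (intro continuous_on_compose2[OF g(1)] continuous_intros) auto
    from borel_measurable_times[OF borel_measurable_continuous_onI[OF this] \<xi>(1)]
    show "(\<lambda>z. g (real k *\<^sub>R fst z) * \<xi> z) \<in> borel_measurable (lebesgue_on ?B)"
      by (rule borel_measurable_lebesgue_on)
    show "norm (g (real k *\<^sub>R fst z) * \<xi> z) \<le> G * C" for z
      unfolding real_norm_def abs_mult using G \<xi>(2) by (intro mult_mono) auto
  qed auto
  have \<phi>i: "\<phi> n integrable_on ?B" for n by (rule continuous_integrable[OF c\<phi>])
  \<comment> \<open>Changing the integrands on the null set \<open>Z\<close> turns almost everywhere convergence into convergence everywhere.\<close>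
  define h where "h n z = (if z \<in> Z then 0 else \<bar>\<phi> n z - \<xi> z\<bar>)" for n z
  have di: "(\<lambda>z. \<bar>\<phi> n z - \<xi> z\<bar>) integrable_on ?B" for n
  proof (rule measurable_bounded_by_integrable_imp_integrable[where g = "\<lambda>_. 2 * C"])
    show "(\<lambda>z. \<bar>\<phi> n z - \<xi> z\<bar>) \<in> borel_measurable (lebesgue_on ?B)"
      using borel_measurable_abs[OF borel_measurable_diff[OF borel_measurable_continuous_onI[OF c\<phi>] \<xi>(1)]]
      by (rule borel_measurable_lebesgue_on)
    show "norm \<bar>\<phi> n z - \<xi> z\<bar> \<le> 2 * C" for z using \<phi>C[of n z] \<xi>(2)[of z] by simp
  qed auto
  have hi: "h n integrable_on ?B" and hint: "integral ?B (h n) = integral ?B (\<lambda>z. \<bar>\<phi> n z - \<xi> z\<bar>)" for n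
    by (rule integrable_spike[OF di Z], simp add: h_def)
       (rule integral_spike[OF Z], simp add: h_def)
  have "(\<lambda>n. integral ?B (h n)) \<longlonglongrightarrow> integral ?B (\<lambda>z. 0)"
  proof (rule dominated_convergence(2)[OF hi])
    show "(\<lambda>z. 2 * C) integrable_on ?B" by auto
    show "norm (h n z) \<le> 2 * C" for n z using \<phi>C[of n z] \<xi>(2)[of z] C0 by (auto simp: h_def)
    show "(\<lambda>n. h n z) \<longlonglongrightarrow> 0" for z
    proof (cases "z \<in> Z")
      case False
      from tendsto_rabs[OF tendsto_diff[OF lim[OF False] tendsto_const[of "\<xi> z"]]] False
      show ?thesis by (simp add: h_def)
    qed (simp add: h_def)
  qed
  then have "(\<lambda>n. integral ?B (h n)) \<longlonglongrightarrow> 0" by simp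
  from LIMSEQ_D[OF this, of "e / (2 * (G + 1))"] e G(1)
  obtain n where n: "\<bar>integral ?B (h n)\<bar> < e / (2 * (G + 1))" by auto
  have near: "G * integral ?B (\<lambda>z. \<bar>\<phi> n z - \<xi> z\<bar>) \<le> e / 2"
  proof -
    have "G * integral ?B (\<lambda>z. \<bar>\<phi> n z - \<xi> z\<bar>) \<le> G * (e / (2 * (G + 1)))"
      using n G(1) unfolding hint by (intro mult_left_mono) auto
    also have "\<dots> \<le> e / 2" using G(1) e by (simp add: field_simps)
    finally show ?thesis .
  qed
  have sup: "\<phi> n (x, t) = 0" if "\<exists>i. \<bar>x $ i\<bar> > r + 1" for x t
    using \<eta>0[OF that] by (simp add: \<phi>_def)
  have "(\<lambda>k. integral (slab (r + 1 + 1) T) (\<lambda>z. g (real k *\<^sub>R fst z) * \<phi> n z)) \<longlonglongrightarrow> 0"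
    by (rule oscillating_mean_zero_continuous[OF g c\<phi> sup])
  then have "(\<lambda>k. integral ?B (\<lambda>z. g (real k *\<^sub>R fst z) * \<phi> n z)) \<longlonglongrightarrow> 0" by (simp add: add.assoc)
  from LIMSEQ_D[OF this, of "e / 2"] e obtain N where
    N: "\<And>k. N \<le> k \<Longrightarrow> \<bar>integral ?B (\<lambda>z. g (real k *\<^sub>R fst z) * \<phi> n z)\<bar> < e / 2" by auto
  have "\<bar>integral ?B (\<lambda>z. g (real k *\<^sub>R fst z) * \<xi> z)\<bar> < e" if k: "N \<le> k" for k
  proof -
    have g\<phi>i: "(\<lambda>z. g (real k *\<^sub>R fst z) * \<phi> n z) integrable_on ?B"
      by (intro continuous_integrable continuous_on_mult c\<phi> continuous_on_compose2[OF g(1)] continuous_intros) auto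
    have "norm (integral ?B (\<lambda>z. g (real k *\<^sub>R fst z) * \<phi> n z - g (real k *\<^sub>R fst z) * \<xi> z))
        \<le> integral ?B (\<lambda>z. G * \<bar>\<phi> n z - \<xi> z\<bar>)"
    proof (rule integral_norm_bound_integral)
      show "(\<lambda>z. g (real k *\<^sub>R fst z) * \<phi> n z - g (real k *\<^sub>R fst z) * \<xi> z) integrable_on ?B"
        by (rule integrable_diff[OF g\<phi>i g\<xi>i])
      show "(\<lambda>z. G * \<bar>\<phi> n z - \<xi> z\<bar>) integrable_on ?B"
        using integrable_cmul[OF di[of n], of G] by simp
      show "norm (g (real k *\<^sub>R fst z) * \<phi> n z - g (real k *\<^sub>R fst z) * \<xi> z) \<le> G * \<bar>\<phi> n z - \<xi> z\<bar>" for z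
        unfolding right_diff_distrib[symmetric] real_norm_def abs_mult
        by (intro mult_right_mono) (auto simp: G)
    qed
    then have "\<bar>integral ?B (\<lambda>z. g (real k *\<^sub>R fst z) * \<phi> n z) - integral ?B (\<lambda>z. g (real k *\<^sub>R fst z) * \<xi> z)\<bar> \<le> e / 2"
      using near by (simp add: integral_diff[OF g\<phi>i g\<xi>i])
    then show ?thesis using N[OF k] by linarith
  qed
  then show "\<exists>N. \<forall>k\<ge>N. norm (integral ?B (\<lambda>z. g (real k *\<^sub>R fst z) * \<xi> z) - 0) < e" by auto
qed

lemma uniform_limit_tendsto_L2:
  fixes f :: "nat \<Rightarrow> 'a::euclidean_space \<Rightarrow> real"
  assumes S: "compact S" and f: "\<And>k. 1 \<le> k \<Longrightarrow> continuous_on S (f k)" "continuous_on S f0"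
    and lim: "\<And>e. 0 < e \<Longrightarrow> \<exists>N. \<forall>k\<ge>N. \<forall>z\<in>S. \<bar>f k z - f0 z\<bar> \<le> e"
  shows "tendsto_L2 S f f0"
  unfolding tendsto_L2_def
proof (intro conjI)
  have int: "set_integrable lborel S h" if "continuous_on S h" for h :: "'a \<Rightarrow> real"
    unfolding set_integrable_def by (rule borel_integrable_compact[OF S that])
  have L2: "L2_on S h" if "continuous_on S h" for h
    unfolding L2_on_def set_borel_measurable_def
    using int[OF that] int[OF continuous_on_power[OF that]] borel_measurable_integrable
    by (auto simp: set_integrable_def)
  show "L2_on S f0" by (rule L2[OF f(2)])
  show "\<forall>\<^sub>F k in sequentially. L2_on S (f k)"
    using eventually_ge_at_top[of 1] by eventually_elim (rule L2[OF f(1)])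
  have "(\<lambda>k. LINT z:S|lborel. (f k z - f0 z)\<^sup>2) \<longlonglongrightarrow> 0"
  proof (rule LIMSEQ_I)
    fix e :: real assume e: "0 < e"
    define vol where "vol = measure lborel S"
    have vol: "0 \<le> vol" by (simp add: vol_def)
    define \<delta> where "\<delta> = sqrt (e / (vol + 1))"
    have \<delta>: "0 < \<delta>" "\<delta>\<^sup>2 = e / (vol + 1)" using e vol by (auto simp: \<delta>_def)
    obtain N where N: "\<And>k z. N \<le> k \<Longrightarrow> z \<in> S \<Longrightarrow> \<bar>f k z - f0 z\<bar> \<le> \<delta>" using lim[OF \<delta>(1)] by blast
    have "norm ((LINT z:S|lborel. (f k z - f0 z)\<^sup>2) - 0) < e" if k: "max 1 N \<le> k" for k
    proof -
      have fin: "emeasure lborel S < \<infinity>" using emeasure_compact_finite[OF S] by simp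
      have c: "continuous_on S (\<lambda>z. (f k z - f0 z)\<^sup>2)"
        using k by (intro continuous_intros f) auto
      have "(LINT z:S|lborel. (f k z - f0 z)\<^sup>2) \<le> (LINT z:S|lborel. \<delta>\<^sup>2)"
      proof (rule set_integral_mono[OF int[OF c] int[OF continuous_on_const]])
        show "(f k z - f0 z)\<^sup>2 \<le> \<delta>\<^sup>2" if "z \<in> S" for z
          using N[of k z] that k \<delta>(1) by (simp add: abs_le_square_iff[symmetric])
      qed
      also have "\<dots> = \<delta>\<^sup>2 * vol"
        unfolding set_lebesgue_integral_def using S fin by (simp add: vol_def mult.commute)
      also have "\<dots> < e" using e vol by (simp add: \<delta>(2) field_simps)
      finally have "(LINT z:S|lborel. (f k z - f0 z)\<^sup>2) < e" .
      moreover have "0 \<le> (LINT z:S|lborel. (f k z - f0 z)\<^sup>2)"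
        unfolding set_lebesgue_integral_def by (intro integral_nonneg_AE) auto
      ultimately show ?thesis by simp
    qed
    then show "\<exists>N. \<forall>k\<ge>N. norm ((LINT z:S|lborel. (f k z - f0 z)\<^sup>2) - 0) < e" by blast
  qed
  from tendsto_real_sqrt[OF this] show "(\<lambda>k. sqrt (LINT z:S|lborel. (f k z - f0 z)\<^sup>2)) \<longlonglongrightarrow> 0" by simp
qed

text \<open>Lebesgue integrals over \<open>S\<close> against an almost everywhere bounded test function become
  integrals over a box against a bounded Borel function.\<close>

lemma set_integral_test_function:
  fixes f \<psi> \<xi> :: "'a::euclidean_space \<Rightarrow> real"
  assumes S: "compact S" "S \<subseteq> cbox a b" and f: "continuous_on (cbox a b) f"
    and \<xi>: "\<xi> \<in> borel_measurable borel" "\<And>z. \<bar>\<xi> z\<bar> \<le> C" "\<And>z. z \<notin> S \<Longrightarrow> \<xi> z = 0"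
    and \<psi>: "set_borel_measurable lborel S \<psi>" "AE z in lborel. z \<in> S \<longrightarrow> \<psi> z = \<xi> z"
  shows "(LINT z:S|lborel. f z * \<psi> z) = integral (cbox a b) (\<lambda>z. f z * \<xi> z)"
    and "(\<lambda>z. f z * \<xi> z) integrable_on cbox a b"
proof -
  have fi: "set_integrable lborel (cbox a b) f"
    unfolding set_integrable_def by (rule borel_integrable_compact[OF compact_cbox f])
  have si: "set_integrable lborel (cbox a b) (\<lambda>z. f z * \<xi> z)"
    using set_integrable_scaleR_bounded[OF fi \<xi>(1), of C] \<xi>(2) by (simp add: mult.commute)
  show "(\<lambda>z. f z * \<xi> z) integrable_on cbox a b" by (rule set_borel_integral_eq_integral(1)[OF si])
  have "(LINT z:S|lborel. f z * \<psi> z) = (LINT z:cbox a b|lborel. f z * \<xi> z)"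
    unfolding set_lebesgue_integral_def
  proof (rule integral_cong_AE)
    have "(\<lambda>z. (indicator (cbox a b) z *\<^sub>R f z) * (indicator S z *\<^sub>R \<psi> z)) \<in> borel_measurable lborel"
      using borel_measurable_times[OF borel_measurable_integrable[OF fi[unfolded set_integrable_def]]
          \<psi>(1)[unfolded set_borel_measurable_def]] .
    moreover have "(\<lambda>z. (indicator (cbox a b) z *\<^sub>R f z) * (indicator S z *\<^sub>R \<psi> z)) = (\<lambda>z. indicator S z *\<^sub>R (f z * \<psi> z))"
      using S(2) by (auto simp: fun_eq_iff indicator_def)
    ultimately show "(\<lambda>z. indicator S z *\<^sub>R (f z * \<psi> z)) \<in> borel_measurable lborel" by simp
    show "(\<lambda>z. indicator (cbox a b) z *\<^sub>R (f z * \<xi> z)) \<in> borel_measurable lborel"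
      using si borel_measurable_integrable unfolding set_integrable_def by blast
    show "AE z in lborel. indicator S z *\<^sub>R (f z * \<psi> z) = indicator (cbox a b) z *\<^sub>R (f z * \<xi> z)"
      using \<psi>(2) by eventually_elim (use S(2) \<xi>(3) in \<open>auto simp: indicator_def\<close>)
  qed
  also have "\<dots> = integral (cbox a b) (\<lambda>z. f z * \<xi> z)" by (rule set_borel_integral_eq_integral(2)[OF si])
  finally show "(LINT z:S|lborel. f z * \<psi> z) = integral (cbox a b) (\<lambda>z. f z * \<xi> z)" .
qed

lemma continuous_dilated:
  fixes h :: "real^'n \<Rightarrow> real \<Rightarrow> real"
  assumes "continuous_on (UNIV \<times> {0..T}) (\<lambda>(x, t). h x t)"
  shows "continuous_on (UNIV \<times> {0..T}) (\<lambda>(x, t). h (c *\<^sub>R x) t)"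
proof -
  have "continuous_on (UNIV \<times> {0..T}) (\<lambda>p. (\<lambda>(x, t). h x t) (c *\<^sub>R fst p, snd p))"
    by (rule continuous_on_compose2[OF assms]) (auto intro!: continuous_intros)
  then show ?thesis by (simp add: split_beta)
qed

lemma integral_slab_periodic:
  fixes h :: "real^'n \<Rightarrow> real \<Rightarrow> real"
  assumes h: "continuous_on (UNIV \<times> {0..T}) (\<lambda>(x, t). h x t)" "\<And>t. t \<in> {0..T} \<Longrightarrow> periodic 1 (\<lambda>x. h x t)"
    and k: "1 \<le> k"
  shows "integral (slab (real N) T) (\<lambda>(x, t). h (real k *\<^sub>R x) t)
     = (2 * real N) ^ CARD('n) * integral {0..T} (\<lambda>t. integral (cbox 0 1) (\<lambda>x. h x t))"
proof -
  note c = continuous_dilated[OF h(1), of "real k"]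
  have cs: "continuous_on (slab (real N) T) (\<lambda>(x, t). h (real k *\<^sub>R x) t)"
    by (rule continuous_on_subset[OF c]) (auto simp: cbox_Pair_eq)
  have "integral (slab (real N) T) (\<lambda>(x, t). h (real k *\<^sub>R x) t)
     = integral (cbox (- (real N *\<^sub>R 1)) (real N *\<^sub>R 1)) (\<lambda>x. integral (cbox 0 T) (\<lambda>t. h (real k *\<^sub>R x) t))"
    using integral_prod_continuous[OF cs] by simp
  also have "\<dots> = integral (cbox 0 T) (\<lambda>t. integral (cbox (- (real N *\<^sub>R 1)) (real N *\<^sub>R 1)) (\<lambda>x. h (real k *\<^sub>R x) t))"
    by (rule integral_swap_continuous[OF cs])
  also have "\<dots> = integral (cbox 0 T) (\<lambda>t. (2 * real N) ^ CARD('n) * integral (cbox 0 1) (\<lambda>x. h x t))"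
  proof (rule integral_cong)
    fix t assume "t \<in> cbox 0 T"
    then have t: "t \<in> {0..T}" by simp
    have "periodic 1 (\<lambda>x. h (real k *\<^sub>R x) t)"
      unfolding periodic_def
    proof (intro allI impI)
      fix x v :: "real^'n" assume "\<forall>i. v $ i \<in> \<int>"
      then have "\<forall>i. (real k *\<^sub>R v) $ i \<in> \<int>" by simp
      with h(2)[OF t] have "h (real k *\<^sub>R x + 1 *\<^sub>R (real k *\<^sub>R v)) t = h (real k *\<^sub>R x) t"
        unfolding periodic_def by blast
      then show "h (real k *\<^sub>R (x + 1 *\<^sub>R v)) t = h (real k *\<^sub>R x) t" by (simp add: scaleR_add_right)
    qed
    then have "integral (cbox (- (real N *\<^sub>R 1)) (real N *\<^sub>R 1)) (\<lambda>x. h (real k *\<^sub>R x) t)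
       = (2 * real N) ^ CARD('n) * integral (cbox 0 1) (\<lambda>x. h (real k *\<^sub>R x) t)"
      by (rule integral_periodic_symmetric_cube[OF continuous_space[OF c t]])
    also have "integral (cbox 0 1) (\<lambda>x. h (real k *\<^sub>R x) t) = integral (cbox 0 1) (\<lambda>x. h x t)"
      by (rule integral_periodic_dilate[OF continuous_space[OF h(1) t] h(2)[OF t] k])
    finally show "integral (cbox (- (real N *\<^sub>R 1)) (real N *\<^sub>R 1)) (\<lambda>x. h (real k *\<^sub>R x) t)
       = (2 * real N) ^ CARD('n) * integral (cbox 0 1) (\<lambda>x. h x t)" .
  qed
  finally show ?thesis by simp
qed

text \<open>The densities are close to \<open>\<mu> (k x)\<close> in the mean, by periodicity on every box and not only on
  one cell, and \<open>\<mu> (k x)\<close> converges weakly to the mean value one.\<close>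

lemma oscillating_density_weak_limit:
  fixes M :: "nat \<Rightarrow> real^'n \<Rightarrow> real \<Rightarrow> real" and \<mu> :: "real^'n \<Rightarrow> real"
  assumes Q: "compact Q"
    and f: "\<And>k x t. 1 \<le> k \<Longrightarrow> f k x t = M k (real k *\<^sub>R x) t"
    and M: "\<And>k. 1 \<le> k \<Longrightarrow> continuous_on (UNIV \<times> {0..T}) (\<lambda>(x, t). M k x t)"
      "\<And>k t. 1 \<le> k \<Longrightarrow> t \<in> {0..T} \<Longrightarrow> periodic 1 (\<lambda>x. M k x t)"
    and \<mu>: "continuous_on UNIV \<mu>" "periodic 1 \<mu>" "integral (cbox 0 1) \<mu> = 1"
    and gap: "\<And>e. 0 < e \<Longrightarrow> \<exists>N. \<forall>k\<ge>N. integral {0..T} (\<lambda>t. integral (cbox 0 1) (\<lambda>x. \<bar>M k x t - \<mu> x\<bar>)) \<le> e"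
  shows "tendsto_weak_L1 (Q \<times> {0..T}) (\<lambda>k (x, t). f k x t) (\<lambda>(x, t). 1)"
  unfolding tendsto_weak_L1_def
proof (intro conjI allI impI)
  let ?S = "Q \<times> {0..T}"
  have S: "compact ?S" using Q by (intro compact_Times) auto
  have fc: "continuous_on (UNIV \<times> {0..T}) (\<lambda>(x, t). f k x t)" if "1 \<le> k" for k
    using continuous_dilated[OF M(1)[OF that], of "real k"] by (simp add: f[OF that])
  have "set_integrable lborel ?S (\<lambda>(x, t). f k x t)" if "1 \<le> k" for k
    unfolding set_integrable_def
    by (rule borel_integrable_compact[OF S continuous_on_subset[OF fc[OF that]]]) auto
  then show "\<forall>\<^sub>F k in sequentially. set_integrable lborel ?S (\<lambda>(x, t). f k x t)"
    using eventually_sequentially by blast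
  show "set_integrable lborel ?S (\<lambda>(x, t). 1::real)"
    unfolding set_integrable_def split_beta by (rule borel_integrable_compact[OF S continuous_on_const])
  fix \<psi> :: "(real^'n) \<times> real \<Rightarrow> real"
  assume \<psi>: "set_borel_measurable lborel ?S \<psi> \<and> (\<exists>C. AE z in lborel. z \<in> ?S \<longrightarrow> \<bar>\<psi> z\<bar> \<le> C)"
  then obtain C0 where C0: "AE z in lborel. z \<in> ?S \<longrightarrow> \<bar>\<psi> z\<bar> \<le> C0" by blast
  define C where "C = \<bar>C0\<bar>"
  \<comment> \<open>Truncation turns the test function, which is bounded almost everywhere on \<open>Q \<times> {0..T}\<close>, into one
    that is bounded and Borel on the whole space.\<close>
  define \<xi> where "\<xi> z = max (- C) (min C (indicator ?S z *\<^sub>R \<psi> z))" for z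
  have \<xi>: "\<xi> \<in> borel_measurable borel" "\<And>z. \<bar>\<xi> z\<bar> \<le> C" "\<And>z. z \<notin> ?S \<Longrightarrow> \<xi> z = 0"
  proof -
    have "(\<lambda>z. indicator ?S z *\<^sub>R \<psi> z) \<in> borel_measurable borel"
      using \<psi> by (simp add: set_borel_measurable_def)
    then show "\<xi> \<in> borel_measurable borel"
      unfolding \<xi>_def by (intro borel_measurable_max borel_measurable_min borel_measurable_const)
    show "\<bar>\<xi> z\<bar> \<le> C" for z unfolding \<xi>_def C_def by auto
    show "\<xi> z = 0" if "z \<notin> ?S" for z using that by (simp add: \<xi>_def C_def)
  qed
  have ae: "AE z in lborel. z \<in> ?S \<longrightarrow> \<psi> z = \<xi> z"
    using C0 by eventually_elim (auto simp: \<xi>_def C_def)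
  have C: "0 \<le> C" by (simp add: C_def)
  obtain r :: nat where r: "\<And>x i. x \<in> Q \<Longrightarrow> \<bar>x $ i\<bar> \<le> real r"
  proof -
    obtain b where b: "\<And>x. x \<in> Q \<Longrightarrow> norm x \<le> b" using compact_imp_bounded[OF Q] bounded_iff by metis
    obtain n :: nat where "b < real n" using reals_Archimedean2 by blast
    then show thesis using b component_le_norm_cart that by (metis less_imp_le order_trans)
  qed
  let ?B = "slab (real (r + 2)) T :: ((real^'n) \<times> real) set"
  have SB: "?S \<subseteq> ?B"
  proof (intro subsetI)
    fix z assume z: "z \<in> ?S"
    obtain x t where zx: "z = (x, t)" by force
    have "\<bar>x $ i\<bar> \<le> real (r + 2)" for i using r[of x i] z zx by auto
    then show "z \<in> ?B" using z unfolding zx mem_slab by auto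
  qed
  have Bsub: "?B \<subseteq> UNIV \<times> {0..T}" by (auto simp: cbox_Pair_eq)
  note test = set_integral_test_function[OF S SB _ \<xi> conjunct1[OF \<psi>] ae]
  define g where "g y = \<mu> y - 1" for y
  have g: "continuous_on UNIV g" "periodic 1 g" "integral (cbox 0 1) g = 0"
  proof -
    show "continuous_on UNIV g" unfolding g_def by (intro continuous_intros \<mu>)
    show "periodic 1 g" using \<mu>(2) unfolding g_def periodic_def by simp
    show "integral (cbox 0 1) g = 0"
      using integral_diff[OF continuous_integrable[OF \<mu>(1)] integrable_const[of 1]] \<mu>(3)
      by (simp add: g_def[abs_def] unit_cell_content del: content_eq_0)
  qed
  have "(\<lambda>k. integral ?B (\<lambda>z. g (real k *\<^sub>R fst z) * \<xi> z)) \<longlonglongrightarrow> 0"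
  proof -
    have "real (r + 2) = real r + 2" by simp
    moreover have "\<xi> (x, t) = 0" if far: "\<exists>i. \<bar>x $ i\<bar> > real r" for x t
    proof (rule \<xi>(3))
      obtain i where "\<bar>x $ i\<bar> > real r" using far by blast
      then show "(x, t) \<notin> ?S" using r[of x i] by auto
    qed
    ultimately show ?thesis using oscillating_mean_zero[OF g \<xi>(1,2), of "real r" T] by metis
  qed
  moreover have "(\<lambda>k. integral ?B (\<lambda>z. (f k (fst z) (snd z) - \<mu> (real k *\<^sub>R fst z)) * \<xi> z)) \<longlonglongrightarrow> 0"
  proof (rule LIMSEQ_I)
    fix e :: real assume e: "0 < e"
    define D where "D = C * (2 * real (r + 2)) ^ CARD('n)"
    have D: "0 \<le> D" using C by (simp add: D_def)
    obtain N where N: "\<And>k. N \<le> k \<Longrightarrow> integral {0..T} (\<lambda>t. integral (cbox 0 1) (\<lambda>x. \<bar>M k x t - \<mu> x\<bar>)) \<le> e / (2 * (D + 1))"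
      using gap[of "e / (2 * (D + 1))"] e D by auto
    have "norm (integral ?B (\<lambda>z. (f k (fst z) (snd z) - \<mu> (real k *\<^sub>R fst z)) * \<xi> z) - 0) < e" if k: "max 1 N \<le> k" for k
    proof -
      have k1: "1 \<le> k" using k by simp
      define h where "h x t = \<bar>M k x t - \<mu> x\<bar>" for x t
      note \<mu>p = continuous_time_independent[OF \<mu>(1)]
      have hc: "continuous_on (UNIV \<times> {0..T}) (\<lambda>(x, t). h x t)"
        using continuous_on_rabs[OF continuous_on_diff[OF M(1)[OF k1] \<mu>p]] by (simp add: h_def split_beta)
      have hp: "periodic 1 (\<lambda>x. h x t)" if "t \<in> {0..T}" for t
        using M(2)[OF k1 that] \<mu>(2) unfolding periodic_def h_def by simp
      have dc: "continuous_on ?B (\<lambda>z. f k (fst z) (snd z) - \<mu> (real k *\<^sub>R fst z))"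
        using continuous_on_subset[OF fc[OF k1] Bsub]
        by (auto simp: split_beta intro!: continuous_intros continuous_on_compose2[OF \<mu>(1)])
      have "norm (integral ?B (\<lambda>z. (f k (fst z) (snd z) - \<mu> (real k *\<^sub>R fst z)) * \<xi> z))
         \<le> integral ?B (\<lambda>z. C * h (real k *\<^sub>R fst z) (snd z))"
      proof (rule integral_norm_bound_integral[OF test(2)[OF dc]])
        have "continuous_on ?B (\<lambda>z. h (real k *\<^sub>R fst z) (snd z))"
          using continuous_on_subset[OF continuous_dilated[OF hc, of "real k"] Bsub] by (simp add: split_beta)
        then show "(\<lambda>z. C * h (real k *\<^sub>R fst z) (snd z)) integrable_on ?B"
          by (intro integrable_continuous continuous_intros)
        show "norm ((f k (fst z) (snd z) - \<mu> (real k *\<^sub>R fst z)) * \<xi> z) \<le> C * h (real k *\<^sub>R fst z) (snd z)" for z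
          using mult_left_mono[OF \<xi>(2)[of z], of "h (real k *\<^sub>R fst z) (snd z)"]
          by (simp add: f[OF k1] h_def abs_mult mult.commute)
      qed
      also have "\<dots> = C * ((2 * real (r + 2)) ^ CARD('n) * integral {0..T} (\<lambda>t. integral (cbox 0 1) (\<lambda>x. h x t)))"
        using integral_slab_periodic[OF hc hp k1, of "r + 2"]
        by (simp only: case_prod_unfold integral_mult_right)
      also have "\<dots> = D * integral {0..T} (\<lambda>t. integral (cbox 0 1) (\<lambda>x. h x t))" by (simp add: D_def)
      also have "\<dots> \<le> D * (e / (2 * (D + 1)))"
        using N[of k] k D unfolding h_def by (intro mult_left_mono) auto
      also have "\<dots> < e"
      proof -
        have "D * (e / (2 * (D + 1))) \<le> e / 2" using D e by (simp add: field_simps)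
        then show ?thesis using e by linarith
      qed
      finally show ?thesis by simp
    qed
    then show "\<exists>N. \<forall>k\<ge>N. norm (integral ?B (\<lambda>z. (f k (fst z) (snd z) - \<mu> (real k *\<^sub>R fst z)) * \<xi> z) - 0) < e" by blast
  qed
  ultimately have "(\<lambda>k. integral ?B (\<lambda>z. g (real k *\<^sub>R fst z) * \<xi> z)
     + integral ?B (\<lambda>z. (f k (fst z) (snd z) - \<mu> (real k *\<^sub>R fst z)) * \<xi> z)
     + integral ?B (\<lambda>z. 1 * \<xi> z)) \<longlonglongrightarrow> 0 + 0 + integral ?B (\<lambda>z. 1 * \<xi> z)"
    by (intro tendsto_intros)
  moreover have "integral ?B (\<lambda>z. g (real k *\<^sub>R fst z) * \<xi> z)
     + integral ?B (\<lambda>z. (f k (fst z) (snd z) - \<mu> (real k *\<^sub>R fst z)) * \<xi> z)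
     + integral ?B (\<lambda>z. 1 * \<xi> z) = (LINT z:?S|lborel. (case z of (x, t) \<Rightarrow> f k x t) * \<psi> z)" if k: "1 \<le> k" for k
  proof -
    have fB: "continuous_on ?B (\<lambda>(x, t). f k x t)" by (rule continuous_on_subset[OF fc[OF k] Bsub])
    have gB: "continuous_on ?B (\<lambda>z. g (real k *\<^sub>R fst z))"
      by (intro continuous_on_compose2[OF g(1)] continuous_intros) auto
    have \<mu>B: "continuous_on ?B (\<lambda>z. \<mu> (real k *\<^sub>R fst z))"
      by (intro continuous_on_compose2[OF \<mu>(1)] continuous_intros) auto
    have dB: "continuous_on ?B (\<lambda>z. f k (fst z) (snd z) - \<mu> (real k *\<^sub>R fst z))"
      using continuous_on_diff[OF fB \<mu>B] by (simp add: split_beta)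
    have "integral ?B (\<lambda>z. (case z of (x, t) \<Rightarrow> f k x t) * \<xi> z)
      = integral ?B (\<lambda>z. (g (real k *\<^sub>R fst z) * \<xi> z + (f k (fst z) (snd z) - \<mu> (real k *\<^sub>R fst z)) * \<xi> z) + 1 * \<xi> z)"
      by (simp add: g_def algebra_simps split_beta)
    also have "\<dots> = integral ?B (\<lambda>z. g (real k *\<^sub>R fst z) * \<xi> z)
     + integral ?B (\<lambda>z. (f k (fst z) (snd z) - \<mu> (real k *\<^sub>R fst z)) * \<xi> z)
     + integral ?B (\<lambda>z. 1 * \<xi> z)"
      using integral_add[OF integrable_add[OF test(2)[OF gB] test(2)[OF dB]] test(2)[OF continuous_on_const[of _ 1]]]
        integral_add[OF test(2)[OF gB] test(2)[OF dB]] by simp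
    finally show ?thesis using test(1)[OF fB] by simp
  qed
  then have "\<forall>\<^sub>F k in sequentially. integral ?B (\<lambda>z. g (real k *\<^sub>R fst z) * \<xi> z)
     + integral ?B (\<lambda>z. (f k (fst z) (snd z) - \<mu> (real k *\<^sub>R fst z)) * \<xi> z)
     + integral ?B (\<lambda>z. 1 * \<xi> z) = (LINT z:?S|lborel. (case z of (x, t) \<Rightarrow> f k x t) * \<psi> z)"
    using eventually_sequentially by blast
  ultimately have "(\<lambda>k. LINT z:?S|lborel. (case z of (x, t) \<Rightarrow> f k x t) * \<psi> z) \<longlonglongrightarrow> 0 + 0 + integral ?B (\<lambda>z. 1 * \<xi> z)"
    by (rule Lim_transform_eventually)
  moreover have "(LINT z:?S|lborel. (case z of (x, t) \<Rightarrow> 1) * \<psi> z) = integral ?B (\<lambda>z. 1 * \<xi> z)"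
    using test(1)[OF continuous_on_const[of _ 1]] by (simp add: split_beta)
  ultimately show "(\<lambda>k. LINT z:?S|lborel. (case z of (x, t) \<Rightarrow> f k x t) * \<psi> z)
      \<longlonglongrightarrow> (LINT z:?S|lborel. (case z of (x, t) \<Rightarrow> 1) * \<psi> z)" by simp
qed

section \<open>Convergence to the effective problem\<close>

theorem theorem7p2:
  fixes V :: "real^'n \<Rightarrow> real \<Rightarrow> real"
    and Hbar :: "real^'n \<Rightarrow> real \<Rightarrow> real" and bbar :: "real^'n \<Rightarrow> real \<Rightarrow> real^'n"
    and P :: "real^'n" and T :: real
    and u m :: "nat \<Rightarrow> real^'n \<Rightarrow> real \<Rightarrow> real"
    and u0 m0 :: "real^'n \<Rightarrow> real \<Rightarrow> real"
  assumes V_periodic: "\<And>s. periodic 1 (\<lambda>y. V y s)"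
    and V_C1: "C1 (\<lambda>(y, s). V y s)"
    and V_bounded: "bounded (range (\<lambda>(y, s). V y s))"
    and V_nonneg: "\<And>y s. 0 \<le> V y s"
    and V_monotone: "\<And>a b. \<exists>\<gamma>>0. \<forall>y. \<forall>s\<in>{a..b}. \<forall>s'\<in>{a..b}.
          s' \<le> s \<longrightarrow> \<gamma> * (s - s') \<le> V y s - V y s'"
    and effective: "effective_operators V Hbar bbar"
    and T_pos: "0 < T"
    and solution: "\<And>k. 1 \<le> k \<Longrightarrow> periodic_mfg_solution V P T (1 / real k) (u k) (m k)"
    and u0: "u0 = (\<lambda>x t. P \<bullet> x + (t - T) * Hbar P 1)"
    and m0: "m0 = (\<lambda>x t. 1)"
  shows "(\<forall>k\<ge>1. \<forall>u' m'. periodic_mfg_solution V P T (1 / real k) u' m' \<longrightarrow>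
            (\<forall>x. \<forall>t\<in>{0..T}. u' x t = u k x t \<and> m' x t = m k x t)) \<and>
         effective_solution Hbar bbar P T u0 m0 \<and>
         (\<forall>Q. compact Q \<longrightarrow>
            tendsto_L2 (Q \<times> {0..T}) (\<lambda>k (x, t). u k x t) (\<lambda>(x, t). u0 x t) \<and>
            tendsto_weak_L1 (Q \<times> {0..T}) (\<lambda>k (x, t). m k x t) (\<lambda>(x, t). m0 x t))"
proof -
  obtain C where C: "\<And>y s. \<bar>V y s\<bar> \<le> C" using V_bounded unfolding bounded_iff by auto
  have coupling: "monotone_coupling V C"
  proof
    show "continuous_on UNIV (\<lambda>(y, s). V y s)" by (rule C1_continuous[OF V_C1])
    show "0 \<le> V y s \<and> V y s \<le> C" for y s using V_nonneg[of y s] C[of y s] by (simp add: abs_le_iff)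
  qed (rule V_periodic V_monotone)+
  \<comment> \<open>All claims are read off in the fast variable \<open>k x\<close>, in which the period is one.\<close>
  define w where "w k u x t = real k * u ((1 / real k) *\<^sub>R x) t - P \<bullet> x"
    for k and u :: "real^'n \<Rightarrow> real \<Rightarrow> real" and x t
  define M where "M k m x t = m ((1 / real k) *\<^sub>R x) t" for k and m :: "real^'n \<Rightarrow> real \<Rightarrow> real" and x t
  have unscale: "u x t = (w k u (real k *\<^sub>R x) t + P \<bullet> (real k *\<^sub>R x)) / real k"
      "m x t = M k m (real k *\<^sub>R x) t"
    if "1 \<le> k" for k x t and u m :: "real^'n \<Rightarrow> real \<Rightarrow> real"
    using that by (simp_all add: w_def M_def)
  have mf: "mean_field P (real k) T V (w k u') (M k m')"
    if "1 \<le> k" "periodic_mfg_solution V P T (1 / real k) u' m'" for k u' m'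
    using rescaled_mean_field[OF that(2,1)] unfolding w_def M_def .
  have unique: "u' x t = u k x t \<and> m' x t = m k x t"
    if k: "1 \<le> k" and sol: "periodic_mfg_solution V P T (1 / real k) u' m'" and t: "t \<in> {0..T}" for k u' m' x t
  proof -
    have k0: "0 < real k" using k by simp
    note eq = monotone_coupling.mean_field_unique[OF coupling mf[OF k sol] mf[OF k solution[OF k]] k0 T_pos t, of "real k *\<^sub>R x"]
    have "u' x t = u k x t"
      using eq(1) unscale(1)[OF k, where u = u' and x = x and t = t]
        unscale(1)[OF k, where u = "u k" and x = x and t = t] by metis
    moreover have "m' x t = m k x t"
      using eq(2) unscale(2)[OF k, where m = m' and x = x and t = t]
        unscale(2)[OF k, where m = "m k" and x = x and t = t] by metis
    ultimately show ?thesis ..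
  qed
  obtain v \<mu> where "cell_solution V P 1 (Hbar P 1) v \<mu>"
    using effective[unfolded effective_operators_def, rule_format, OF zero_le_one, of P] by blast
  then obtain A b where "cell_corrector V C P (Hbar P 1) v \<mu> A b"
    using cell_solution_corrector[OF coupling] by blast
  then interpret cell_corrector V C P "Hbar P 1" v \<mu> A b .
  have lim_u: "\<exists>N. \<forall>k\<ge>N. \<forall>x. \<forall>t\<in>{0..T}. \<bar>u k x t - u0 x t\<bar> \<le> e" if e: "0 < e" for e
  proof -
    obtain N :: nat where N: "1 \<le> N" "\<forall>k\<ge>N. \<forall>w m. mean_field P (real k) T V w m \<longrightarrow>
        (\<forall>x. \<forall>t\<in>{0..T}. \<bar>w x t - real k * Hbar P 1 * (t - T)\<bar> \<le> e * real k)
        \<and> integral {0..T} (density_gap m) \<le> e"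
      using homogenization[OF T_pos e] by blast
    have "\<bar>u k x t - u0 x t\<bar> \<le> e" if k: "N \<le> k" and t: "t \<in> {0..T}" for k x t
    proof -
      have k1: "1 \<le> k" "0 < real k" using k N(1) by auto
      have "u k x t - u0 x t = (w k (u k) (real k *\<^sub>R x) t - real k * Hbar P 1 * (t - T)) / real k"
        using k1 by (simp add: w_def u0 field_simps)
      then have "\<bar>u k x t - u0 x t\<bar> = \<bar>w k (u k) (real k *\<^sub>R x) t - real k * Hbar P 1 * (t - T)\<bar> / real k"
        by (simp add: abs_divide)
      also have "\<dots> \<le> e * real k / real k"
        using N(2) k mf[OF k1(1) solution[OF k1(1)]] t by (intro divide_right_mono) auto
      finally show ?thesis using k1 by simp
    qed
    then show ?thesis by blast
  qed
  have C21_uk: "C21 T (u k)" and C21_Mk: "C21 T (M k (m k))"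
    and per_Mk: "t \<in> {0..T} \<Longrightarrow> periodic 1 (\<lambda>x. M k (m k) x t)" if "1 \<le> k" for k t
    using solution[OF that] mf[OF that solution[OF that]]
    unfolding periodic_mfg_solution_def mfg_solution_def mean_field_def fokker_planck_def by blast+
  have L2: "tendsto_L2 (Q \<times> {0..T}) (\<lambda>k (x, t). u k x t) (\<lambda>(x, t). u0 x t)" if Q: "compact Q" for Q
  proof (rule uniform_limit_tendsto_L2)
    show "compact (Q \<times> {0..T})" using Q by (intro compact_Times) auto
    show "continuous_on (Q \<times> {0..T}) (\<lambda>(x, t). u k x t)" if "1 \<le> k" for k
      by (rule continuous_on_subset[OF C21_D(1)[OF C21_uk[OF that]]]) auto
    show "continuous_on (Q \<times> {0..T}) (\<lambda>(x, t). u0 x t)"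
      unfolding u0 split_beta by (intro continuous_intros)
    show "\<exists>N. \<forall>k\<ge>N. \<forall>z\<in>Q \<times> {0..T}. \<bar>(case z of (x, t) \<Rightarrow> u k x t) - (case z of (x, t) \<Rightarrow> u0 x t)\<bar> \<le> e" if "0 < e" for e
      using lim_u[OF that] by fastforce
  qed
  have weak: "tendsto_weak_L1 (Q \<times> {0..T}) (\<lambda>k (x, t). m k x t) (\<lambda>(x, t). m0 x t)" if Q: "compact Q" for Q
    unfolding m0
  proof (rule oscillating_density_weak_limit[OF Q _ _ _ \<mu>_continuous \<mu>_periodic \<mu>_mass, where M = "\<lambda>k. M k (m k)"])
    show "m k x t = M k (m k) (real k *\<^sub>R x) t" if "1 \<le> k" for k x t by (rule unscale(2)[OF that])
    show "continuous_on (UNIV \<times> {0..T}) (\<lambda>(x, t). M k (m k) x t)" if "1 \<le> k" for k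
      by (rule C21_D(1)[OF C21_Mk[OF that]])
    show "periodic 1 (\<lambda>x. M k (m k) x t)" if "1 \<le> k" "t \<in> {0..T}" for k t by (rule per_Mk[OF that])
    fix e :: real assume "0 < e"
    from homogenization[OF T_pos this] obtain N :: nat where N: "1 \<le> N"
      "\<forall>k\<ge>N. \<forall>w m. mean_field P (real k) T V w m \<longrightarrow>
        (\<forall>x. \<forall>t\<in>{0..T}. \<bar>w x t - real k * Hbar P 1 * (t - T)\<bar> \<le> e * real k)
        \<and> integral {0..T} (density_gap m) \<le> e"
      by blast
    have "integral {0..T} (density_gap (M k (m k))) \<le> e" if k: "N \<le> k" for k
    proof -
      have "1 \<le> k" using k N(1) by simp
      from N(2) k mf[OF this solution[OF this]] show ?thesis by blast
    qed
    then show "\<exists>N. \<forall>k\<ge>N. integral {0..T} (\<lambda>t. integral (cbox 0 1) (\<lambda>x. \<bar>M k (m k) x t - \<mu> x\<bar>)) \<le> e"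
      unfolding density_gap_def[abs_def] by blast
  qed
  have limit_solution: "effective_solution Hbar bbar P T u0 m0"
    unfolding u0 m0 by (rule effective_problem_solution)
  show ?thesis
    by (intro conjI allI impI ballI limit_solution L2 weak unique[THEN conjunct1] unique[THEN conjunct2])
qed

end
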